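(* Let $G$ be one of the groups $\mathcal{R},\mathcal{G}_l,\mathcal{G}_r,\mathcal{G}_{lr}$ and let $A\in\mathfrak{m}\cdot M_{m,n}$. If $\mathrm{char}(K)=0$, then $A$ is finitely $G$-determined if and only if the embedding $T_A(GA)\hookrightarrow M_{m,n}$ is of finite codimension, i.e. $$\dim_K\left(M_{m,n}/T_A(GA)\right)<\infty.$$
   Context: $K$ is a field, $R=K[[x_1,\ldots,x_s]]$ is the formal power series ring with maximal ideal $\mathfrak{m}$, and $M_{m,n}$ is the $R$-module of $m\times n$ matrices with entries in $R$. Groups and actions: $\mathcal{R}=\mathrm{Aut}(R)$ is the group of $K$-algebra automorphisms of $R$; $\mathcal{G}_l=GL(m,R)\rtimes\mathcal{R}$, $\mathcal{G}_r=GL(n,R)\rtimes\mathcal{R}$, $\mathcal{G}_{lr}=(GL(m,R)\times GL(n,R))\rtimes\mathcal{R}$. They act on $M_{m,n}$ by $\phi(A)=[\phi(a_{ij})]$, $U\cdot\phi(A)$, $\phi(A)\cdot V$, $U\cdot\phi(A)\cdot V$, respectively. $GA$ denotes the orbit of $A$; $A,B$ are $G$-equivalent if $B\in GA$. $A$ is $G$ $k$-determined if every $B\in M_{m,n}$ with $B-A\in\mathfrak{m}^{k+1}\cdot M_{m,n}$ is $G$-equivalent to $A$; $A$ is finitely $G$-determined if it is $G$ $k$-determined for some positive integer $k$. Jets: $\mathrm{jet}_k(A)$ is the class of $A$ in $M^{(k)}_{m,n}=M_{m,n}/\mathfrak{m}^{k+1}M_{m,n}$. $G^{(k)}=\{\mathrm{jet}_k(g)\mid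 g\in G\}$, where $\mathrm{jet}_k(U,V,\phi)=(\mathrm{jet}_k(U),\mathrm{jet}_k(V),\mathrm{jet}_k(\phi))$ with $\mathrm{jet}_k(\phi)(x_i)=\mathrm{jet}_k(\phi(x_i))$ (similarly for the other groups); it is an affine algebraic group with $\mathrm{jet}_k(g)\mathrm{jet}_k(h)=\mathrm{jet}_k(gh)$, acting algebraically on the affine space $M^{(k)}_{m,n}$ by $(\mathrm{jet}_k(g),\mathrm{jet}_k(A))\mapsto\mathrm{jet}_k(gA)$, everything defined over $K$. Tangent space: the orbit $G^{(k)}\mathrm{jet}_k(A)$, formed over an algebraic closure of $K$, is a variety defined over $K$; $T_{\mathrm{jet}_k(A)}(G^{(k)}\mathrm{jet}_k(A))$ is its Zariski tangent space over $K$ at the $K$-rational point $\mathrm{jet}_k(A)$, regarded as a $K$-subspace of $M^{(k)}_{m,n}$. With the maps induced by the projections $M^{(k)}_{m,n}\to M^{(k-1)}_{m,n}$ these form an inverse system, and the tangent space at $A$ to the orbit is the $K$-vector space $T_A(GA):=\varprojlim_{k\ge0}T_{\mathrm{jet}_k(A)}(G^{(k)}\mathrm{jet}_k(A))\subset M_{m,n}$. *)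

theory Defs
  imports
    "HOL-Analysis.Determinants"
    "HOL-Library.Poly_Mapping"
    "HOL-Algebra.Ideal_Product"
    "HOL-Algebra.Algebraic_Closure_Type"
begin

no_notation fps_nth (infixl \<open>$\<close> 75)

section \<open>The ring of formal power series in finitely many variables\<close>

text \<open>
  The type \<open>('s, 'a) mps\<close> is the ring of formal power series over \<open>'a\<close> in variables indexed by the
  finite type \<open>'s\<close>; so the number of variables is \<open>CARD('s)\<close>. A multi-index is an element
  of \<open>nat ^ 's\<close>.
\<close>

typedef ('s, 'a) mps = "UNIV :: (nat ^ 's::finite \<Rightarrow> 'a) set"
  morphisms mps_nth Abs_mps ..

setup_lifting type_definition_mps

lemma mps_eqI: "(\<And>\<alpha>. mps_nth f \<alpha> = mps_nth g \<alpha>) \<Longrightarrow> f = g"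
  by transfer auto

definition splits :: "nat ^ 's::finite \<Rightarrow> ((nat ^ 's) \<times> (nat ^ 's)) set" where
  "splits \<alpha> = {(\<beta>, \<gamma>). \<beta> + \<gamma> = \<alpha>}"

lemma finite_le_multiindex: "finite {\<beta> :: nat ^ 's::finite. \<forall>i. \<beta> $ i \<le> b i}"
proof (rule finite_subset)
  show "{\<beta> :: nat ^ 's. \<forall>i. \<beta> $ i \<le> b i} \<subseteq> vec_lambda ` (PiE UNIV (\<lambda>i. {..b i}))"
  proof
    fix \<beta> :: "nat ^ 's" assume "\<beta> \<in> {\<beta>. \<forall>i. \<beta> $ i \<le> b i}"
    then have "vec_nth \<beta> \<in> PiE UNIV (\<lambda>i. {..b i})" by auto
    moreover have "\<beta> = vec_lambda (vec_nth \<beta>)" by simp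
    ultimately show "\<beta> \<in> vec_lambda ` (PiE UNIV (\<lambda>i. {..b i}))" by blast
  qed
  show "finite (vec_lambda ` (PiE UNIV (\<lambda>i::'s. {..b i})))"
    by (intro finite_imageI finite_PiE) auto
qed

lemma finite_splits [simp]: "finite (splits \<alpha>)"
proof (rule finite_subset)
  let ?B = "{\<beta>. \<forall>i. \<beta> $ i \<le> \<alpha> $ i}"
  show "splits \<alpha> \<subseteq> ?B \<times> ?B" by (auto simp: splits_def split: if_splits)
  show "finite (?B \<times> ?B)" by (intro finite_cartesian_product finite_le_multiindex)
qed

lemma mem_splits: "(\<beta>, \<gamma>) \<in> splits \<alpha> \<longleftrightarrow> \<beta> + \<gamma> = \<alpha>"
  by (simp add: splits_def)

instantiation mps :: (finite, comm_ring_1) comm_ring_1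
begin

lift_definition zero_mps :: "('a, 'b) mps" is "\<lambda>_. 0" .
lift_definition one_mps :: "('a, 'b) mps" is "\<lambda>\<alpha>. if \<alpha> = 0 then 1 else 0" .
lift_definition plus_mps :: "('a, 'b) mps \<Rightarrow> ('a, 'b) mps \<Rightarrow> ('a, 'b) mps" is "\<lambda>f g \<alpha>. f \<alpha> + g \<alpha>" .
lift_definition minus_mps :: "('a, 'b) mps \<Rightarrow> ('a, 'b) mps \<Rightarrow> ('a, 'b) mps" is "\<lambda>f g \<alpha>. f \<alpha> - g \<alpha>" .
lift_definition uminus_mps :: "('a, 'b) mps \<Rightarrow> ('a, 'b) mps" is "\<lambda>f \<alpha>. - f \<alpha>" .
lift_definition times_mps :: "('a, 'b) mps \<Rightarrow> ('a, 'b) mps \<Rightarrow> ('a, 'b) mps"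
  is "\<lambda>f g \<alpha>. \<Sum>(\<beta>, \<gamma>)\<in>splits \<alpha>. f \<beta> * g \<gamma>" .

instance
proof
  fix a b c :: "('a, 'b) mps"
  show "a * b * c = a * (b * c)"
  proof (rule mps_eqI)
    fix \<alpha>
    let ?a = "mps_nth a" and ?b = "mps_nth b" and ?c = "mps_nth c"
    have "mps_nth (a * b * c) \<alpha> =
        (\<Sum>p\<in>splits \<alpha>. \<Sum>q\<in>splits (fst p). ?a (fst q) * ?b (snd q) * ?c (snd p))"
      by (simp add: times_mps.rep_eq case_prod_beta sum_distrib_right)
    also have "\<dots> = (\<Sum>(p, q)\<in>Sigma (splits \<alpha>) (\<lambda>p. splits (fst p)).
        ?a (fst q) * ?b (snd q) * ?c (snd p))"
      by (simp add: sum.Sigma)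
    also have "\<dots> = (\<Sum>(p, q)\<in>Sigma (splits \<alpha>) (\<lambda>p. splits (snd p)).
        ?a (fst p) * (?b (fst q) * ?c (snd q)))"
      by (rule sum.reindex_bij_witness
            [where i = "\<lambda>(p, q). ((fst p + fst q, snd q), (fst p, fst q))"
               and j = "\<lambda>(p, q). ((fst q, snd q + snd p), (snd q, snd p))"])
         (auto simp: splits_def algebra_simps)
    also have "\<dots> = (\<Sum>p\<in>splits \<alpha>. \<Sum>q\<in>splits (snd p). ?a (fst p) * (?b (fst q) * ?c (snd q)))"
      by (simp add: sum.Sigma)
    also have "\<dots> = mps_nth (a * (b * c)) \<alpha>"
      by (simp add: times_mps.rep_eq case_prod_beta sum_distrib_left)
    finally show "mps_nth (a * b * c) \<alpha> = mps_nth (a * (b * c)) \<alpha>" .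
  qed
  show "a * b = b * a"
  proof (rule mps_eqI)
    fix \<alpha>
    show "mps_nth (a * b) \<alpha> = mps_nth (b * a) \<alpha>"
      unfolding times_mps.rep_eq
      by (rule sum.reindex_bij_witness[where i = prod.swap and j = prod.swap])
         (auto simp: splits_def algebra_simps)
  qed
  show "1 * a = a"
  proof (rule mps_eqI)
    fix \<alpha>
    have "mps_nth (1 * a) \<alpha> =
        (\<Sum>p\<in>splits \<alpha>. if p = (0, \<alpha>) then mps_nth a \<alpha> else 0)"
      unfolding times_mps.rep_eq one_mps.rep_eq
      by (rule sum.cong) (auto simp: splits_def split: if_splits)
    also have "\<dots> = mps_nth a \<alpha>" by (subst sum.delta) (simp_all add: mem_splits)
    finally show "mps_nth (1 * a) \<alpha> = mps_nth a \<alpha>" .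
  qed
  show "(a + b) * c = a * c + b * c"
    by (rule mps_eqI)
       (simp add: times_mps.rep_eq plus_mps.rep_eq case_prod_beta distrib_right sum.distrib)
  show "(0::('a, 'b) mps) \<noteq> 1"
    by (metis one_mps.rep_eq zero_mps.rep_eq zero_neq_one)
qed (transfer; simp add: algebra_simps)+

end

lift_definition mps_const :: "'a::zero \<Rightarrow> ('s::finite, 'a) mps" is "\<lambda>c \<alpha>. if \<alpha> = 0 then c else 0" .

lift_definition mps_X :: "'s::finite \<Rightarrow> ('s, 'a::zero_neq_one) mps"
  is "\<lambda>i \<alpha>. if \<alpha> = axis i 1 then 1 else 0" .

lift_definition mps_map :: "('a \<Rightarrow> 'b) \<Rightarrow> ('s::finite, 'a) mps \<Rightarrow> ('s, 'b) mps" is "\<lambda>h f \<alpha>. h (f \<alpha>)" .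

definition mdeg :: "nat ^ 's::finite \<Rightarrow> nat" where
  "mdeg \<alpha> = (\<Sum>i\<in>UNIV. \<alpha> $ i)"

definition max_ideal :: "('s::finite, 'a::field) mps set" where
  "max_ideal = {f. mps_nth f 0 = 0}"

primrec ideal_pow :: "'r::comm_ring_1 set \<Rightarrow> nat \<Rightarrow> 'r set" where
  "ideal_pow I 0 = UNIV"
| "ideal_pow I (Suc k) = ideal_prod ring_of_type_algebra I (ideal_pow I k)"

section \<open>Matrices, groups and orbits\<close>

type_synonym ('s, 'a, 'm, 'n) mps_mat = "(('s, 'a) mps ^ 'n) ^ 'm"

text \<open>The submodule \<open>I \<cdot> M\<^sub>m\<^sub>,\<^sub>n\<close> of the free module \<open>M\<^sub>m\<^sub>,\<^sub>n\<close>, for an ideal \<open>I\<close>.\<close>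

definition ideal_mats :: "'r set \<Rightarrow> ('r ^ 'n::finite ^ 'm::finite) set" where
  "ideal_mats I = {A. \<forall>i j. A $ i $ j \<in> I}"

definition alg_aut :: "(('s::finite, 'a::field) mps \<Rightarrow> ('s, 'a) mps) \<Rightarrow> bool" where
  "alg_aut \<phi> \<longleftrightarrow> bij \<phi> \<and>
     (\<forall>f g. \<phi> (f + g) = \<phi> f + \<phi> g) \<and> (\<forall>f g. \<phi> (f * g) = \<phi> f * \<phi> g) \<and>
     (\<forall>c. \<phi> (mps_const c) = mps_const c)"

datatype grp = Grp_R | Grp_l | Grp_r | Grp_lr

text \<open>
  All four groups are regarded as subsets of the largest one; its elements are triples \<open>(U, V, \<phi>)\<close>.
  The group is given by its name only, so that it makes sense over every coefficient field.
\<close>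

definition grp_elems ::
  "grp \<Rightarrow> (('s::finite, 'a::field, 'm::finite, 'm) mps_mat \<times> ('s, 'a, 'n::finite, 'n) mps_mat \<times>
     (('s, 'a) mps \<Rightarrow> ('s, 'a) mps)) set" where
  "grp_elems G = {(U, V, \<phi>). alg_aut \<phi> \<and>
     (if G \<in> {Grp_l, Grp_lr} then invertible U else U = mat 1) \<and>
     (if G \<in> {Grp_r, Grp_lr} then invertible V else V = mat 1)}"

definition grp_act ::
  "('s::finite, 'a::field, 'm::finite, 'm) mps_mat \<times> ('s, 'a, 'n::finite, 'n) mps_mat \<times>
     (('s, 'a) mps \<Rightarrow> ('s, 'a) mps) \<Rightarrow> ('s, 'a, 'm, 'n) mps_mat \<Rightarrow> ('s, 'a, 'm, 'n) mps_mat" where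
  "grp_act = (\<lambda>(U, V, \<phi>) A. U ** map_matrix \<phi> A ** V)"

definition grp_orbit ::
  "grp \<Rightarrow> ('s::finite, 'a::field, 'm::finite, 'n::finite) mps_mat \<Rightarrow> ('s, 'a, 'm, 'n) mps_mat set" where
  "grp_orbit G A = {grp_act g A | g. g \<in> grp_elems G}"

definition determined ::
  "grp \<Rightarrow> nat \<Rightarrow> ('s::finite, 'a::field, 'm::finite, 'n::finite) mps_mat \<Rightarrow> bool" where
  "determined G k A \<longleftrightarrow>
     (\<forall>B. B - A \<in> ideal_mats (ideal_pow max_ideal (k + 1)) \<longrightarrow> B \<in> grp_orbit G A)"

definition finitely_determined ::
  "grp \<Rightarrow> ('s::finite, 'a::field, 'm::finite, 'n::finite) mps_mat \<Rightarrow> bool" where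
  "finitely_determined G A \<longleftrightarrow> (\<exists>k>0. determined G k A)"

section \<open>Zariski tangent spaces\<close>

text \<open>
  Polynomials in variables indexed by \<open>'v\<close>. Only those in the variables of a given finite set \<open>S\<close>
  are used below, as the coordinate ring of the affine space \<open>\<bbbA>\<^sup>S\<close>. Points of \<open>\<bbbA>\<^sup>S\<close> are functions
  on \<open>'v\<close> that vanish outside \<open>S\<close>.
\<close>

type_synonym ('v, 'a) mpoly = "('v \<Rightarrow>\<^sub>0 nat) \<Rightarrow>\<^sub>0 'a"

definition mpoly_vars :: "('v, 'a::zero) mpoly \<Rightarrow> 'v set" where
  "mpoly_vars f = (\<Union>e\<in>Poly_Mapping.keys f. Poly_Mapping.keys e)"

definition mpoly_eval ::
  "('a::zero \<Rightarrow> 'b::comm_semiring_1) \<Rightarrow> ('v \<Rightarrow> 'b) \<Rightarrow> ('v, 'a) mpoly \<Rightarrow> 'b" where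
  "mpoly_eval h x f = (\<Sum>e\<in>Poly_Mapping.keys f. h (Poly_Mapping.lookup f e) *
     (\<Prod>v\<in>Poly_Mapping.keys e. x v ^ Poly_Mapping.lookup e v))"

definition mpoly_deriv :: "'v \<Rightarrow> ('v, 'a::comm_semiring_1) mpoly \<Rightarrow> ('v, 'a) mpoly" where
  "mpoly_deriv v f = (\<Sum>e\<in>Poly_Mapping.keys f.
     Poly_Mapping.single (e - Poly_Mapping.single v 1)
       (of_nat (Poly_Mapping.lookup e v) * Poly_Mapping.lookup f e))"

text \<open>The ideal, over the ground field, of a set of points over the algebraic closure.\<close>

definition vanishing_ideal :: "'v set \<Rightarrow> ('v \<Rightarrow> 'a::field alg_closure) set \<Rightarrow> ('v, 'a) mpoly set" where
  "vanishing_ideal S Z = {f. mpoly_vars f \<subseteq> S \<and> (\<forall>x\<in>Z. mpoly_eval to_ac x f = 0)}"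

text \<open>
  The Zariski tangent space, over the ground field, at the rational point \<open>p\<close> of a locally closed
  subset \<open>Z\<close> of \<open>\<bbbA>\<^sup>S\<close> as a subspace of the ambient vector space. Since \<open>Z\<close> is open
  in its closure, it is cut out by the differentials at \<open>p\<close> of the polynomials vanishing on \<open>Z\<close>.
\<close>

definition zariski_tangent ::
  "'v set \<Rightarrow> ('v \<Rightarrow> 'a::field alg_closure) set \<Rightarrow> ('v \<Rightarrow> 'a) \<Rightarrow> ('v \<Rightarrow> 'a) set" where
  "zariski_tangent S Z p = {w. (\<forall>v. v \<notin> S \<longrightarrow> w v = 0) \<and>
     (\<forall>f\<in>vanishing_ideal S Z. (\<Sum>v\<in>S. mpoly_eval id p (mpoly_deriv v f) * w v) = 0)}"

section \<open>Jets and the tangent space to the orbit\<close>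

text \<open>
  The quotient \<open>M\<^sub>m\<^sub>,\<^sub>n / \<mm>\<^sup>k\<^sup>+\<^sup>1 M\<^sub>m\<^sub>,\<^sub>n\<close> is identified with the affine space on the coefficients of
  degree at most \<open>k\<close> of the entries; see \<open>jet_eq_iff\<close> and \<open>range_jet\<close> below.
\<close>

definition jet_coords :: "nat \<Rightarrow> ('m \<times> 'n \<times> (nat ^ 's::finite)) set" where
  "jet_coords k = {(i, j, \<alpha>). mdeg \<alpha> \<le> k}"

definition jet ::
  "nat \<Rightarrow> ('s::finite, 'a::zero, 'm::finite, 'n::finite) mps_mat \<Rightarrow> ('m \<times> 'n \<times> (nat ^ 's) \<Rightarrow> 'a)" where
  "jet k A = (\<lambda>(i, j, \<alpha>). if mdeg \<alpha> \<le> k then mps_nth (A $ i $ j) \<alpha> else 0)"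

text \<open>
  The orbit of the \<open>k\<close>-jet of \<open>A\<close> under the \<open>k\<close>-jets of the group, over the algebraic closure.
  The jet of \<open>g\<close> sends the jet of \<open>A\<close> to the jet of \<open>g A\<close>.
\<close>

definition jet_orbit ::
  "grp \<Rightarrow> nat \<Rightarrow> ('s::finite, 'a::field, 'm::finite, 'n::finite) mps_mat \<Rightarrow>
     ('m \<times> 'n \<times> (nat ^ 's) \<Rightarrow> 'a alg_closure) set" where
  "jet_orbit G k A = {jet k (grp_act g (map_matrix (mps_map to_ac) A)) | g. g \<in> grp_elems G}"

definition jet_tangent ::
  "grp \<Rightarrow> nat \<Rightarrow> ('s::finite, 'a::field, 'm::finite, 'n::finite) mps_mat \<Rightarrow>
     ('m \<times> 'n \<times> (nat ^ 's) \<Rightarrow> 'a) set" where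
  "jet_tangent G k A = zariski_tangent (jet_coords k) (jet_orbit G k A) (jet k A)"

text \<open>
  The inverse limit of the tangent spaces. A compatible sequence of jets is the sequence of jets of
  a unique matrix, which is how the limit is a subset of \<open>M\<^sub>m\<^sub>,\<^sub>n\<close>.
\<close>

definition tangent_space ::
  "grp \<Rightarrow> ('s::finite, 'a::field, 'm::finite, 'n::finite) mps_mat \<Rightarrow> ('s, 'a, 'm, 'n) mps_mat set" where
  "tangent_space G A = {B. \<forall>k. jet k B \<in> jet_tangent G k A}"

section \<open>Codimension\<close>

definition mat_scale ::
  "'a::field \<Rightarrow> ('s::finite, 'a, 'm::finite, 'n::finite) mps_mat \<Rightarrow> ('s, 'a, 'm, 'n) mps_mat" where
  "mat_scale c A = map_matrix (\<lambda>f. mps_const c * f) A"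

lemma mps_nth_const_mult [simp]:
  "mps_nth (mps_const c * f) \<alpha> = c * mps_nth (f :: ('s::finite, 'a::comm_ring_1) mps) \<alpha>"
proof -
  have "mps_nth (mps_const c * f) \<alpha> =
      (\<Sum>p\<in>splits \<alpha>. if p = (0, \<alpha>) then c * mps_nth f \<alpha> else 0)"
    unfolding times_mps.rep_eq mps_const.rep_eq
    by (rule sum.cong) (auto simp: splits_def split: if_splits)
  also have "\<dots> = c * mps_nth f \<alpha>" by (subst sum.delta) (simp_all add: mem_splits)
  finally show ?thesis .
qed

global_interpretation mps_mat: vector_space mat_scale
  by unfold_locales
     (auto simp: mat_scale_def vec_eq_iff plus_mps.rep_eq one_mps.rep_eq algebra_simps
           intro!: mps_eqI)

text \<open>
  \<open>coset T A\<close> is the class of \<open>A\<close> in the quotient by the subspace \<open>T\<close>. The quotient has finite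
  dimension iff it is the linear span of finitely many classes, i.e. the image of the span of
  a finite set.
\<close>

definition coset :: "'v::ab_group_add set \<Rightarrow> 'v \<Rightarrow> 'v set" where
  "coset T A = {B. B - A \<in> T}"

definition finite_codim :: "('s::finite, 'a::field, 'm::finite, 'n::finite) mps_mat set \<Rightarrow> bool" where
  "finite_codim T \<longleftrightarrow>
     (\<exists>F. finite F \<and> range (coset T) = coset T ` mps_mat.span F)"

section \<open>Consistency of the encodings\<close>

lemma mdeg_0 [simp]: "mdeg 0 = 0"
  by (simp add: mdeg_def)

lemma mdeg_add [simp]: "mdeg (\<alpha> + \<beta>) = mdeg \<alpha> + mdeg \<beta>"
  by (simp add: mdeg_def sum.distrib)

lemma mdeg_eq_0_iff [simp]: "mdeg \<alpha> = 0 \<longleftrightarrow> \<alpha> = 0"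
  by (auto simp: mdeg_def vec_eq_iff)

lemma mdeg_axis [simp]: "mdeg (axis i n) = n"
  by (simp add: mdeg_def axis_def)

lemma finite_jet_coords: "finite (jet_coords k :: ('m::finite \<times> 'n::finite \<times> (nat ^ 's::finite)) set)"
proof (rule finite_subset)
  show "(jet_coords k :: ('m \<times> 'n \<times> (nat ^ 's)) set) \<subseteq>
      UNIV \<times> UNIV \<times> {\<alpha>. \<forall>i. \<alpha> $ i \<le> k}"
  proof -
    have "\<alpha> $ i \<le> mdeg \<alpha>" for \<alpha> :: "nat ^ 's" and i
      unfolding mdeg_def by (rule member_le_sum) auto
    then show ?thesis unfolding jet_coords_def using order_trans by blast
  qed
  show "finite ((UNIV :: 'm set) \<times> (UNIV :: 'n set) \<times> {\<alpha> :: nat ^ 's. \<forall>i. \<alpha> $ i \<le> k})"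
    by (intro finite_cartesian_product finite_le_multiindex) auto
qed

lemma mps_nth_sum: "mps_nth (\<Sum>x\<in>A. f x) \<alpha> = (\<Sum>x\<in>A. mps_nth (f x) \<alpha>)"
  by (induction A rule: infinite_finite_induct) (auto simp: zero_mps.rep_eq plus_mps.rep_eq)

lemma mps_nth_X_mult:
  "mps_nth (mps_X i * (f :: ('s::finite, 'a::comm_ring_1) mps)) \<alpha> =
     (if \<alpha> $ i = 0 then 0 else mps_nth f (\<alpha> - axis i 1))"
proof -
  have *: "axis i 1 + (\<alpha> - axis i 1) = \<alpha> \<longleftrightarrow> \<alpha> $ i \<noteq> 0"
    by (auto simp: vec_eq_iff axis_def)
  have "mps_nth (mps_X i * f) \<alpha> =
      (\<Sum>p\<in>splits \<alpha>. if p = (axis i 1, \<alpha> - axis i 1) then mps_nth f (\<alpha> - axis i 1) else 0)"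
    unfolding times_mps.rep_eq mps_X.rep_eq
    by (rule sum.cong) (auto simp: splits_def split: if_splits)
  also have "\<dots> = (if \<alpha> $ i = 0 then 0 else mps_nth f (\<alpha> - axis i 1))"
    by (subst sum.delta) (use * in \<open>simp_all add: mem_splits\<close>)
  finally show ?thesis .
qed

lemma ideal_pow_max_ideal_iff:
  "f \<in> ideal_pow max_ideal k \<longleftrightarrow>
     (\<forall>\<alpha>. mdeg \<alpha> < k \<longrightarrow> mps_nth (f :: ('s::finite, 'a::field) mps) \<alpha> = 0)"
proof (induction k arbitrary: f)
  case (Suc k)
  let ?P = "ideal_prod ring_of_type_algebra (max_ideal :: ('s, 'a) mps set) (ideal_pow max_ideal k)"
  have mult: "a * b \<in> ?P" if "a \<in> max_ideal" "b \<in> ideal_pow max_ideal k" for a b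
    using ideal_prod.prod[OF that, of ring_of_type_algebra] by (simp add: ring_of_type_algebra_def)
  have add: "a + b \<in> ?P" if "a \<in> ?P" "b \<in> ?P" for a b
    using ideal_prod.sum[OF that] by (simp add: ring_of_type_algebra_def)
  have "mps_nth f \<alpha> = 0" if "f \<in> ?P" "mdeg \<alpha> < Suc k" for \<alpha>
    using that
  proof (induction arbitrary: \<alpha> rule: ideal_prod.induct)
    case (prod a b)
    have "mps_nth a \<beta> * mps_nth b \<gamma> = 0" if "\<beta> + \<gamma> = \<alpha>" for \<beta> \<gamma>
    proof (cases "\<beta> = 0")
      case True
      then show ?thesis using prod by (simp add: max_ideal_def)
    next
      case False
      then have "mdeg \<beta> > 0" using mdeg_eq_0_iff[of \<beta>] by linarith
      then have "mdeg \<gamma> < k" using prod.prems that by auto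
      then show ?thesis using prod.hyps Suc.IH by auto
    qed
    then show ?case
      by (auto simp: ring_of_type_algebra_def times_mps.rep_eq splits_def intro!: sum.neutral)
  next
    case (sum a b)
    then show ?case by (simp add: ring_of_type_algebra_def plus_mps.rep_eq)
  qed
  moreover have "f \<in> ?P" if f: "\<forall>\<alpha>. mdeg \<alpha> < Suc k \<longrightarrow> mps_nth f \<alpha> = 0"
  proof -
    define s :: "nat ^ 's \<Rightarrow> 's" where "s = (\<lambda>\<alpha>. SOME i. \<alpha> $ i \<noteq> 0)"
    define g where "g = (\<lambda>i. Abs_mps (\<lambda>\<beta>. if s (\<beta> + axis i 1) = i
      then mps_nth f (\<beta> + axis i 1) else 0) :: ('s, 'a) mps)"
    have g: "mps_nth (g i) \<beta> =
        (if s (\<beta> + axis i 1) = i then mps_nth f (\<beta> + axis i 1) else 0)" for i \<beta>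
      by (simp add: g_def Abs_mps_inverse)
    have "f = (\<Sum>i\<in>UNIV. mps_X i * g i)"
    proof (rule mps_eqI)
      fix \<alpha> :: "nat ^ 's"
      have *: "\<alpha> - axis i 1 + axis i 1 = \<alpha>" if "\<alpha> $ i \<noteq> 0" for i
        using that by (auto simp: vec_eq_iff axis_def)
      have "mps_nth (\<Sum>i\<in>UNIV. mps_X i * g i) \<alpha> =
          (\<Sum>i\<in>UNIV. if \<alpha> $ i = 0 then 0 else if s \<alpha> = i then mps_nth f \<alpha> else 0)"
        unfolding mps_nth_sum mps_nth_X_mult g using * by (intro sum.cong) auto
      also have "\<dots> = mps_nth f \<alpha>"
      proof (cases "\<alpha> = 0")
        case True
        then show ?thesis using f by simp
      next
        case False
        then have "\<exists>i. \<alpha> $ i \<noteq> 0" by (auto simp: vec_eq_iff)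
        from someI_ex[OF this] have s: "\<alpha> $ s \<alpha> \<noteq> 0" by (simp add: s_def)
        have "(\<Sum>i\<in>UNIV. if \<alpha> $ i = 0 then 0 else if s \<alpha> = i then mps_nth f \<alpha> else 0) =
            (\<Sum>i\<in>UNIV. if s \<alpha> = i then mps_nth f \<alpha> else 0)"
          using s by (intro sum.cong) auto
        then show ?thesis by simp
      qed
      finally show "mps_nth f \<alpha> = mps_nth (\<Sum>i\<in>UNIV. mps_X i * g i) \<alpha>" ..
    qed
    moreover have "mps_X i * g i \<in> ?P" for i
    proof (rule mult)
      have "axis i 1 \<noteq> (0 :: nat ^ 's)" by (metis axis_nth zero_index zero_neq_one)
      then show "mps_X i \<in> (max_ideal :: ('s, 'a) mps set)"
        by (simp add: max_ideal_def mps_X.rep_eq)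
      show "g i \<in> ideal_pow max_ideal k"
        unfolding Suc.IH g using f by simp
    qed
    moreover have "(\<Sum>i\<in>S. h i) \<in> ?P" if "finite S" "\<And>i. h i \<in> ?P" for S :: "'s set" and h
      using that
    proof (induction S rule: finite_induct)
      case empty
      have "(0 :: ('s, 'a) mps) * 0 \<in> ?P"
        by (rule mult) (simp_all add: max_ideal_def zero_mps.rep_eq Suc.IH[unfolded max_ideal_def])
      then show ?case by simp
    qed (auto intro: add)
    ultimately show ?thesis by simp
  qed
  ultimately show ?case by auto
qed auto

lemma jet_eq_iff:
  "jet k A = jet k B \<longleftrightarrow>
     A - (B :: ('s::finite, 'a::field, 'm::finite, 'n::finite) mps_mat)
       \<in> ideal_mats (ideal_pow max_ideal (k + 1))"
  unfolding jet_def ideal_mats_def mem_Collect_eq ideal_pow_max_ideal_iff fun_eq_iff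
  by (simp add: minus_mps.rep_eq less_Suc_eq_le)

lemma range_jet:
  "range (jet k :: ('s::finite, 'a::zero, 'm::finite, 'n::finite) mps_mat \<Rightarrow> _) =
     {w. \<forall>v. v \<notin> jet_coords k \<longrightarrow> w v = 0}"
proof (intro equalityI subsetI)
  fix w :: "'m \<times> 'n \<times> (nat ^ 's) \<Rightarrow> 'a" assume w: "w \<in> {w. \<forall>v. v \<notin> jet_coords k \<longrightarrow> w v = 0}"
  have "w = jet k (\<chi> i j. Abs_mps (\<lambda>\<alpha>. w (i, j, \<alpha>)))"
    using w by (auto simp: jet_def jet_coords_def fun_eq_iff Abs_mps_inverse)
  then show "w \<in> range (jet k :: ('s, 'a, 'm, 'n) mps_mat \<Rightarrow> _)" by blast
qed (auto simp: jet_def jet_coords_def)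

lemma zariski_tangent_add:
  assumes "u \<in> zariski_tangent S Z p" "w \<in> zariski_tangent S Z p"
  shows "(\<lambda>v. u v + w v) \<in> zariski_tangent S Z p"
  using assms by (simp add: zariski_tangent_def distrib_left sum.distrib)

lemma zariski_tangent_scale:
  assumes "w \<in> zariski_tangent S Z p"
  shows "(\<lambda>v. c * w v) \<in> zariski_tangent S Z p"
proof -
  have "(\<Sum>v\<in>S. d v * (c * w v)) = c * (\<Sum>v\<in>S. d v * w v)" for d
    by (simp add: sum_distrib_left mult.left_commute)
  then show ?thesis using assms by (simp add: zariski_tangent_def)
qed

lemma jet_0: "jet k (0 :: (_, 'a::comm_ring_1, _, _) mps_mat) = (\<lambda>_. 0)"
  by (simp add: jet_def zero_mps.rep_eq fun_eq_iff)

lemma jet_add: "jet k (A + B) = (\<lambda>v. jet k A v + jet k (B :: (_, 'a::comm_ring_1, _, _) mps_mat) v)"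
  by (simp add: jet_def plus_mps.rep_eq fun_eq_iff)

lemma jet_scale: "jet k (mat_scale c A) = (\<lambda>v. c * jet k A v)"
  by (simp add: jet_def mat_scale_def fun_eq_iff)

lemma subspace_tangent_space: "mps_mat.subspace (tangent_space G A)"
proof (rule mps_mat.subspaceI)
  show "0 \<in> tangent_space G A"
    by (simp add: tangent_space_def jet_tangent_def zariski_tangent_def jet_0)
qed (simp_all add: tangent_space_def jet_tangent_def jet_add jet_scale
      zariski_tangent_add zariski_tangent_scale)

end

theory Submission
  imports Defs
begin

text \<open>
  Let \<open>\<tau>(A)\<close> be the set of all \<open>u A + A v + \<Sum>\<^sub>i \<xi>\<^sub>i \<partial>\<^sub>i A\<close> with \<open>\<xi>\<^sub>i \<in> \<mm>\<close>, where \<open>u = 0\<close> or \<open>v = 0\<close> if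
  the group has no left or no right factor.

  In characteristic 0, every tangent vector to the orbit of the \<open>k\<close>-jet of \<open>A\<close> is the jet of an
  element of \<open>\<tau>(A)\<close>. Indeed, the coordinates of the jet of \<open>g A\<close> are polynomials in the parameters
  of \<open>g\<close>. Take a maximal algebraically independent family of these coordinates, and enlarge it to a
  maximal one by some of the parameters. The remaining coordinates and parameters satisfy polynomial
  relations over it; one of minimal degree has a nonzero derivative in the dependent variable, so at
  a rational group element \<open>g\<close> where none of these derivatives vanishes, the relations show that
  every tangent vector at \<open>g A\<close> is in the image of the derivative of the orbit map. Translating by
  the inverse of \<open>g\<close> gives the claim at \<open>A\<close>.

  The tangent space \<open>T\<close> is closed in the \<open>\<mm>\<close>-adic topology, so if it has finite codimension, then
  \<open>\<mm>\<^sup>c M \<subseteq> T\<close> for some \<open>c\<close>, hence \<open>\<mm>\<^sup>c M \<subseteq> \<tau>(A) + \<mm>\<^sup>c\<^sup>+\<^sup>1 M\<close>. As \<open>\<tau>(A)\<close> is a module, errors of order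
  \<open>c + j\<close> can be removed, up to order \<open>c + j + 1\<close>, by group elements that are trivial up to order
  \<open>j\<close>; once \<open>j > c\<close>, the quadratic terms in the Taylor expansion do not matter, and a Newton
  iteration moves \<open>A\<close> to any sufficiently close matrix.

  Conversely, if \<open>A\<close> is \<open>k\<close>-determined and \<open>W \<in> \<mm>\<^sup>k\<^sup>+\<^sup>1 M\<close>, then the whole line \<open>A + t W\<close>, \<open>t \<in> K\<close>,
  is in the orbit, so polynomials vanishing on the orbit vanish on it, and \<open>W\<close> is a tangent vector.
\<close>

text \<open>The tangent space is defined by all polynomials that vanish on an orbit over the
  algebraic closure, and these are not known explicitly. The only ones exploited are relations
  between the coordinate polynomials of the orbit map; dimension theory is replaced by counting
  equations and unknowns. To have these polynomials at all, the action is defined for coefficients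
  in an arbitrary commutative ring and is natural in that ring: over a polynomial ring it produces
  the orbit map, over K[t] its linear coefficient is the derivative of the orbit map, over the
  closure it gives the geometric orbit. One Taylor formula with remainder in a closed ideal yields
  both expansions that are needed: modulo t^2 for derivatives, modulo a power of the maximal ideal
  for the Newton iteration. Characteristic 0 enters in two ways: a positive exponent is a nonzero
  scalar, so a minimal relation has a nonzero derivative; and K is infinite, so polynomial
  identities can be tested at rational points and finitely many satisfiable nonvanishing conditions
  have a common rational solution.\<close>

declare One_nat_def [simp del]

section \<open>Ring homomorphisms and the order of power series\<close>

definition ord_ge :: "nat \<Rightarrow> ('s::finite, 'a::zero) mps \<Rightarrow> bool" where
  "ord_ge k f \<longleftrightarrow> (\<forall>\<alpha>. mdeg \<alpha> < k \<longrightarrow> mps_nth f \<alpha> = 0)"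

text \<open>A predicate on bare functions, so that substitution, change of coefficients, evaluation
  of polynomials and the constant term of a polynomial all fall under the same rules.\<close>

definition ring_morph :: "('a::comm_ring_1 \<Rightarrow> 'b::comm_ring_1) \<Rightarrow> bool" where
  "ring_morph h \<longleftrightarrow> h 1 = 1 \<and> (\<forall>x y. h (x + y) = h x + h y) \<and> (\<forall>x y. h (x * y) = h x * h y)"

lemma ring_morph_1: "ring_morph h \<Longrightarrow> h 1 = 1"
  and ring_morph_add: "ring_morph h \<Longrightarrow> h (x + y) = h x + h y"
  and ring_morph_mult: "ring_morph h \<Longrightarrow> h (x * y) = h x * h y"
  by (simp_all add: ring_morph_def)

lemma ring_morph_0: "ring_morph h \<Longrightarrow> h 0 = 0"
  by (metis add_cancel_right_right ring_morph_add)

lemma ring_morph_minus: "ring_morph h \<Longrightarrow> h (- x) = - h x"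
  using ring_morph_add[of h "- x" x] by (simp add: ring_morph_0 eq_neg_iff_add_eq_0)

lemma ring_morph_diff: "ring_morph h \<Longrightarrow> h (x - y) = h x - h y"
  using ring_morph_add[of h "x - y" y] by (simp add: eq_diff_eq)

lemma ring_morph_sum: "ring_morph h \<Longrightarrow> h (\<Sum>i\<in>I. f i) = (\<Sum>i\<in>I. h (f i))"
  by (induction I rule: infinite_finite_induct) (auto simp: ring_morph_0 ring_morph_add)

lemma ring_morph_prod: "ring_morph h \<Longrightarrow> h (\<Prod>i\<in>I. f i) = (\<Prod>i\<in>I. h (f i))"
  by (induction I rule: infinite_finite_induct) (auto simp: ring_morph_1 ring_morph_mult)

lemma ring_morph_power: "ring_morph h \<Longrightarrow> h (x ^ n) = h x ^ n"
  by (induction n) (auto simp: ring_morph_1 ring_morph_mult)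

lemma ring_morph_of_nat: "ring_morph h \<Longrightarrow> h (of_nat n) = of_nat n"
  by (induction n) (auto simp: ring_morph_0 ring_morph_1 ring_morph_add)

lemmas ring_morph_simps = ring_morph_0 ring_morph_1 ring_morph_add ring_morph_mult
  ring_morph_minus ring_morph_diff ring_morph_sum ring_morph_prod ring_morph_power

lemma ring_morph_comp: "ring_morph g \<Longrightarrow> ring_morph h \<Longrightarrow> ring_morph (\<lambda>x. g (h x))"
  by (simp add: ring_morph_def)

lemmas mps_nth_simps = zero_mps.rep_eq plus_mps.rep_eq minus_mps.rep_eq uminus_mps.rep_eq

lemma ord_ge_0 [simp]: "ord_ge 0 f"
  by (simp add: ord_ge_def)

lemma ord_ge_zero [simp]: "ord_ge k (0 :: ('s::finite, 'a::comm_ring_1) mps)"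
  by (simp add: ord_ge_def mps_nth_simps)

lemma ord_ge_add: "ord_ge k f \<Longrightarrow> ord_ge k g \<Longrightarrow> ord_ge k (f + g :: ('s::finite, 'a::comm_ring_1) mps)"
  by (simp add: ord_ge_def mps_nth_simps)

lemma ord_ge_diff: "ord_ge k f \<Longrightarrow> ord_ge k g \<Longrightarrow> ord_ge k (f - g :: ('s::finite, 'a::comm_ring_1) mps)"
  by (simp add: ord_ge_def mps_nth_simps)

lemma ord_ge_uminus: "ord_ge k f \<Longrightarrow> ord_ge k (- f :: ('s::finite, 'a::comm_ring_1) mps)"
  by (simp add: ord_ge_def mps_nth_simps)

lemma ord_ge_sum: "(\<And>i. i \<in> I \<Longrightarrow> ord_ge k (f i)) \<Longrightarrow> ord_ge k (\<Sum>i\<in>I. f i :: ('s::finite, 'a::comm_ring_1) mps)"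
  by (induction I rule: infinite_finite_induct) (auto intro: ord_ge_add)

lemma ord_ge_mono: "ord_ge k f \<Longrightarrow> l \<le> k \<Longrightarrow> ord_ge l f"
  by (auto simp: ord_ge_def)

lemma ord_ge_mult:
  assumes "ord_ge j f" "ord_ge k g"
  shows "ord_ge (j + k) (f * g :: ('s::finite, 'a::comm_ring_1) mps)"
  unfolding ord_ge_def times_mps.rep_eq
proof (intro allI impI sum.neutral ballI)
  fix \<alpha> :: "nat ^ 's" and p assume "mdeg \<alpha> < j + k" "p \<in> splits \<alpha>"
  then have "mdeg (fst p) < j \<or> mdeg (snd p) < k"
    by (auto simp: splits_def)
  then show "(case p of (\<beta>, \<gamma>) \<Rightarrow> mps_nth f \<beta> * mps_nth g \<gamma>) = 0"
    using assms by (auto simp: ord_ge_def split: prod.split)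
qed

lemma ord_ge_mult_left: "ord_ge k g \<Longrightarrow> ord_ge k (f * g :: ('s::finite, 'a::comm_ring_1) mps)"
  using ord_ge_mult[of 0 f k g] by simp

lemma ord_ge_mult_right: "ord_ge k f \<Longrightarrow> ord_ge k (f * g :: ('s::finite, 'a::comm_ring_1) mps)"
  using ord_ge_mult[of k f 0 g] by simp

lemma ord_ge_all_imp_0: "(\<And>k. ord_ge k f) \<Longrightarrow> f = (0 :: ('s::finite, 'a::comm_ring_1) mps)"
  by (rule mps_eqI) (metis ord_ge_def lessI zero_mps.rep_eq)

lemma ord_ge_all_imp_eq:
  "(\<And>k. ord_ge k (f - g)) \<Longrightarrow> f = (g :: ('s::finite, 'a::comm_ring_1) mps)"
  using ord_ge_all_imp_0[of "f - g"] by simp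

lemma mdeg_less_Suc_0: "mdeg \<alpha> < Suc 0 \<longleftrightarrow> \<alpha> = 0"
  using mdeg_eq_0_iff[of \<alpha>] by linarith

lemma ord_ge_1_iff: "ord_ge (Suc 0) f \<longleftrightarrow> mps_nth f 0 = 0"
  by (auto simp: ord_ge_def mdeg_less_Suc_0)

lemma ideal_pow_ord_ge: "f \<in> ideal_pow max_ideal k \<longleftrightarrow> ord_ge k f"
  by (simp add: ideal_pow_max_ideal_iff ord_ge_def)

lemma mps_nth_Abs [simp]: "mps_nth (Abs_mps f) = f"
  by (simp add: Abs_mps_inverse)

lemma mps_const_0 [simp]: "mps_const 0 = (0 :: ('s::finite, 'a::comm_ring_1) mps)"
  and mps_const_1 [simp]: "mps_const 1 = (1 :: ('s::finite, 'a::comm_ring_1) mps)"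
  by (auto intro!: mps_eqI simp: mps_const.rep_eq zero_mps.rep_eq one_mps.rep_eq)

lemma mps_const_add: "mps_const (a + b) = (mps_const a + mps_const b :: ('s::finite, 'a::comm_ring_1) mps)"
  and mps_const_mult: "mps_const (a * b) = (mps_const a * mps_const b :: ('s::finite, 'a::comm_ring_1) mps)"
  by (auto intro!: mps_eqI simp: mps_const.rep_eq plus_mps.rep_eq)

lemma ring_morph_mps_const: "ring_morph (mps_const :: 'a::comm_ring_1 \<Rightarrow> ('s::finite, 'a) mps)"
  by (simp add: ring_morph_def mps_const_add mps_const_mult)

lemma axis_1_neq_0 [simp]: "axis i 1 \<noteq> (0 :: nat ^ 's::finite)"
  by (metis axis_nth zero_index zero_neq_one)

lemma ord_ge_X [simp]: "ord_ge (Suc 0) (mps_X i :: ('s::finite, 'a::comm_ring_1) mps)"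
  by (simp add: ord_ge_1_iff mps_X.rep_eq axis_1_neq_0[symmetric] del: axis_1_neq_0)

lemma diff_axis_add: "\<alpha> $ i \<noteq> 0 \<Longrightarrow> \<alpha> - axis i 1 + axis i 1 = (\<alpha> :: nat ^ 's::finite)"
  by (auto simp: vec_eq_iff axis_def)

lemma multiindex_cases [case_names zero add_axis]:
  fixes \<alpha> :: "nat ^ 's::finite"
  obtains "\<alpha> = 0" | \<beta> i where "\<alpha> = \<beta> + axis i 1"
proof (cases "\<alpha> = 0")
  case False
  then obtain i where "\<alpha> $ i \<noteq> 0" by (auto simp: vec_eq_iff)
  from diff_axis_add[OF this] show ?thesis using that by metis
qed

lemma multiindex_induct [case_names zero add_axis]:
  fixes \<alpha> :: "nat ^ 's::finite"
  assumes "P 0" "\<And>\<beta> i. P \<beta> \<Longrightarrow> P (\<beta> + axis i 1)"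
  shows "P \<alpha>"
proof (induction "mdeg \<alpha>" arbitrary: \<alpha>)
  case 0 then show ?case using assms(1) by simp
next
  case (Suc n)
  show ?case
  proof (cases \<alpha> rule: multiindex_cases)
    case zero then show ?thesis using assms(1) by simp
  next
    case (add_axis \<beta> i)
    then show ?thesis using Suc assms(2) by simp
  qed
qed

lemma finite_mdeg_le: "finite {\<beta> :: nat ^ 's::finite. mdeg \<beta> \<le> k}"
proof (rule finite_subset[OF _ finite_le_multiindex[of "\<lambda>_. k"]])
  have "\<alpha> $ i \<le> mdeg \<alpha>" for \<alpha> :: "nat ^ 's" and i
    unfolding mdeg_def by (rule member_le_sum) auto
  then show "{\<beta> :: nat ^ 's. mdeg \<beta> \<le> k} \<subseteq> {\<beta>. \<forall>i. \<beta> $ i \<le> k}"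
    using order_trans by blast
qed

lemma finite_mdeg_less: "finite {\<beta> :: nat ^ 's::finite. mdeg \<beta> < k}"
  by (rule finite_subset[OF _ finite_mdeg_le[of k]]) auto

definition mps_mono :: "nat ^ 's::finite \<Rightarrow> ('s, 'a::comm_ring_1) mps" where
  "mps_mono \<beta> = Abs_mps (\<lambda>\<alpha>. if \<alpha> = \<beta> then 1 else 0)"

lemma mps_nth_mono: "mps_nth (mps_mono \<beta>) \<alpha> = (if \<alpha> = \<beta> then 1 else 0)"
  by (simp add: mps_mono_def)

lemma mps_mono_0: "mps_mono 0 = 1"
  by (rule mps_eqI) (simp add: mps_nth_mono one_mps.rep_eq)

lemma mps_mono_add_axis:
  "mps_mono (\<beta> + axis i 1) = (mps_X i * mps_mono \<beta> :: ('s::finite, 'a::comm_ring_1) mps)"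
proof (rule mps_eqI)
  fix \<alpha> :: "nat ^ 's"
  have "\<alpha> = \<beta> + axis i 1 \<longleftrightarrow> \<alpha> $ i \<noteq> 0 \<and> \<alpha> - axis i 1 = \<beta>"
    using diff_axis_add[of \<alpha> i] by auto
  then show "mps_nth (mps_mono (\<beta> + axis i 1)) \<alpha> = mps_nth (mps_X i * mps_mono \<beta>) \<alpha>"
    by (auto simp: mps_nth_mono mps_nth_X_mult)
qed

lemma ord_ge_truncate:
  "ord_ge k (f - (\<Sum>\<beta> | mdeg \<beta> < k. mps_const (mps_nth f \<beta>) * mps_mono \<beta>))"
  for f :: "('s::finite, 'a::comm_ring_1) mps"
proof -
  have "mps_nth (\<Sum>\<beta> | mdeg \<beta> < k. mps_const (mps_nth f \<beta>) * mps_mono \<beta>) \<alpha> = mps_nth f \<alpha>"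
    if "mdeg \<alpha> < k" for \<alpha>
  proof -
    have "mps_nth (\<Sum>\<beta> | mdeg \<beta> < k. mps_const (mps_nth f \<beta>) * mps_mono \<beta>) \<alpha> =
        (\<Sum>\<beta> | mdeg \<beta> < k. if \<alpha> = \<beta> then mps_nth f \<beta> else 0)"
      by (simp add: mps_nth_sum mps_nth_mono if_distrib cong: if_cong)
    also have "\<dots> = mps_nth f \<alpha>"
      using that by (simp add: sum.delta' finite_mdeg_less)
    finally show ?thesis .
  qed
  then show ?thesis by (simp add: ord_ge_def mps_nth_simps)
qed

text \<open>Constants, sums and multiplication by variables produce all polynomials, and the
  truncations of \<open>f\<close> converge to \<open>f\<close>. Only the case \<open>closed\<close>
  sees infinite series; in applications it amounts to continuity.\<close>

lemma mps_dense_induct [case_names const add X closed]: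
  fixes f :: "('s::finite, 'a::comm_ring_1) mps"
  assumes const: "\<And>c. P (mps_const c)"
    and add: "\<And>f g. P f \<Longrightarrow> P g \<Longrightarrow> P (f + g)"
    and X: "\<And>i f. P f \<Longrightarrow> P (mps_X i * f)"
    and closed: "\<And>f. (\<And>k. \<exists>g. P g \<and> ord_ge k (f - g)) \<Longrightarrow> P f"
  shows "P f"
proof -
  have "P (mps_const c * mps_mono \<beta>)" for c \<beta>
  proof (induction \<beta> rule: multiindex_induct)
    case zero then show ?case using const by (simp add: mps_mono_0)
  next
    case (add_axis \<beta> i)
    from X[OF this, of i] show ?case by (simp add: mps_mono_add_axis mult.left_commute)
  qed
  moreover have "P 0" using const[of 0] by simp
  ultimately have "P (\<Sum>\<beta>\<in>S. mps_const (mps_nth f \<beta>) * mps_mono \<beta>)" for f S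
    by (induction S rule: infinite_finite_induct) (auto intro: add)
  then show ?thesis
    using ord_ge_truncate finite_mdeg_less by (intro closed) blast
qed

section \<open>Substitution\<close>

text \<open>If every \<open>\<phi> i\<close> has zero constant term, the monomial with exponent
  \<beta> becomes a series of order at least \<open>mdeg \<beta>\<close>, so larger \<beta> do not
  reach the coefficient at \<alpha> and the cut-off loses nothing. It keeps the sum finite for
  arbitrary \<open>\<phi>\<close>.\<close>

definition mps_subst :: "('s::finite \<Rightarrow> ('t::finite, 'a::comm_ring_1) mps) \<Rightarrow> ('s, 'a) mps \<Rightarrow> ('t, 'a) mps" where
  "mps_subst \<phi> f = Abs_mps (\<lambda>\<alpha>. \<Sum>\<beta> | mdeg \<beta> \<le> mdeg \<alpha>.
     mps_nth f \<beta> * mps_nth (\<Prod>i\<in>UNIV. \<phi> i ^ (\<beta> $ i)) \<alpha>)"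

lemma mps_nth_subst:
  "mps_nth (mps_subst \<phi> f) \<alpha> =
     (\<Sum>\<beta> | mdeg \<beta> \<le> mdeg \<alpha>. mps_nth f \<beta> * mps_nth (\<Prod>i\<in>UNIV. \<phi> i ^ (\<beta> $ i)) \<alpha>)"
  by (simp add: mps_subst_def)

lemma ord_ge_power: "ord_ge k f \<Longrightarrow> ord_ge (k * n) (f ^ n :: ('s::finite, 'a::comm_ring_1) mps)"
  by (induction n) (auto simp: ord_ge_mult)

lemma ord_ge_prod: "(\<And>i. i \<in> I \<Longrightarrow> ord_ge (d i) (f i)) \<Longrightarrow>
    ord_ge (\<Sum>i\<in>I. d i) (\<Prod>i\<in>I. f i :: ('s::finite, 'a::comm_ring_1) mps)"
  by (induction I rule: infinite_finite_induct) (auto simp: ord_ge_mult)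

context
  fixes \<phi> :: "'s::finite \<Rightarrow> ('t::finite, 'a::comm_ring_1) mps"
  assumes \<phi>: "\<And>i. ord_ge (Suc 0) (\<phi> i)"
begin

lemma ord_ge_subst_mono: "ord_ge (mdeg \<beta>) (\<Prod>i\<in>UNIV. \<phi> i ^ (\<beta> $ i))"
  unfolding mdeg_def by (rule ord_ge_prod) (use ord_ge_power[OF \<phi>] in auto)

lemma mps_nth_subst':
  assumes "mdeg \<alpha> \<le> n"
  shows "mps_nth (mps_subst \<phi> f) \<alpha> =
     (\<Sum>\<beta> | mdeg \<beta> \<le> n. mps_nth f \<beta> * mps_nth (\<Prod>i\<in>UNIV. \<phi> i ^ (\<beta> $ i)) \<alpha>)"
  unfolding mps_nth_subst using assms ord_ge_subst_mono
  by (intro sum.mono_neutral_left finite_mdeg_le) (auto simp: ord_ge_def)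

lemma mps_subst_add: "mps_subst \<phi> (f + g) = mps_subst \<phi> f + mps_subst \<phi> g"
  by (rule mps_eqI) (simp add: mps_nth_subst mps_nth_simps algebra_simps sum.distrib)

lemma mps_subst_const_mult: "mps_subst \<phi> (mps_const c * f) = mps_const c * mps_subst \<phi> f"
  by (rule mps_eqI) (simp add: mps_nth_subst sum_distrib_left mult.assoc)

lemma ord_ge_subst: "ord_ge k f \<Longrightarrow> ord_ge k (mps_subst \<phi> f)"
  unfolding ord_ge_def mps_nth_subst by (intro allI impI sum.neutral) auto

lemma mps_subst_1: "mps_subst \<phi> 1 = 1"
proof (rule mps_eqI)
  fix \<alpha> :: "nat ^ 't"
  have "mps_nth (mps_subst \<phi> 1) \<alpha> = (\<Sum>\<beta> :: nat ^ 's | mdeg \<beta> \<le> mdeg \<alpha>. if \<beta> = 0 then mps_nth 1 \<alpha> else 0)"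
    unfolding mps_nth_subst by (rule sum.cong) (auto simp: one_mps.rep_eq)
  also have "\<dots> = mps_nth 1 \<alpha>" by (subst sum.delta) (auto simp: finite_mdeg_le)
  finally show "mps_nth (mps_subst \<phi> 1) \<alpha> = mps_nth 1 \<alpha>" .
qed

lemma mps_subst_const: "mps_subst \<phi> (mps_const c) = mps_const c"
  using mps_subst_const_mult[of c 1] by (simp add: mps_subst_1)

lemma mps_subst_X_mult: "mps_subst \<phi> (mps_X i * f) = \<phi> i * mps_subst \<phi> f"
proof (rule mps_eqI)
  fix \<alpha> :: "nat ^ 't"
  let ?m = "\<lambda>\<beta>. \<Prod>i\<in>UNIV. \<phi> i ^ (\<beta> $ i)"
  let ?n = "mdeg \<alpha>"
  have m: "?m (\<gamma> + axis i 1) = \<phi> i * ?m \<gamma>" for \<gamma>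
  proof -
    have "?m (\<gamma> + axis i 1) = ?m \<gamma> * (\<Prod>j\<in>UNIV. \<phi> j ^ (axis i (1::nat) $ j))"
      by (simp add: power_add prod.distrib)
    also have "(\<Prod>j\<in>UNIV. \<phi> j ^ (axis i (1::nat) $ j)) = (\<Prod>j\<in>UNIV. if j = i then \<phi> i else 1)"
      by (rule prod.cong) (auto simp: axis_def)
    finally show ?thesis by (simp add: mult.commute)
  qed
  \<comment> \<open>The cut-off is raised by one to contain \<open>\<gamma> + axis i 1\<close> for
    every \<gamma> up to the old cut-off; the other exponents do not involve the variable
    \<open>i\<close>.\<close>
  have "mps_nth (mps_subst \<phi> (mps_X i * f)) \<alpha> =
      (\<Sum>\<beta> | mdeg \<beta> \<le> Suc ?n. mps_nth (mps_X i * f) \<beta> * mps_nth (?m \<beta>) \<alpha>)"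
    by (rule mps_nth_subst') simp
  also have "\<dots> = (\<Sum>\<beta>\<in>(\<lambda>\<gamma>. \<gamma> + axis i 1) ` {\<gamma>. mdeg \<gamma> \<le> ?n}. mps_nth (mps_X i * f) \<beta> * mps_nth (?m \<beta>) \<alpha>)"
  proof (rule sum.mono_neutral_right[OF finite_mdeg_le])
    show "\<forall>\<beta>\<in>{\<beta>. mdeg \<beta> \<le> Suc ?n} - (\<lambda>\<gamma>. \<gamma> + axis i 1) ` {\<gamma>. mdeg \<gamma> \<le> ?n}.
        mps_nth (mps_X i * f) \<beta> * mps_nth (?m \<beta>) \<alpha> = 0"
    proof
      fix \<beta> assume b: "\<beta> \<in> {\<beta>. mdeg \<beta> \<le> Suc ?n} - (\<lambda>\<gamma>. \<gamma> + axis i 1) ` {\<gamma>. mdeg \<gamma> \<le> ?n}"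
      have "\<beta> $ i = 0"
      proof (rule ccontr)
        assume "\<beta> $ i \<noteq> 0"
        from diff_axis_add[OF this] obtain \<gamma> where "\<beta> = \<gamma> + axis i 1" by metis
        then show False using b by auto
      qed
      then show "mps_nth (mps_X i * f) \<beta> * mps_nth (?m \<beta>) \<alpha> = 0" by (simp add: mps_nth_X_mult)
    qed
  qed auto
  also have "\<dots> = (\<Sum>\<gamma> | mdeg \<gamma> \<le> ?n. mps_nth f \<gamma> * mps_nth (\<phi> i * ?m \<gamma>) \<alpha>)"
    by (subst sum.reindex) (auto simp: inj_on_def m[simplified] mps_nth_X_mult)
  also have "\<dots> = (\<Sum>\<gamma> | mdeg \<gamma> \<le> ?n. \<Sum>p\<in>splits \<alpha>. mps_nth f \<gamma> * (mps_nth (\<phi> i) (fst p) * mps_nth (?m \<gamma>) (snd p)))"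
    by (simp add: times_mps.rep_eq sum_distrib_left case_prod_beta)
  also have "\<dots> = (\<Sum>p\<in>splits \<alpha>. \<Sum>\<gamma> | mdeg \<gamma> \<le> ?n. mps_nth f \<gamma> * (mps_nth (\<phi> i) (fst p) * mps_nth (?m \<gamma>) (snd p)))"
    by (rule sum.swap)
  also have "\<dots> = (\<Sum>p\<in>splits \<alpha>. mps_nth (\<phi> i) (fst p) * mps_nth (mps_subst \<phi> f) (snd p))"
    by (rule sum.cong[OF refl], subst mps_nth_subst'[where n = ?n])
       (auto simp: sum_distrib_left splits_def algebra_simps)
  also have "\<dots> = mps_nth (\<phi> i * mps_subst \<phi> f) \<alpha>"
    by (simp add: times_mps.rep_eq case_prod_beta)
  finally show "mps_nth (mps_subst \<phi> (mps_X i * f)) \<alpha> = mps_nth (\<phi> i * mps_subst \<phi> f) \<alpha>" .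
qed

lemma mps_subst_X: "mps_subst \<phi> (mps_X i) = \<phi> i"
  using mps_subst_X_mult[of i 1] by (simp add: mps_subst_1)

lemma mps_subst_diff: "mps_subst \<phi> (f - g) = mps_subst \<phi> f - mps_subst \<phi> g"
  by (metis add_diff_cancel diff_add_cancel mps_subst_add)

lemma mps_subst_mult: "mps_subst \<phi> (f * g) = mps_subst \<phi> f * mps_subst \<phi> g"
proof (induction f rule: mps_dense_induct)
  case (closed f)
  show ?case
  proof (rule ord_ge_all_imp_eq)
    fix k
    obtain f' where f': "mps_subst \<phi> (f' * g) = mps_subst \<phi> f' * mps_subst \<phi> g" "ord_ge k (f - f')"
      using closed by blast
    have "mps_subst \<phi> (f * g) - mps_subst \<phi> f * mps_subst \<phi> g =
      mps_subst \<phi> ((f - f') * g) - mps_subst \<phi> (f - f') * mps_subst \<phi> g"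
      using f'(1) by (simp add: mps_subst_diff left_diff_distrib)
    then show "ord_ge k (mps_subst \<phi> (f * g) - mps_subst \<phi> f * mps_subst \<phi> g)"
      using f'(2) by (simp add: ord_ge_diff ord_ge_subst ord_ge_mult_right)
  qed
qed (auto simp: mps_subst_const_mult mps_subst_const distrib_right mps_subst_add mult.assoc mps_subst_X_mult)

lemma ring_morph_subst: "ring_morph (mps_subst \<phi>)"
  by (simp add: ring_morph_def mps_subst_1 mps_subst_add mps_subst_mult)

text \<open>By density, a continuous homomorphism that fixes the coefficients is determined by the
  images of the variables. This identifies the identity, compositions of substitutions and arbitrary
  automorphisms as substitutions.\<close>

lemma continuous_hom_eq_subst:
  assumes T: "ring_morph T" "\<And>c. T (mps_const c) = mps_const c" "\<And>i. T (mps_X i) = \<phi> i"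
    and cont: "\<And>k f. ord_ge k f \<Longrightarrow> ord_ge k (T f)"
  shows "T = mps_subst \<phi>"
proof
  fix f show "T f = mps_subst \<phi> f"
  proof (induction f rule: mps_dense_induct)
    case (closed f)
    show ?case
    proof (rule ord_ge_all_imp_eq)
      fix k
      obtain f' where f': "T f' = mps_subst \<phi> f'" "ord_ge k (f - f')"
        using closed by blast
      have "T f - mps_subst \<phi> f = T (f - f') - mps_subst \<phi> (f - f')"
        using f'(1) by (simp add: mps_subst_diff ring_morph_diff T)
      then show "ord_ge k (T f - mps_subst \<phi> f)"
        using f'(2) by (simp add: ord_ge_diff ord_ge_subst cont)
    qed
  qed (use T in \<open>auto simp: ring_morph_simps mps_subst_const mps_subst_add mps_subst_X_mult\<close>)
qed

end

lemma mps_subst_id: "mps_subst mps_X = (id :: ('s::finite, 'a::comm_ring_1) mps \<Rightarrow> _)"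
  by (rule continuous_hom_eq_subst[symmetric]) (auto simp: ring_morph_def)

lemma mps_subst_subst:
  fixes \<phi> :: "'s::finite \<Rightarrow> ('t::finite, 'a::comm_ring_1) mps" and \<psi> :: "'t \<Rightarrow> ('u::finite, 'a) mps"
  assumes "\<And>i. ord_ge (Suc 0) (\<phi> i)" "\<And>i. ord_ge (Suc 0) (\<psi> i)"
  shows "mps_subst \<psi> (mps_subst \<phi> f) = mps_subst (\<lambda>i. mps_subst \<psi> (\<phi> i)) f"
proof -
  have "(\<lambda>f. mps_subst \<psi> (mps_subst \<phi> f)) = mps_subst (\<lambda>i. mps_subst \<psi> (\<phi> i))"
    using assms
    by (intro continuous_hom_eq_subst)
       (auto simp: ord_ge_subst ring_morph_comp ring_morph_subst mps_subst_const mps_subst_X)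
  then show ?thesis by metis
qed

section \<open>Change of coefficients\<close>

context
  fixes h :: "'a::comm_ring_1 \<Rightarrow> 'b::comm_ring_1"
  assumes h: "ring_morph h"
begin

lemma mps_map_mult: "mps_map h (f * g) = mps_map h f * (mps_map h g :: ('s::finite, 'b) mps)"
  by (rule mps_eqI) (simp add: mps_map.rep_eq times_mps.rep_eq case_prod_beta ring_morph_simps[OF h])

lemma ring_morph_mps_map: "ring_morph (mps_map h :: ('s::finite, 'a) mps \<Rightarrow> _)"
  unfolding ring_morph_def
  by (auto intro!: mps_eqI
      simp: mps_map.rep_eq one_mps.rep_eq plus_mps.rep_eq ring_morph_simps[OF h] mps_map_mult)

lemma mps_map_subst: "mps_map h (mps_subst \<phi> f) = mps_subst (\<lambda>i. mps_map h (\<phi> i)) (mps_map h f)"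
proof (rule mps_eqI)
  fix \<alpha>
  have "h (mps_nth (\<Prod>i\<in>UNIV. \<phi> i ^ (\<beta> $ i)) \<alpha>) = mps_nth (\<Prod>i\<in>UNIV. mps_map h (\<phi> i) ^ (\<beta> $ i)) \<alpha>" for \<beta>
  proof -
    have "h (mps_nth (\<Prod>i\<in>UNIV. \<phi> i ^ (\<beta> $ i)) \<alpha>) = mps_nth (mps_map h (\<Prod>i\<in>UNIV. \<phi> i ^ (\<beta> $ i))) \<alpha>"
      by (simp add: mps_map.rep_eq)
    then show ?thesis by (simp only: ring_morph_simps[OF ring_morph_mps_map])
  qed
  then show "mps_nth (mps_map h (mps_subst \<phi> f)) \<alpha> =
      mps_nth (mps_subst (\<lambda>i. mps_map h (\<phi> i)) (mps_map h f)) \<alpha>"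
    by (simp add: mps_map.rep_eq mps_nth_subst ring_morph_simps[OF h])
qed

lemma mps_map_X: "mps_map h (mps_X i) = mps_X i"
  by (rule mps_eqI) (simp add: mps_map.rep_eq mps_X.rep_eq ring_morph_simps[OF h])

lemma ord_ge_map: "ord_ge k f \<Longrightarrow> ord_ge k (mps_map h f)"
  by (simp add: ord_ge_def mps_map.rep_eq ring_morph_simps[OF h])

end

text \<open>The Banach fixed point theorem for families graded by \<open>d\<close>: each application
  of \<open>T\<close> settles one more degree. After \<open>n\<close> iterations the entries of
  degree below \<open>n\<close> no longer change, so the fixed point can read entry \<open>i\<close>
  after \<open>Suc (d i)\<close> iterations, from any starting point.\<close>

lemma contraction_fixpoint:
  fixes T :: "('i \<Rightarrow> 'b) \<Rightarrow> 'i \<Rightarrow> 'b" and d :: "'i \<Rightarrow> nat"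
  assumes T: "\<And>k x y. (\<And>i. d i < k \<Longrightarrow> x i = y i) \<Longrightarrow> (\<And>i. d i < Suc k \<Longrightarrow> T x i = T y i)"
  shows "\<exists>!x. T x = x"
proof -
  define s where "s n = (T ^^ n) undefined" for n
  have s_Suc: "s (Suc n) = T (s n)" for n
    by (simp add: s_def)
  have step: "d i < n \<Longrightarrow> s n i = s (Suc n) i" for n i
  proof (induction n arbitrary: i)
    case (Suc n)
    from T[of n "s n" "s (Suc n)" i, OF Suc.IH Suc.prems] show ?case by (simp only: s_Suc)
  qed simp
  have agree: "n \<le> m \<Longrightarrow> d i < n \<Longrightarrow> s n i = s m i" for n m i
    by (induction m rule: dec_induct) (simp, metis step order.strict_trans2)
  define x where "x i = s (Suc (d i)) i" for i
  have x: "d i < k \<Longrightarrow> x i = s k i" for i k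
    using agree[of "Suc (d i)" k i] by (simp add: x_def)
  have "T x i = x i" for i
    using T[of "d i" x "s (d i)" i, OF x] by (simp add: x_def s_Suc)
  moreover have "y = x" if y: "T y = y" for y
  proof
    have "d i < k \<Longrightarrow> y i = x i" for k i
    proof (induction k arbitrary: i)
      case (Suc k)
      from T[of k y x i, OF Suc.IH Suc.prems] show ?case
        using y \<open>\<And>i. T x i = x i\<close> by simp
    qed simp
    then show "y i = x i" for i by blast
  qed
  ultimately show ?thesis by blast
qed

definition mat_ord_ge :: "nat \<Rightarrow> (('s::finite, 'a::zero) mps ^ 'n::finite) ^ 'm::finite \<Rightarrow> bool" where
  "mat_ord_ge k A \<longleftrightarrow> (\<forall>i j. ord_ge k (A $ i $ j))"

lemma mat_contraction_fixpoint:
  fixes T :: "('s::finite, 'a::comm_ring_1, 'm::finite, 'n::finite) mps_mat \<Rightarrow> ('s, 'a, 'm, 'n) mps_mat"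
  assumes T: "\<And>k A B. mat_ord_ge k (A - B) \<Longrightarrow> mat_ord_ge (Suc k) (T A - T B)"
  shows "\<exists>!A. T A = A"
proof -
  define c :: "('s, 'a, 'm, 'n) mps_mat \<Rightarrow> 'm \<times> 'n \<times> (nat ^ 's) \<Rightarrow> 'a"
    where "c A = (\<lambda>(i, j, \<alpha>). mps_nth (A $ i $ j) \<alpha>)" for A
  define m where "m x = (\<chi> i j. Abs_mps (\<lambda>\<alpha>. x (i, j, \<alpha>)))" for x :: "'m \<times> 'n \<times> (nat ^ 's) \<Rightarrow> 'a"
  have mc: "m (c A) = A" and cm: "c (m x) = x" for A and x :: "'m \<times> 'n \<times> (nat ^ 's) \<Rightarrow> 'a"
    by (auto simp: m_def c_def vec_eq_iff intro!: mps_eqI)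
  have ord: "mat_ord_ge k (A - B) \<longleftrightarrow> (\<forall>i. mdeg (snd (snd i)) < k \<longrightarrow> c A i = c B i)" for k A B
    by (auto simp: mat_ord_ge_def ord_ge_def c_def mps_nth_simps)
  have "\<exists>!x. c (T (m x)) = x"
  proof (rule contraction_fixpoint[where d = "\<lambda>i. mdeg (snd (snd i))"])
    fix k and i :: "'m \<times> 'n \<times> (nat ^ 's)" and x y :: "'m \<times> 'n \<times> (nat ^ 's) \<Rightarrow> 'a"
    assume *: "\<And>i. mdeg (snd (snd i)) < k \<Longrightarrow> x i = y i" "mdeg (snd (snd i)) < Suc k"
    have "mat_ord_ge k (m x - m y)" using * by (simp add: ord cm)
    from T[OF this] show "c (T (m x)) i = c (T (m y)) i" using * unfolding ord by blast
  qed
  then obtain x where x: "c (T (m x)) = x" "\<And>y. c (T (m y)) = y \<Longrightarrow> y = x" by blast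
  show ?thesis
  proof (rule ex1I[of _ "m x"])
    show "T (m x) = m x" using x(1) by (metis mc)
    show "A = m x" if "T A = A" for A using x(2)[of "c A"] that by (metis mc)
  qed
qed

lemma mps_contraction_fixpoint:
  fixes T :: "('s::finite, 'a::comm_ring_1) mps \<Rightarrow> ('s, 'a) mps"
  assumes T: "\<And>k f g. ord_ge k (f - g) \<Longrightarrow> ord_ge (Suc k) (T f - T g)"
  shows "\<exists>!f. T f = f"
proof -
  define c :: "('s, 'a) mps \<Rightarrow> ('s, 'a, 1, 1) mps_mat" where "c f = (\<chi> i j. f)" for f
  have c: "c (A $ 1 $ 1) = A" for A :: "('s, 'a, 1, 1) mps_mat"
    by (simp add: c_def vec_eq_iff)
  have "\<exists>!A :: ('s, 'a, 1, 1) mps_mat. c (T (A $ 1 $ 1)) = A"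
    by (rule mat_contraction_fixpoint) (use T in \<open>simp add: mat_ord_ge_def c_def\<close>)
  then obtain A where A: "c (T (A $ 1 $ 1)) = A" "\<And>B. c (T (B $ 1 $ 1)) = B \<Longrightarrow> B = A" by metis
  show ?thesis
  proof (rule ex1I[of _ "A $ 1 $ 1"])
    show "T (A $ 1 $ 1) = A $ 1 $ 1" by (subst (2) A(1)[symmetric]) (simp add: c_def)
    show "f = A $ 1 $ 1" if "T f = f" for f
      using A(2)[of "c f"] that by (simp add: c_def vec_eq_iff)
  qed
qed

section \<open>Units and invertible matrices\<close>

text \<open>With \<open>f = c + r\<close>, \<open>c\<close> the constant term, an inverse is a fixed
  point of \<open>g\<close> \<mapsto> \<open>(1 - r * g) / c\<close>, a contraction because
  \<open>r\<close> has order at least 1.\<close>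

lemma mps_unit:
  fixes f :: "('s::finite, 'a::field) mps"
  assumes "mps_nth f 0 \<noteq> 0"
  shows "\<exists>g. f * g = 1"
proof -
  define c where "c = mps_nth f 0"
  define r where "r = f - mps_const c"
  have r: "ord_ge (Suc 0) r"
    by (simp add: ord_ge_1_iff r_def c_def mps_nth_simps mps_const.rep_eq)
  have "\<exists>!g. mps_const (inverse c) * (1 - r * g) = g"
  proof (rule mps_contraction_fixpoint)
    fix k and g h :: "('s, 'a) mps" assume "ord_ge k (g - h)"
    from ord_ge_mult[OF r this] have "ord_ge (Suc k) (r * (h - g))"
      using ord_ge_uminus[of "Suc k" "r * (g - h)"] by (simp add: algebra_simps)
    then show "ord_ge (Suc k) (mps_const (inverse c) * (1 - r * g) - mps_const (inverse c) * (1 - r * h))"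
      using ord_ge_mult_left[of "Suc k" "r * (h - g)" "mps_const (inverse c)"]
      by (simp add: algebra_simps)
  qed
  then obtain g where "mps_const (inverse c) * (1 - r * g) = g" by blast
  then have "mps_const c * g = mps_const (c * inverse c) * (1 - r * g)"
    by (metis mps_const_mult mult.assoc)
  also have "\<dots> = 1 - r * g" using assms by (simp add: c_def)
  finally have "f * g = 1" by (simp add: r_def algebra_simps)
  then show ?thesis ..
qed

lemma mps_unit_iff: "(\<exists>g. f * g = 1) \<longleftrightarrow> mps_nth f 0 \<noteq> 0" for f :: "('s::finite, 'a::field) mps"
proof
  assume "\<exists>g. f * g = 1"
  then obtain g where g: "f * g = 1" ..
  show "mps_nth f 0 \<noteq> 0"
  proof
    assume "mps_nth f 0 = 0"
    then have "ord_ge (Suc 0) (f * g)" by (simp add: ord_ge_1_iff[symmetric] ord_ge_mult_right)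
    then show False by (simp add: g ord_ge_1_iff one_mps.rep_eq)
  qed
qed (rule mps_unit)

section \<open>Matrix algebra and the order of a matrix\<close>

lemma map_matrix_mult:
  "ring_morph h \<Longrightarrow> map_matrix h (A ** B) = map_matrix h A ** map_matrix h B"
  by (simp add: vec_eq_iff matrix_matrix_mult_def ring_morph_simps)

lemma map_matrix_1: "ring_morph h \<Longrightarrow> map_matrix h (mat 1) = mat 1"
  by (simp add: vec_eq_iff mat_def ring_morph_simps)

lemma map_matrix_add: "ring_morph h \<Longrightarrow> map_matrix h (A + B) = map_matrix h A + map_matrix h B"
  by (simp add: vec_eq_iff ring_morph_simps)

lemma map_matrix_comp: "map_matrix f (map_matrix g A) = map_matrix (\<lambda>x. f (g x)) A"
  by (simp add: vec_eq_iff)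

lemma invertible_map_matrix: "ring_morph h \<Longrightarrow> invertible U \<Longrightarrow> invertible (map_matrix h U)"
  unfolding invertible_def by (metis map_matrix_1 map_matrix_mult)

lemma matrix_add_rdistrib: "(A + B) ** C = A ** C + B ** (C :: 'a::comm_ring_1 ^ _ ^ _)"
  by (simp add: matrix_matrix_mult_def vec_eq_iff distrib_right sum.distrib)

lemma matrix_diff_ldistrib: "A ** (B - C) = A ** B - A ** (C :: 'a::comm_ring_1 ^ _ ^ _)"
  by (simp add: matrix_matrix_mult_def vec_eq_iff right_diff_distrib sum_subtractf)

lemma matrix_diff_rdistrib: "(A - B) ** C = A ** C - B ** (C :: 'a::comm_ring_1 ^ _ ^ _)"
  by (simp add: matrix_matrix_mult_def vec_eq_iff left_diff_distrib sum_subtractf)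

lemma mat_ord_ge_mult:
  fixes A :: "(('s::finite, 'a::comm_ring_1) mps ^ _) ^ _"
  shows "mat_ord_ge j A \<Longrightarrow> mat_ord_ge k B \<Longrightarrow> mat_ord_ge (j + k) (A ** B)"
  by (simp add: mat_ord_ge_def matrix_matrix_mult_def ord_ge_sum ord_ge_mult)

lemma mat_ord_ge_mult_left: "mat_ord_ge k B \<Longrightarrow> mat_ord_ge k (A ** B)"
  and mat_ord_ge_mult_right: "mat_ord_ge k A \<Longrightarrow> mat_ord_ge k (A ** B)"
  for A :: "(('s::finite, 'a::comm_ring_1) mps ^ _) ^ _"
  using mat_ord_ge_mult[of 0 A k B] mat_ord_ge_mult[of k A 0 B] by (simp_all add: mat_ord_ge_def)

lemma mat_ord_ge_add: "mat_ord_ge k A \<Longrightarrow> mat_ord_ge k B \<Longrightarrow> mat_ord_ge k (A + B)"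
  and mat_ord_ge_diff: "mat_ord_ge k A \<Longrightarrow> mat_ord_ge k B \<Longrightarrow> mat_ord_ge k (A - B)"
  and mat_ord_ge_uminus: "mat_ord_ge k A \<Longrightarrow> mat_ord_ge k (- A)"
  for A :: "(('s::finite, 'a::comm_ring_1) mps ^ _) ^ _"
  by (simp_all add: mat_ord_ge_def ord_ge_add ord_ge_diff ord_ge_uminus)

lemma mat_ord_ge_mono: "mat_ord_ge k A \<Longrightarrow> l \<le> k \<Longrightarrow> mat_ord_ge l A"
  unfolding mat_ord_ge_def using ord_ge_mono by blast

lemma mat_ord_ge_all_imp_eq:
  "(\<And>k. mat_ord_ge k (A - B)) \<Longrightarrow> A = (B :: (('s::finite, 'a::comm_ring_1) mps ^ _) ^ _)"
  by (auto simp: mat_ord_ge_def vec_eq_iff intro!: ord_ge_all_imp_eq)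

text \<open>The geometric series argument of \<open>mps_unit\<close> with \<open>U = U0 + N\<close>,
  where \<open>U0\<close> is the constant part. Right and left inverse are constructed as two
  separate fixed points and then coincide by associativity.\<close>

lemma invertible_mps_mat:
  fixes U :: "('s::finite, 'a::field, 'm::finite, 'm) mps_mat"
  assumes "det (map_matrix (\<lambda>f. mps_nth f 0) U) \<noteq> 0"
  shows "invertible U"
proof -
  let ?c = "map_matrix mps_const :: 'a ^ 'm ^ 'm \<Rightarrow> ('s, 'a, 'm, 'm) mps_mat"
  define U0 where "U0 = map_matrix (\<lambda>f. mps_nth f 0) U"
  obtain C where C: "C ** U0 = mat 1" "U0 ** C = mat 1"
    using assms invertible_det_nz[of U0] unfolding invertible_def U0_def by blast
  have C': "?c C ** ?c U0 = mat 1" "?c U0 ** ?c C = mat 1"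
    by (simp_all add: map_matrix_mult[OF ring_morph_mps_const, symmetric] C map_matrix_1[OF ring_morph_mps_const])
  define N where "N = U - ?c U0"
  have U: "U = ?c U0 + N" by (simp add: N_def)
  have N: "mat_ord_ge (Suc 0) N"
    by (simp add: mat_ord_ge_def ord_ge_1_iff N_def U0_def mps_nth_simps mps_const.rep_eq)
  have "\<exists>!Z. ?c C ** (mat 1 - N ** Z) = Z"
  proof (rule mat_contraction_fixpoint)
    fix k and A B :: "('s, 'a, 'm, 'm) mps_mat" assume "mat_ord_ge k (A - B)"
    from mat_ord_ge_mult_left[OF mat_ord_ge_mult[OF N this], of "- ?c C"]
    show "mat_ord_ge (Suc k) (?c C ** (mat 1 - N ** A) - ?c C ** (mat 1 - N ** B))"
      by (simp add: matrix_diff_ldistrib matrix_mul_assoc)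
         (simp add: matrix_matrix_mult_def mat_ord_ge_def sum_negf)
  qed
  then obtain Z where Z: "?c C ** (mat 1 - N ** Z) = Z" by blast
  have "?c U0 ** Z = mat 1 - N ** Z"
    by (subst (1) Z[symmetric]) (simp add: matrix_mul_assoc C' )
  then have UZ: "U ** Z = mat 1" by (simp add: U matrix_add_rdistrib)
  have "\<exists>!Y. (mat 1 - Y ** N) ** ?c C = Y"
  proof (rule mat_contraction_fixpoint)
    fix k and A B :: "('s, 'a, 'm, 'm) mps_mat" assume "mat_ord_ge k (A - B)"
    from mat_ord_ge_mult_right[OF mat_ord_ge_mult[OF this N], of "?c C"]
    have "mat_ord_ge (Suc k) (- ((A - B) ** N ** ?c C))" by (simp add: mat_ord_ge_uminus)
    then show "mat_ord_ge (Suc k) ((mat 1 - A ** N) ** ?c C - (mat 1 - B ** N) ** ?c C)"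
      by (simp add: matrix_diff_rdistrib matrix_mul_assoc)
  qed
  then obtain Y where Y: "(mat 1 - Y ** N) ** ?c C = Y" by blast
  have "Y ** ?c U0 = mat 1 - Y ** N"
    by (subst (1) Y[symmetric]) (simp add: matrix_mul_assoc[symmetric] C')
  then have YU: "Y ** U = mat 1" by (simp add: U matrix_add_ldistrib)
  have "Z = Y" by (metis UZ YU matrix_mul_assoc matrix_mul_lid matrix_mul_rid)
  with UZ YU show ?thesis unfolding invertible_def by blast
qed

section \<open>Automorphisms\<close>

text \<open>Every monomial of positive degree is assigned to one variable dividing it, chosen by
  \<open>s\<close>, so that no monomial is counted twice. This drives the inductions on the order
  below.\<close>

lemma ord_ge_Suc_decomp:
  fixes f :: "('s::finite, 'a::comm_ring_1) mps"
  assumes f: "ord_ge (Suc k) f"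
  shows "\<exists>g. f = (\<Sum>i\<in>UNIV. mps_X i * g i) \<and> (\<forall>i. ord_ge k (g i))"
proof -
  define s :: "nat ^ 's \<Rightarrow> 's" where "s = (\<lambda>\<alpha>. SOME i. \<alpha> $ i \<noteq> 0)"
  define g where "g = (\<lambda>i. Abs_mps (\<lambda>\<beta>. if s (\<beta> + axis i 1) = i
    then mps_nth f (\<beta> + axis i 1) else 0) :: ('s, 'a) mps)"
  have g: "mps_nth (g i) \<beta> =
      (if s (\<beta> + axis i 1) = i then mps_nth f (\<beta> + axis i 1) else 0)" for i \<beta>
    by (simp add: g_def)
  have "f = (\<Sum>i\<in>UNIV. mps_X i * g i)"
  proof (rule mps_eqI)
    fix \<alpha> :: "nat ^ 's"
    have "mps_nth (\<Sum>i\<in>UNIV. mps_X i * g i) \<alpha> =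
        (\<Sum>i\<in>UNIV. if s \<alpha> = i then (if \<alpha> $ i = 0 then 0 else mps_nth f \<alpha>) else 0)"
      unfolding mps_nth_sum mps_nth_X_mult g using diff_axis_add[of \<alpha>] by (intro sum.cong) auto
    also have "\<dots> = (if \<alpha> $ s \<alpha> = 0 then 0 else mps_nth f \<alpha>)" by simp
    also have "\<dots> = mps_nth f \<alpha>"
    proof (cases "\<alpha> = 0")
      case True
      then show ?thesis using f by (simp add: ord_ge_def)
    next
      case False
      then have "\<exists>i. \<alpha> $ i \<noteq> 0" by (auto simp: vec_eq_iff)
      from someI_ex[OF this] show ?thesis by (simp add: s_def)
    qed
    finally show "mps_nth f \<alpha> = mps_nth (\<Sum>i\<in>UNIV. mps_X i * g i) \<alpha>" ..
  qed
  moreover have "ord_ge k (g i)" for i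
    using f by (simp add: ord_ge_def g)
  ultimately show ?thesis by blast
qed

lemma alg_aut_ring_morph:
  assumes "alg_aut \<phi>" shows "ring_morph \<phi>"
  using assms unfolding alg_aut_def ring_morph_def by (metis mps_const_1)

lemma alg_aut_const: "alg_aut \<phi> \<Longrightarrow> \<phi> (mps_const c) = mps_const c"
  by (simp add: alg_aut_def)

text \<open>The maximal ideal consists of the nonunits, and automorphisms preserve nonunits. Hence
  continuity is a consequence of \<open>alg_aut\<close> and need not be demanded there.\<close>

lemma alg_aut_ord_ge_1:
  assumes "alg_aut \<phi>" "ord_ge (Suc 0) f" shows "ord_ge (Suc 0) (\<phi> f)"
proof (rule ccontr)
  assume "\<not> ord_ge (Suc 0) (\<phi> f)"
  then obtain g where g: "\<phi> f * g = 1" using mps_unit by (auto simp: ord_ge_1_iff)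
  obtain g' where "g = \<phi> g'" using assms(1) by (metis alg_aut_def bij_pointE)
  then have "\<phi> (f * g') = \<phi> 1"
    using g alg_aut_ring_morph[OF assms(1)] by (simp add: ring_morph_simps)
  then have "f * g' = 1" using assms(1) by (metis alg_aut_def bij_pointE)
  then show False using assms(2) mps_unit_iff[of f] by (auto simp: ord_ge_1_iff)
qed

lemma alg_aut_ord_ge:
  assumes "alg_aut \<phi>" "ord_ge k f" shows "ord_ge k (\<phi> f)"
  using assms(2)
proof (induction k arbitrary: f)
  case (Suc k)
  obtain g where f: "f = (\<Sum>i\<in>UNIV. mps_X i * g i)" and g: "\<And>i. ord_ge k (g i)"
    using ord_ge_Suc_decomp[OF Suc.prems] by blast
  have "ord_ge (Suc 0 + k) (\<phi> (mps_X i) * \<phi> (g i))" for i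
    by (rule ord_ge_mult) (use Suc.IH g alg_aut_ord_ge_1[OF assms(1)] in auto)
  then show ?case
    by (simp add: f ring_morph_simps[OF alg_aut_ring_morph[OF assms(1)]] ord_ge_sum)
qed simp

lemma alg_aut_eq_subst: "alg_aut \<phi> \<Longrightarrow> \<phi> = mps_subst (\<lambda>i. \<phi> (mps_X i))"
  by (rule continuous_hom_eq_subst)
     (auto simp: alg_aut_ord_ge alg_aut_ring_morph alg_aut_const)

lemma alg_aut_inverse:
  assumes "alg_aut \<phi>"
  obtains \<psi> where "alg_aut \<psi>" "\<And>f. \<psi> (\<phi> f) = f" "\<And>f. \<phi> (\<psi> f) = f"
proof -
  have b: "bij \<phi>" using assms by (simp add: alg_aut_def)
  define \<psi> where "\<psi> = inv_into UNIV \<phi>"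
  have 1: "\<psi> (\<phi> f) = f" "\<phi> (\<psi> f) = f" for f
    using b by (simp_all add: \<psi>_def bij_is_inj bij_is_surj surj_f_inv_f)
  have "bij \<psi>" using bij_imp_bij_inv[OF b] by (simp add: \<psi>_def)
  moreover have "\<psi> (f + g) = \<psi> f + \<psi> g" "\<psi> (f * g) = \<psi> f * \<psi> g" "\<psi> (mps_const c) = mps_const c" for f g c
    using assms 1 unfolding alg_aut_def by metis+
  ultimately have "alg_aut \<psi>" by (simp add: alg_aut_def)
  then show thesis using that 1 by blast
qed

lemma alg_aut_comp: "alg_aut \<phi> \<Longrightarrow> alg_aut \<psi> \<Longrightarrow> alg_aut (\<lambda>x. \<phi> (\<psi> x))"
  unfolding alg_aut_def using bij_comp[of \<psi> \<phi>] by (simp add: comp_def)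

lemma alg_aut_substI:
  fixes \<phi> :: "'s::finite \<Rightarrow> ('s, 'a::field) mps"
  assumes "\<And>i. ord_ge (Suc 0) (\<phi> i)" "bij (mps_subst \<phi>)"
  shows "alg_aut (mps_subst \<phi>)"
  using assms by (simp add: alg_aut_def mps_subst_add mps_subst_mult mps_subst_const)

text \<open>Both the automorphism and its inverse are given by the images of the variables.
  Coefficient change commutes with substitution, so the two extended substitutions are still inverse
  to each other.\<close>

lemma alg_aut_extend:
  fixes \<phi> :: "('s::finite, 'a::field) mps \<Rightarrow> ('s, 'a) mps" and h :: "'a \<Rightarrow> 'b::field"
  assumes \<phi>: "alg_aut \<phi>" and h: "ring_morph h"
  shows "alg_aut (mps_subst (\<lambda>i. mps_map h (\<phi> (mps_X i))))"
proof -
  obtain \<psi> where \<psi>: "alg_aut \<psi>" "\<And>f. \<psi> (\<phi> f) = f" "\<And>f. \<phi> (\<psi> f) = f"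
    using alg_aut_inverse[OF \<phi>] by blast
  let ?p = "\<lambda>i. mps_map h (\<phi> (mps_X i))" and ?q = "\<lambda>i. mps_map h (\<psi> (mps_X i))"
  have o: "ord_ge (Suc 0) (?p i)" "ord_ge (Suc 0) (?q i)" for i
    by (simp_all add: ord_ge_map[OF h] alg_aut_ord_ge[OF \<phi>] alg_aut_ord_ge[OF \<psi>(1)])
  have "mps_subst ?p (?q i) = mps_X i" for i
  proof -
    have "mps_subst ?p (?q i) = mps_map h (mps_subst (\<lambda>i. \<phi> (mps_X i)) (\<psi> (mps_X i)))"
      by (simp only: mps_map_subst[OF h])
    also have "mps_subst (\<lambda>i. \<phi> (mps_X i)) (\<psi> (mps_X i)) = mps_X i"
      using fun_cong[OF alg_aut_eq_subst[OF \<phi>], of "\<psi> (mps_X i)"] unfolding \<psi>(3) by (rule sym)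
    finally show ?thesis by (simp add: mps_map_X h)
  qed
  moreover have "mps_subst ?q (?p i) = mps_X i" for i
  proof -
    have "mps_subst ?q (?p i) = mps_map h (mps_subst (\<lambda>i. \<psi> (mps_X i)) (\<phi> (mps_X i)))"
      by (simp only: mps_map_subst[OF h])
    also have "mps_subst (\<lambda>i. \<psi> (mps_X i)) (\<phi> (mps_X i)) = mps_X i"
      using fun_cong[OF alg_aut_eq_subst[OF \<psi>(1)], of "\<phi> (mps_X i)"] unfolding \<psi>(2) by (rule sym)
    finally show ?thesis by (simp add: mps_map_X h)
  qed
  ultimately have "mps_subst ?p (mps_subst ?q f) = f" "mps_subst ?q (mps_subst ?p f) = f" for f
    by (simp_all add: mps_subst_subst o mps_subst_id)
  then have "bij (mps_subst ?p)" by (intro o_bij[of "mps_subst ?q"]) auto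
  then show ?thesis using o by (intro alg_aut_substI)
qed

text \<open>Such a substitution changes a series of order \<open>k\<close> only in order
  \<open>k + 1\<close> (the fact \<open>raise\<close>), so its difference from the identity is a
  contraction and the preimage of \<open>g\<close> is a fixed point.\<close>

lemma subst_tangent_to_id_bij:
  fixes \<phi> :: "'s::finite \<Rightarrow> ('s, 'a::comm_ring_1) mps"
  assumes \<phi>: "\<And>i. ord_ge 2 (\<phi> i - mps_X i)"
  shows "bij (mps_subst \<phi>)"
proof -
  have o: "ord_ge (Suc 0) (\<phi> i)" for i
    using ord_ge_add[OF ord_ge_mono[OF \<phi>[of i], of "Suc 0"] ord_ge_X[of i]] by simp
  have raise: "ord_ge k f \<Longrightarrow> ord_ge (Suc k) (mps_subst \<phi> f - f)" for k f
  proof (induction k arbitrary: f)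
    case 0
    have "{\<beta> :: nat ^ 's. mdeg \<beta> = 0} = {0}" by auto
    then show ?case by (simp add: ord_ge_1_iff mps_nth_simps mps_nth_subst one_mps.rep_eq)
  next
    case (Suc k)
    obtain g where f: "f = (\<Sum>i\<in>UNIV. mps_X i * g i)" and g: "\<And>i. ord_ge k (g i)"
      using ord_ge_Suc_decomp[OF Suc.prems] by blast
    have "ord_ge (Suc (Suc k)) (mps_subst \<phi> (mps_X i * g i) - mps_X i * g i)" for i
    proof -
      have "mps_subst \<phi> (mps_X i * g i) - mps_X i * g i =
          \<phi> i * (mps_subst \<phi> (g i) - g i) + (\<phi> i - mps_X i) * g i"
        by (simp add: mps_subst_X_mult o algebra_simps)
      then show ?thesis
        using ord_ge_mult[OF o[of i] Suc.IH[OF g[of i]]] ord_ge_mult[OF \<phi>[of i] g[of i]]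
        by (simp add: ord_ge_add)
    qed
    then show ?case
      by (simp add: f ring_morph_sum[OF ring_morph_subst[OF o]] sum_subtractf[symmetric] ord_ge_sum)
  qed
  have "\<exists>!f. mps_subst \<phi> f = g" for g
  proof -
    have "\<exists>!f. g - (mps_subst \<phi> f - f) = f"
    proof (rule mps_contraction_fixpoint)
      fix k and f f' :: "('s, 'a) mps" assume "ord_ge k (f - f')"
      from ord_ge_uminus[OF raise[OF this]]
      show "ord_ge (Suc k) (g - (mps_subst \<phi> f - f) - (g - (mps_subst \<phi> f' - f')))"
        by (simp add: mps_subst_diff o algebra_simps)
    qed
    moreover have "g - (mps_subst \<phi> f - f) = f \<longleftrightarrow> mps_subst \<phi> f = g" for f
      by (auto simp: algebra_simps)
    ultimately show ?thesis by simp
  qed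
  then show ?thesis by (simp add: bij_iff)
qed

definition lin_subst :: "'a::comm_ring_1 ^ 's ^ 's \<Rightarrow> 's::finite \<Rightarrow> ('s, 'a) mps" where
  "lin_subst M i = (\<Sum>j\<in>UNIV. mps_const (M $ i $ j) * mps_X j)"

lemma ord_ge_lin_subst: "ord_ge (Suc 0) (lin_subst M i)"
  by (simp add: lin_subst_def ord_ge_sum ord_ge_mult_left)

lemma lin_subst_mult: "(\<Sum>j\<in>UNIV. mps_const (M $ i $ j) * lin_subst N j) = lin_subst (M ** N) i"
proof -
  have "(\<Sum>j\<in>UNIV. mps_const (M $ i $ j) * lin_subst N j) =
      (\<Sum>j\<in>UNIV. \<Sum>k\<in>UNIV. mps_const (M $ i $ j * N $ j $ k) * mps_X k)"
    by (simp add: lin_subst_def sum_distrib_left mps_const_mult mult.assoc)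
  also have "\<dots> = (\<Sum>k\<in>UNIV. \<Sum>j\<in>UNIV. mps_const (M $ i $ j * N $ j $ k) * mps_X k)"
    by (rule sum.swap)
  finally show ?thesis
    by (simp add: lin_subst_def matrix_matrix_mult_def ring_morph_sum[OF ring_morph_mps_const] sum_distrib_right)
qed

lemma lin_subst_1: "lin_subst (mat 1 :: 'a::comm_ring_1 ^ 's::finite ^ 's) = mps_X"
proof
  fix i :: 's
  have "lin_subst (mat 1) i = (\<Sum>j\<in>UNIV. if i = j then mps_X j else 0 :: ('s, 'a) mps)"
    unfolding lin_subst_def by (rule sum.cong) (auto simp: mat_def)
  then show "lin_subst (mat 1) i = (mps_X i :: ('s, 'a) mps)" by simp
qed

lemma mps_subst_lin_subst:
  assumes "\<And>i. ord_ge (Suc 0) (\<phi> i)"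
  shows "mps_subst \<phi> (lin_subst M i) = (\<Sum>j\<in>UNIV. mps_const (M $ i $ j) * \<phi> j)"
  by (simp add: lin_subst_def ring_morph_sum[OF ring_morph_subst] assms mps_subst_const_mult mps_subst_X)

text \<open>A formal inverse function theorem. With \<open>C\<close> the inverse of the linear part
  \<open>L\<close>, composing with the linear substitution of \<open>C\<close> gives one tangent to
  the identity, hence bijective; composing with that of \<open>L\<close> recovers
  \<open>\<phi>\<close>.\<close>

lemma alg_aut_subst:
  fixes \<phi> :: "'s::finite \<Rightarrow> ('s, 'a::field) mps"
  assumes o: "\<And>i. ord_ge (Suc 0) (\<phi> i)"
    and det: "det (\<chi> i j. mps_nth (\<phi> i) (axis j 1)) \<noteq> 0"
  shows "alg_aut (mps_subst \<phi>)"
proof -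
  define L where "L = (\<chi> i j. mps_nth (\<phi> i) (axis j 1))"
  obtain C where C: "C ** L = mat 1" "L ** C = mat 1"
    using det invertible_det_nz[of L] unfolding invertible_def L_def by blast
  have lin: "ord_ge 2 (\<phi> i - lin_subst L i)" for i
    unfolding ord_ge_def
  proof (intro allI impI)
    fix \<alpha> :: "nat ^ 's" assume "mdeg \<alpha> < 2"
    then show "mps_nth (\<phi> i - lin_subst L i) \<alpha> = 0"
    proof (cases \<alpha> rule: multiindex_cases)
      case zero
      then show ?thesis using o[of i] ord_ge_lin_subst[of L i] by (simp add: ord_ge_1_iff mps_nth_simps)
    next
      case (add_axis \<beta> j)
      with \<open>mdeg \<alpha> < 2\<close> have "\<beta> = 0" using mdeg_eq_0_iff[of \<beta>] by simp
      moreover have "axis j (1 :: nat) = axis j' 1 \<longleftrightarrow> j = j'" for j j' :: 's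
        by (simp add: axis_eq_axis)
      ultimately show ?thesis using add_axis
        by (simp add: mps_nth_simps lin_subst_def mps_nth_sum mps_X.rep_eq L_def if_distrib cong: if_cong)
    qed
  qed
  have "ord_ge 2 (mps_subst \<phi> (lin_subst C i) - mps_X i)" for i
  proof -
    have "mps_subst \<phi> (lin_subst C i) - mps_X i =
        (\<Sum>j\<in>UNIV. mps_const (C $ i $ j) * (\<phi> j - lin_subst L j))"
      by (simp add: mps_subst_lin_subst o right_diff_distrib sum_subtractf lin_subst_mult C lin_subst_1)
    then show ?thesis using lin by (simp add: ord_ge_sum ord_ge_mult_left)
  qed
  from subst_tangent_to_id_bij[OF this]
  have 1: "bij (\<lambda>f. mps_subst \<phi> (mps_subst (lin_subst C) f))"
    by (simp add: mps_subst_subst o ord_ge_lin_subst)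
  have inv: "mps_subst (lin_subst L) (mps_subst (lin_subst C) f) = f"
    "mps_subst (lin_subst C) (mps_subst (lin_subst L) f) = f" for f
    by (simp_all add: mps_subst_subst ord_ge_lin_subst mps_subst_lin_subst lin_subst_mult C
          lin_subst_1 mps_subst_id)
  have 2: "bij (mps_subst (lin_subst L))"
    by (rule o_bij[of "mps_subst (lin_subst C)"]) (auto simp: inv)
  from bij_comp[OF 2 1] have "bij (mps_subst \<phi>)" by (simp add: comp_def inv)
  then show ?thesis using o by (intro alg_aut_substI)
qed

section \<open>Taylor expansion\<close>

definition pd :: "'s::finite \<Rightarrow> ('s, 'a::comm_ring_1) mps \<Rightarrow> ('s, 'a) mps" where
  "pd i f = Abs_mps (\<lambda>\<alpha>. of_nat (Suc (\<alpha> $ i)) * mps_nth f (\<alpha> + axis i 1))"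

lemma mps_nth_pd: "mps_nth (pd i f) \<alpha> = of_nat (Suc (\<alpha> $ i)) * mps_nth f (\<alpha> + axis i 1)"
  by (simp add: pd_def)

lemma pd_const: "pd i (mps_const c) = (0 :: ('s::finite, 'a::comm_ring_1) mps)"
proof (rule mps_eqI)
  fix \<alpha> :: "nat ^ 's"
  have "mdeg (\<alpha> + axis i 1) \<noteq> 0" by simp
  then have "\<alpha> + axis i 1 \<noteq> 0" by (metis mdeg_0)
  then show "mps_nth (pd i (mps_const c)) \<alpha> = mps_nth 0 \<alpha>"
    by (simp add: mps_nth_pd mps_const.rep_eq mps_nth_simps)
qed

lemma pd_add: "pd i (f + g) = pd i f + pd i g"
  by (rule mps_eqI) (simp add: mps_nth_pd mps_nth_simps algebra_simps)

lemma pd_X_mult: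
  "pd i (mps_X j * f) = (if i = j then f else 0) + mps_X j * (pd i f :: ('s::finite, 'a::comm_ring_1) mps)"
proof (rule mps_eqI)
  fix \<alpha> :: "nat ^ 's"
  show "mps_nth (pd i (mps_X j * f)) \<alpha> = mps_nth ((if i = j then f else 0) + mps_X j * pd i f) \<alpha>"
  proof (cases "i = j")
    case True
    have "\<alpha> + axis j 1 - axis j 1 = \<alpha>" by simp
    then show ?thesis using True diff_axis_add[of \<alpha> j]
      by (cases "\<alpha> $ j") (auto simp: mps_nth_pd mps_nth_X_mult mps_nth_simps distrib_right)
  next
    case False
    then have "\<alpha> + axis i 1 - axis j 1 = \<alpha> - axis j 1 + axis i 1" if "\<alpha> $ j \<noteq> 0"
      using that by (auto simp: vec_eq_iff axis_def)
    then show ?thesis using False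
      by (auto simp: mps_nth_pd mps_nth_X_mult mps_nth_simps axis_def)
  qed
qed

lemma ord_ge_pd: "ord_ge (Suc k) f \<Longrightarrow> ord_ge k (pd i f)"
  by (simp add: ord_ge_def mps_nth_pd)

lemma mps_map_pd: "ring_morph h \<Longrightarrow> mps_map h (pd i f) = pd i (mps_map h f)"
  by (rule mps_eqI) (simp add: mps_map.rep_eq mps_nth_pd ring_morph_simps ring_morph_of_nat)

text \<open>Closedness in the order topology makes \<open>mps_dense_induct\<close> applicable to
  statements modulo \<open>J\<close>. The instances are the series of order at least
  \<open>k\<close> and the series over a polynomial ring in t whose coefficients are divisible by
  t^2.\<close>

definition closed_ideal :: "('s::finite, 'a::comm_ring_1) mps set \<Rightarrow> bool" where
  "closed_ideal J \<longleftrightarrow> 0 \<in> J \<and> (\<forall>f\<in>J. \<forall>g\<in>J. f + g \<in> J) \<and> (\<forall>f. \<forall>g\<in>J. f * g \<in> J) \<and>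
     (\<forall>f. (\<forall>k. \<exists>g\<in>J. ord_ge k (f - g)) \<longrightarrow> f \<in> J)"

context
  fixes J :: "('s::finite, 'a::comm_ring_1) mps set"
  assumes J: "closed_ideal J"
begin

lemma closed_ideal_0: "0 \<in> J"
  and closed_ideal_add: "f \<in> J \<Longrightarrow> g \<in> J \<Longrightarrow> f + g \<in> J"
  and closed_ideal_mult: "g \<in> J \<Longrightarrow> f * g \<in> J"
  and closed_ideal_closed: "(\<And>k. \<exists>g\<in>J. ord_ge k (f - g)) \<Longrightarrow> f \<in> J"
  using J by (auto simp: closed_ideal_def)

lemma closed_ideal_mult_right: "g \<in> J \<Longrightarrow> g * f \<in> J"
  using closed_ideal_mult[of g f] by (simp add: mult.commute)

lemma closed_ideal_sum: "(\<And>i. i \<in> I \<Longrightarrow> f i \<in> J) \<Longrightarrow> (\<Sum>i\<in>I. f i) \<in> J"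
  by (induction I rule: infinite_finite_induct) (auto intro: closed_ideal_0 closed_ideal_add)

text \<open>The error \<open>E\<close> is additive, vanishes on constants, and \<open>E_X\<close>
  expresses \<open>E (mps_X j * f)\<close> through \<open>E f\<close> and products
  \<open>\<xi> j * \<xi> i\<close>. So the series with error in \<open>J\<close> are closed under
  all steps of the dense induction.\<close>

lemma taylor:
  fixes \<phi> \<xi> :: "'s \<Rightarrow> ('s, 'a) mps"
  assumes \<phi>: "\<And>i. ord_ge (Suc 0) (\<phi> i)" and \<xi>: "\<And>i. ord_ge (Suc 0) (\<xi> i)"
    and \<xi>2: "\<And>i j. \<xi> i * \<xi> j \<in> J"
  shows "mps_subst (\<lambda>i. \<phi> i + \<xi> i) f - mps_subst \<phi> f - (\<Sum>i\<in>UNIV. \<xi> i * mps_subst \<phi> (pd i f)) \<in> J"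
proof -
  have o: "ord_ge (Suc 0) (\<phi> i + \<xi> i)" for i by (simp add: \<phi> \<xi> ord_ge_add)
  define E where "E f = mps_subst (\<lambda>i. \<phi> i + \<xi> i) f - mps_subst \<phi> f - (\<Sum>i\<in>UNIV. \<xi> i * mps_subst \<phi> (pd i f))" for f
  have E_add: "E (f + g) = E f + E g" for f g
    by (simp add: E_def mps_subst_add o \<phi> pd_add algebra_simps sum.distrib)
  have E_diff: "E (f - g) = E f - E g" for f g
    by (metis E_add add_diff_cancel diff_add_cancel)
  have E_X: "E (mps_X j * f) = \<phi> j * E f + \<xi> j * (E f + (\<Sum>i\<in>UNIV. \<xi> i * mps_subst \<phi> (pd i f)))" for j f
  proof -
    let ?D = "\<Sum>i\<in>UNIV. \<xi> i * mps_subst \<phi> (pd i f)"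
    have "(\<Sum>i\<in>UNIV. \<xi> i * mps_subst \<phi> (pd i (mps_X j * f))) =
        (\<Sum>i\<in>UNIV. (if i = j then \<xi> j * mps_subst \<phi> f else 0) + \<phi> j * (\<xi> i * mps_subst \<phi> (pd i f)))"
    proof (rule sum.cong[OF refl])
      fix i
      have "mps_subst \<phi> 0 = 0" using ring_morph_0[OF ring_morph_subst[OF \<phi>]] .
      then show "\<xi> i * mps_subst \<phi> (pd i (mps_X j * f)) =
          (if i = j then \<xi> j * mps_subst \<phi> f else 0) + \<phi> j * (\<xi> i * mps_subst \<phi> (pd i f))"
        by (simp add: pd_X_mult mps_subst_add \<phi> mps_subst_X_mult distrib_left mult.left_commute)
    qed
    also have "\<dots> = \<xi> j * mps_subst \<phi> f + \<phi> j * ?D"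
      by (simp add: sum.distrib sum_distrib_left)
    finally show ?thesis
      by (simp add: E_def mps_subst_X_mult o \<phi>) (simp add: algebra_simps)
  qed
  have "E f \<in> J"
  proof (induction f rule: mps_dense_induct)
    case (const c)
    have "mps_subst \<phi> 0 = 0" using ring_morph_0[OF ring_morph_subst[OF \<phi>]] .
    then show ?case by (simp add: E_def pd_const mps_subst_const o \<phi> closed_ideal_0)
  next
    case (X j f)
    have "\<xi> j * (\<Sum>i\<in>UNIV. \<xi> i * mps_subst \<phi> (pd i f)) = (\<Sum>i\<in>UNIV. (\<xi> j * \<xi> i) * mps_subst \<phi> (pd i f))"
      by (simp add: sum_distrib_left mult.assoc)
    then have "\<xi> j * (\<Sum>i\<in>UNIV. \<xi> i * mps_subst \<phi> (pd i f)) \<in> J"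
      using \<xi>2 by (simp add: closed_ideal_sum closed_ideal_mult_right)
    then show ?case using X by (simp add: E_X distrib_left closed_ideal_add closed_ideal_mult)
  next
    case (closed f)
    show ?case
    proof (rule closed_ideal_closed)
      fix k
      \<comment> \<open>One extra order of approximation, because \<open>pd\<close> lowers the order
        by one.\<close>
      obtain g where g: "E g \<in> J" "ord_ge (Suc k) (f - g)" using closed by blast
      have g2: "ord_ge k (f - g)" using ord_ge_mono[OF g(2), of k] by simp
      have "ord_ge k (E (f - g))"
        unfolding E_def
        by (intro ord_ge_diff ord_ge_subst ord_ge_sum ord_ge_mult_left ord_ge_pd g g2 o \<phi>)
      then show "\<exists>g\<in>J. ord_ge k (E f - g)" using g(1) by (auto simp: E_diff)
    qed
  qed (auto simp: E_add closed_ideal_add)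
  then show ?thesis by (simp add: E_def)
qed

lemma ideal_mats_mult_left: "B \<in> ideal_mats J \<Longrightarrow> A ** B \<in> ideal_mats J"
  by (auto simp: ideal_mats_def matrix_matrix_mult_def intro!: closed_ideal_sum closed_ideal_mult)

lemma ideal_mats_mult_right: "A \<in> ideal_mats J \<Longrightarrow> A ** B \<in> ideal_mats J"
  by (auto simp: ideal_mats_def matrix_matrix_mult_def intro!: closed_ideal_sum closed_ideal_mult_right)

lemma ideal_mats_mult: "(\<And>i j k l. A $ i $ j * B $ k $ l \<in> J) \<Longrightarrow> A ** B \<in> ideal_mats J"
  by (auto simp: ideal_mats_def matrix_matrix_mult_def intro!: closed_ideal_sum)

lemma ideal_mats_add: "A \<in> ideal_mats J \<Longrightarrow> B \<in> ideal_mats J \<Longrightarrow> A + B \<in> ideal_mats J"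
  by (auto simp: ideal_mats_def closed_ideal_add)

end

section \<open>First-order expansion of the action\<close>

definition subst_act :: "('s::finite, 'a::comm_ring_1, 'm::finite, 'm) mps_mat \<Rightarrow> ('s, 'a, 'n::finite, 'n) mps_mat \<Rightarrow>
    ('s \<Rightarrow> ('s, 'a) mps) \<Rightarrow> ('s, 'a, 'm, 'n) mps_mat \<Rightarrow> ('s, 'a, 'm, 'n) mps_mat" where
  "subst_act U V \<phi> A = U ** map_matrix (mps_subst \<phi>) A ** V"

definition dir_deriv :: "('s::finite \<Rightarrow> ('s, 'a::comm_ring_1) mps) \<Rightarrow> ('s \<Rightarrow> ('s, 'a) mps) \<Rightarrow>
    ('s, 'a, 'm::finite, 'n::finite) mps_mat \<Rightarrow> ('s, 'a, 'm, 'n) mps_mat" where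
  "dir_deriv \<phi> \<xi> A = map_matrix (\<lambda>f. \<Sum>i\<in>UNIV. \<xi> i * mps_subst \<phi> (pd i f)) A"

text \<open>The action is linear in each matrix factor, so expanding leaves, besides the linear
  terms, only terms with the Taylor remainder or with a product of increments from two different
  factors; the assumptions put these into \<open>J\<close>.\<close>

lemma subst_act_taylor:
  fixes A :: "('s::finite, 'a::comm_ring_1, 'm::finite, 'n::finite) mps_mat"
    and u :: "('s, 'a, 'm, 'm) mps_mat" and v :: "('s, 'a, 'n, 'n) mps_mat"
  assumes J: "closed_ideal J"
    and \<phi>: "\<And>i. ord_ge (Suc 0) (\<phi> i)" and \<xi>: "\<And>i. ord_ge (Suc 0) (\<xi> i)"
    and \<xi>\<xi>: "\<And>i j. \<xi> i * \<xi> j \<in> J"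
    and u\<xi>: "\<And>i j k. u $ i $ j * \<xi> k \<in> J" and v\<xi>: "\<And>i j k. v $ i $ j * \<xi> k \<in> J"
    and uv: "\<And>i j k l. u $ i $ j * v $ k $ l \<in> J"
  shows "subst_act (U + u) (V + v) (\<lambda>i. \<phi> i + \<xi> i) A -
      (subst_act U V \<phi> A + (u ** map_matrix (mps_subst \<phi>) A ** V + U ** map_matrix (mps_subst \<phi>) A ** v
        + U ** dir_deriv \<phi> \<xi> A ** V)) \<in> ideal_mats J"
proof -
  define B where "B = map_matrix (mps_subst \<phi>) A"
  define d where "d = dir_deriv \<phi> \<xi> A"
  define r where "r = map_matrix (mps_subst (\<lambda>i. \<phi> i + \<xi> i)) A - B - d"
  have B': "map_matrix (mps_subst (\<lambda>i. \<phi> i + \<xi> i)) A = B + d + r"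
    by (simp add: r_def)
  have r: "r \<in> ideal_mats J"
    unfolding r_def ideal_mats_def B_def d_def dir_deriv_def
    using taylor[OF J \<phi> \<xi> \<xi>\<xi>] by simp
  have d1: "(\<Sum>l\<in>UNIV. \<xi> l * f l) * g \<in> J" if "\<And>l. g * \<xi> l \<in> J" for f g
    unfolding sum_distrib_right
  proof (rule closed_ideal_sum[OF J])
    fix l show "\<xi> l * f l * g \<in> J"
      using closed_ideal_mult[OF J that[of l], of "f l"] by (simp add: ac_simps)
  qed
  have dv: "d ** v \<in> ideal_mats J"
    by (rule ideal_mats_mult[OF J]) (simp add: d_def dir_deriv_def d1 v\<xi>)
  have ud: "u ** d \<in> ideal_mats J"
    by (rule ideal_mats_mult[OF J], subst mult.commute) (simp add: d_def dir_deriv_def d1 u\<xi>)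
  have uBv: "u ** B ** v \<in> ideal_mats J"
  proof (rule ideal_mats_mult[OF J])
    fix i j k l
    have "(u ** B) $ i $ j * v $ k $ l = (\<Sum>m\<in>UNIV. B $ m $ j * (u $ i $ m * v $ k $ l))"
      by (simp add: matrix_matrix_mult_def sum_distrib_left ac_simps)
    then show "(u ** B) $ i $ j * v $ k $ l \<in> J"
      by (simp add: closed_ideal_sum[OF J] closed_ideal_mult[OF J uv])
  qed
  note assoc = matrix_mul_assoc[symmetric]
  have "subst_act (U + u) (V + v) (\<lambda>i. \<phi> i + \<xi> i) A -
      (subst_act U V \<phi> A + (u ** B ** V + U ** B ** v + U ** d ** V)) =
      U ** r ** V + U ** (d ** v) + U ** r ** v + u ** d ** V + u ** r ** V
      + u ** B ** v + u ** (d ** v) + u ** r ** v"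
    unfolding subst_act_def B' B_def[symmetric]
    by (simp add: matrix_add_ldistrib matrix_add_rdistrib assoc)
  moreover have "\<dots> \<in> ideal_mats J"
    using r dv ud uBv
    by (simp add: ideal_mats_add[OF J] ideal_mats_mult_left[OF J] ideal_mats_mult_right[OF J])
  ultimately show ?thesis by (simp add: B_def d_def)
qed

lemma closed_ideal_ord_ge: "closed_ideal {f :: ('s::finite, 'a::comm_ring_1) mps. ord_ge k f}"
proof -
  have "ord_ge k f" if f: "\<forall>l. \<exists>g. ord_ge k g \<and> ord_ge l (f - g)" for f :: "('s, 'a) mps"
  proof -
    obtain g where "ord_ge k g" "ord_ge k (f - g)" using f by blast
    from ord_ge_add[OF this] show ?thesis by simp
  qed
  then show ?thesis
    by (auto simp: closed_ideal_def ord_ge_add ord_ge_mult_left)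
qed

section \<open>Parametrization of the groups\<close>

text \<open>
  Coordinates on the group: a function \<open>y\<close> on \<open>par_ix\<close> stands for the element
  \<open>(1 + u, 1 + v, x\<^sub>i \<mapsto> x\<^sub>i + \<xi>\<^sub>i)\<close>, where the coefficients of \<open>u\<close>, \<open>v\<close> and \<open>\<xi>\<close> are the values
  of \<open>y\<close> on the three summands. So \<open>0\<close> is the neutral element, and \<open>y\<close> makes sense over any
  commutative ring, in particular over polynomial rings.
\<close>

type_synonym ('s, 'm, 'n) par_ix = "('m \<times> 'm \<times> (nat ^ 's)) + ('n \<times> 'n \<times> (nat ^ 's)) + ('s \<times> (nat ^ 's))"

definition par_U :: "(('s::finite, 'm::finite, 'n::finite) par_ix \<Rightarrow> 'a) \<Rightarrow> ('s, 'a, 'm, 'm) mps_mat" where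
  "par_U y = (\<chi> i j. Abs_mps (\<lambda>\<alpha>. y (Inl (i, j, \<alpha>))))"

definition par_V :: "(('s::finite, 'm::finite, 'n::finite) par_ix \<Rightarrow> 'a) \<Rightarrow> ('s, 'a, 'n, 'n) mps_mat" where
  "par_V y = (\<chi> i j. Abs_mps (\<lambda>\<alpha>. y (Inr (Inl (i, j, \<alpha>)))))"

definition par_X :: "(('s::finite, 'm::finite, 'n::finite) par_ix \<Rightarrow> 'a) \<Rightarrow> 's \<Rightarrow> ('s, 'a) mps" where
  "par_X y i = Abs_mps (\<lambda>\<alpha>. y (Inr (Inr (i, \<alpha>))))"

definition par_elem :: "(('s::finite, 'm::finite, 'n::finite) par_ix \<Rightarrow> 'a::comm_ring_1) \<Rightarrow>
    ('s, 'a, 'm, 'm) mps_mat \<times> ('s, 'a, 'n, 'n) mps_mat \<times> (('s, 'a) mps \<Rightarrow> ('s, 'a) mps)" where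
  "par_elem y = (mat 1 + par_U y, mat 1 + par_V y, mps_subst (\<lambda>i. mps_X i + par_X y i))"

definition par_act :: "(('s::finite, 'm::finite, 'n::finite) par_ix \<Rightarrow> 'a::comm_ring_1) \<Rightarrow>
    ('s, 'a, 'm, 'n) mps_mat \<Rightarrow> ('s, 'a, 'm, 'n) mps_mat" where
  "par_act y = subst_act (mat 1 + par_U y) (mat 1 + par_V y) (\<lambda>i. mps_X i + par_X y i)"

lemma par_act_elem:
  fixes y :: "('s::finite, 'm::finite, 'n::finite) par_ix \<Rightarrow> 'a::field"
  shows "par_act y A = grp_act (par_elem y) A"
  by (simp add: par_act_def subst_act_def grp_act_def par_elem_def)

text \<open>Excluding \<alpha> = 0 in the last summand expresses that the images of the variables
  have no constant term, as they must for an automorphism.\<close>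

definition par_dom :: "grp \<Rightarrow> ('s::finite, 'm::finite, 'n::finite) par_ix set" where
  "par_dom G = {c. case c of Inl _ \<Rightarrow> G \<in> {Grp_l, Grp_lr} | Inr (Inl _) \<Rightarrow> G \<in> {Grp_r, Grp_lr}
     | Inr (Inr (i, \<alpha>)) \<Rightarrow> \<alpha> \<noteq> 0}"

fun par_deg :: "('s::finite, 'm::finite, 'n::finite) par_ix \<Rightarrow> nat" where
  "par_deg (Inl (i, j, \<alpha>)) = mdeg \<alpha>"
| "par_deg (Inr (Inl (i, j, \<alpha>))) = mdeg \<alpha>"
| "par_deg (Inr (Inr (i, \<alpha>))) = mdeg \<alpha>"

definition par_supp :: "grp \<Rightarrow> (('s::finite, 'm::finite, 'n::finite) par_ix \<Rightarrow> 'a::zero) \<Rightarrow> bool" where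
  "par_supp G y \<longleftrightarrow> (\<forall>c. c \<notin> par_dom G \<longrightarrow> y c = 0)"

text \<open>The determinants of the constant parts of the two matrices, times the Jacobian
  determinant of the substitution at the origin. Being a group element thus becomes one nonvanishing
  condition, polynomial in finitely many coordinates.\<close>

definition par_det :: "(('s::finite, 'm::finite, 'n::finite) par_ix \<Rightarrow> 'a::comm_ring_1) \<Rightarrow> 'a" where
  "par_det y = det (mat 1 + map_matrix (\<lambda>f. mps_nth f 0) (par_U y)) *
     (det (mat 1 + map_matrix (\<lambda>f. mps_nth f 0) (par_V y)) *
      det (mat 1 + (\<chi> i j. mps_nth (par_X y i) (axis j 1))))"

lemma par_supp_U: "par_supp G y \<Longrightarrow> G \<notin> {Grp_l, Grp_lr} \<Longrightarrow> par_U y = 0"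
  by (auto simp: par_supp_def par_U_def par_dom_def vec_eq_iff zero_mps.rep_eq intro!: mps_eqI)

lemma par_supp_V: "par_supp G y \<Longrightarrow> G \<notin> {Grp_r, Grp_lr} \<Longrightarrow> par_V y = 0"
  by (auto simp: par_supp_def par_V_def par_dom_def vec_eq_iff zero_mps.rep_eq intro!: mps_eqI)

lemma par_supp_X: "par_supp G y \<Longrightarrow> ord_ge (Suc 0) (par_X y i)"
  by (auto simp: par_supp_def par_X_def par_dom_def ord_ge_1_iff)

lemma par_elem_in_grp:
  fixes y :: "('s::finite, 'm::finite, 'n::finite) par_ix \<Rightarrow> 'a::field"
  assumes y: "par_supp G y" and d: "par_det y \<noteq> 0"
  shows "par_elem y \<in> grp_elems G"
proof -
  have 1: "map_matrix (\<lambda>f. mps_nth f 0) (mat 1 + M) = mat 1 + map_matrix (\<lambda>f. mps_nth f 0) M"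
    for M :: "('s, 'a, 'q::finite, 'q) mps_mat"
    by (simp add: vec_eq_iff mat_def mps_nth_simps one_mps.rep_eq)
  have U: "invertible (mat 1 + par_U y)" and V: "invertible (mat 1 + par_V y)"
    using d by (auto intro!: invertible_mps_mat simp: 1 par_det_def)
  have 2: "(\<chi> i j. mps_nth (mps_X i + par_X y i) (axis j 1)) =
      mat 1 + (\<chi> i j. mps_nth (par_X y i) (axis j 1))"
    by (intro iffD2[OF vec_eq_iff] allI) (auto simp: mat_def plus_mps.rep_eq mps_X.rep_eq axis_eq_axis)
  have "alg_aut (mps_subst (\<lambda>i. mps_X i + par_X y i))"
    by (rule alg_aut_subst) (use par_supp_X[OF y] d in \<open>auto simp: ord_ge_add 2 par_det_def\<close>)
  then show ?thesis
    using U V par_supp_U[OF y] par_supp_V[OF y] by (auto simp: grp_elems_def par_elem_def)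
qed

lemma par_U_add: "par_U (\<lambda>c. y c + z c) = par_U y + par_U (z :: _ \<Rightarrow> 'a::comm_ring_1)"
  and par_V_add: "par_V (\<lambda>c. y c + z c) = par_V y + par_V z"
  and par_X_add: "par_X (\<lambda>c. y c + z c) = (\<lambda>i. par_X y i + par_X z i)"
  by (auto simp: par_U_def par_V_def par_X_def vec_eq_iff plus_mps.rep_eq fun_eq_iff intro!: mps_eqI)

lemma par_U_map: "par_U (\<lambda>c. h (y c)) = map_matrix (mps_map h) (par_U y)"
  and par_V_map: "par_V (\<lambda>c. h (y c)) = map_matrix (mps_map h) (par_V y)"
  and par_X_map: "par_X (\<lambda>c. h (y c)) i = mps_map h (par_X y i)"
  by (auto simp: par_U_def par_V_def par_X_def vec_eq_iff mps_map.rep_eq intro!: mps_eqI)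

lemma subst_act_map:
  assumes h: "ring_morph h"
  shows "map_matrix (mps_map h) (subst_act U V \<phi> A) = subst_act (map_matrix (mps_map h) U)
    (map_matrix (mps_map h) V) (\<lambda>i. mps_map h (\<phi> i)) (map_matrix (mps_map h) A)"
  by (simp add: subst_act_def map_matrix_mult[OF ring_morph_mps_map[OF h]] map_matrix_comp mps_map_subst[OF h])

lemma par_act_map:
  assumes h: "ring_morph h"
  shows "map_matrix (mps_map h) (par_act y A) = par_act (\<lambda>c. h (y c)) (map_matrix (mps_map h) A)"
  by (simp add: par_act_def subst_act_map[OF h] par_U_map par_V_map par_X_map
      map_matrix_add[OF ring_morph_mps_map[OF h]] map_matrix_1[OF ring_morph_mps_map[OF h]]
      ring_morph_add[OF ring_morph_mps_map[OF h]] mps_map_X[OF h])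

definition par_deriv :: "(('s::finite, 'm::finite, 'n::finite) par_ix \<Rightarrow> 'a::comm_ring_1) \<Rightarrow>
    (('s, 'm, 'n) par_ix \<Rightarrow> 'a) \<Rightarrow> ('s, 'a, 'm, 'n) mps_mat \<Rightarrow> ('s, 'a, 'm, 'n) mps_mat" where
  "par_deriv y z A = (let \<phi> = \<lambda>i. mps_X i + par_X y i; U = mat 1 + par_U y; V = mat 1 + par_V y in
     par_U z ** map_matrix (mps_subst \<phi>) A ** V + U ** map_matrix (mps_subst \<phi>) A ** par_V z
     + U ** dir_deriv \<phi> (par_X z) A ** V)"

lemma par_act_taylor:
  fixes A :: "('s::finite, 'a::comm_ring_1, 'm::finite, 'n::finite) mps_mat"
    and y z :: "('s, 'm, 'n) par_ix \<Rightarrow> 'a"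
  assumes "closed_ideal J" and y: "par_supp G y" and z: "par_supp G z"
    and "\<And>i j. par_X z i * par_X z j \<in> J"
    and "\<And>i j k. par_U z $ i $ j * par_X z k \<in> J" and "\<And>i j k. par_V z $ i $ j * par_X z k \<in> J"
    and "\<And>i j k l. par_U z $ i $ j * par_V z $ k $ l \<in> J"
  shows "par_act (\<lambda>c. y c + z c) A - (par_act y A + par_deriv y z A) \<in> ideal_mats J"
  using subst_act_taylor[of J "\<lambda>i. mps_X i + par_X y i" "par_X z" "par_U z" "par_V z" "mat 1 + par_U y"
      "mat 1 + par_V y" A] assms par_supp_X[OF y] par_supp_X[OF z]
  by (simp add: par_act_def par_deriv_def Let_def par_U_add par_V_add par_X_add ord_ge_add add.assoc)

section \<open>Polynomials\<close>

definition monom_eval :: "('v \<Rightarrow> 'b::comm_semiring_1) \<Rightarrow> ('v \<Rightarrow>\<^sub>0 nat) \<Rightarrow> 'b" where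
  "monom_eval x e = (\<Prod>v\<in>Poly_Mapping.keys e. x v ^ Poly_Mapping.lookup e v)"

definition mpoly_const :: "'a::zero \<Rightarrow> ('v, 'a) mpoly" where
  "mpoly_const c = Poly_Mapping.single 0 c"

definition mpoly_var :: "'v \<Rightarrow> ('v, 'a::zero_neq_one) mpoly" where
  "mpoly_var v = Poly_Mapping.single (Poly_Mapping.single v 1) 1"

lemma monom_eval_superset:
  assumes "finite K" "Poly_Mapping.keys e \<subseteq> K"
  shows "monom_eval x e = (\<Prod>v\<in>K. x v ^ Poly_Mapping.lookup e v)"
  unfolding monom_eval_def using assms
  by (intro prod.mono_neutral_left) (auto simp: in_keys_iff)

lemma monom_eval_add: "monom_eval x (e + e') = monom_eval x e * monom_eval x e'"
proof -
  let ?K = "Poly_Mapping.keys e \<union> Poly_Mapping.keys e'"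
  have "monom_eval x (e + e') = (\<Prod>v\<in>?K. x v ^ Poly_Mapping.lookup (e + e') v)"
    by (rule monom_eval_superset) (auto simp: keys_add)
  also have "\<dots> = (\<Prod>v\<in>?K. x v ^ Poly_Mapping.lookup e v) * (\<Prod>v\<in>?K. x v ^ Poly_Mapping.lookup e' v)"
    by (simp add: lookup_add power_add prod.distrib)
  also have "\<dots> = monom_eval x e * monom_eval x e'"
    by (subst (1 2) monom_eval_superset[of ?K]) auto
  finally show ?thesis .
qed

lemma monom_eval_0 [simp]: "monom_eval x 0 = 1"
  by (simp add: monom_eval_def)

lemma monom_eval_single: "monom_eval x (Poly_Mapping.single v n) = x v ^ n"
  by (simp add: monom_eval_def)

lemma mpoly_eval_monom_eval:
  "mpoly_eval h x f = (\<Sum>e\<in>Poly_Mapping.keys f. h (Poly_Mapping.lookup f e) * monom_eval x e)"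
  by (simp add: mpoly_eval_def monom_eval_def)

lemma mpoly_eval_superset:
  assumes "h 0 = 0" "finite E" "Poly_Mapping.keys f \<subseteq> E"
  shows "mpoly_eval h x f = (\<Sum>e\<in>E. h (Poly_Mapping.lookup f e) * monom_eval x e)"
  unfolding mpoly_eval_monom_eval using assms
  by (intro sum.mono_neutral_left) (auto simp: in_keys_iff)

lemma mpoly_eval_single:
  assumes "h 0 = 0" shows "mpoly_eval h x (Poly_Mapping.single e c) = h c * monom_eval x e"
  by (subst mpoly_eval_superset[where E = "{e}"]) (use assms in auto)

lemma poly_mapping_sum_single: "f = (\<Sum>e\<in>Poly_Mapping.keys f. Poly_Mapping.single e (Poly_Mapping.lookup f e))"
proof (rule poly_mapping_eqI)
  fix e
  have "Poly_Mapping.lookup (\<Sum>e\<in>Poly_Mapping.keys f. Poly_Mapping.single e (Poly_Mapping.lookup f e)) e =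
      (\<Sum>e'\<in>Poly_Mapping.keys f. if e' = e then Poly_Mapping.lookup f e else 0)"
    unfolding lookup_sum by (rule sum.cong) (auto simp: lookup_single when_def)
  also have "\<dots> = Poly_Mapping.lookup f e" by (simp add: in_keys_iff)
  finally show "Poly_Mapping.lookup f e =
    Poly_Mapping.lookup (\<Sum>e\<in>Poly_Mapping.keys f. Poly_Mapping.single e (Poly_Mapping.lookup f e)) e" ..
qed

context
  fixes h :: "'a::comm_ring_1 \<Rightarrow> 'b::comm_ring_1"
  assumes h: "ring_morph h"
begin

lemma mpoly_eval_add: "mpoly_eval h x (f + g) = mpoly_eval h x f + mpoly_eval h x g"
proof -
  let ?E = "Poly_Mapping.keys f \<union> Poly_Mapping.keys g"
  have "mpoly_eval h x (f + g) = (\<Sum>e\<in>?E. h (Poly_Mapping.lookup (f + g) e) * monom_eval x e)"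
    by (rule mpoly_eval_superset) (auto simp: keys_add ring_morph_0[OF h])
  also have "\<dots> = (\<Sum>e\<in>?E. h (Poly_Mapping.lookup f e) * monom_eval x e) + (\<Sum>e\<in>?E. h (Poly_Mapping.lookup g e) * monom_eval x e)"
    by (simp add: lookup_add ring_morph_add[OF h] distrib_right sum.distrib)
  also have "\<dots> = mpoly_eval h x f + mpoly_eval h x g"
    by (subst (1 2) mpoly_eval_superset[of _ ?E]) (auto simp: ring_morph_0[OF h])
  finally show ?thesis .
qed

lemma mpoly_eval_0: "mpoly_eval h x 0 = 0"
  by (simp add: mpoly_eval_def)

lemma mpoly_eval_sum: "mpoly_eval h x (\<Sum>i\<in>I. f i) = (\<Sum>i\<in>I. mpoly_eval h x (f i))"
  by (induction I rule: infinite_finite_induct) (auto simp: mpoly_eval_0 mpoly_eval_add)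

lemma mpoly_eval_mult: "mpoly_eval h x (f * g) = mpoly_eval h x f * mpoly_eval h x g"
proof -
  have "mpoly_eval h x (f * g) = (\<Sum>e\<in>Poly_Mapping.keys f. \<Sum>e'\<in>Poly_Mapping.keys g.
      mpoly_eval h x (Poly_Mapping.single (e + e') (Poly_Mapping.lookup f e * Poly_Mapping.lookup g e')))"
    by (subst poly_mapping_sum_single[of f], subst poly_mapping_sum_single[of g])
       (simp add: sum_product mult_single mpoly_eval_sum)
  also have "\<dots> = (\<Sum>e\<in>Poly_Mapping.keys f. \<Sum>e'\<in>Poly_Mapping.keys g.
      h (Poly_Mapping.lookup f e * Poly_Mapping.lookup g e') * monom_eval x (e + e'))"
    by (simp only: mpoly_eval_single[of h, OF ring_morph_0[OF h]])
  also have "\<dots> = mpoly_eval h x f * mpoly_eval h x g"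
    by (simp add: mpoly_eval_monom_eval sum_product ring_morph_mult[OF h] monom_eval_add ac_simps)
  finally show ?thesis .
qed

lemma mpoly_eval_const: "mpoly_eval h x (mpoly_const c) = h c"
  by (simp add: mpoly_const_def mpoly_eval_single ring_morph_0[OF h])

lemma mpoly_eval_var: "mpoly_eval h x (mpoly_var v) = x v"
  by (simp add: mpoly_var_def mpoly_eval_single ring_morph_0[OF h] ring_morph_1[OF h] monom_eval_single)

lemma ring_morph_mpoly_eval: "ring_morph (mpoly_eval h x)"
  unfolding ring_morph_def using mpoly_eval_const[of x 1]
  by (simp add: mpoly_eval_add mpoly_eval_mult mpoly_const_def ring_morph_1[OF h])

end

lemma ring_morph_mpoly_const: "ring_morph (mpoly_const :: 'a::comm_ring_1 \<Rightarrow> ('v, 'a) mpoly)"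
  by (simp add: ring_morph_def mpoly_const_def single_add mult_single)

lemma ring_morph_id: "ring_morph (id :: 'a::comm_ring_1 \<Rightarrow> 'a)"
  by (simp add: ring_morph_def)

lemma ring_morph_pCons: "ring_morph (\<lambda>a :: 'a::comm_ring_1. [:a:])"
  by (simp add: ring_morph_def one_pCons)

lemma ring_morph_poly: "ring_morph (\<lambda>p. poly p (t :: 'a::comm_ring_1))"
  by (simp add: ring_morph_def)

lemma mpoly_eval_comp:
  assumes g: "ring_morph g"
  shows "g (mpoly_eval h x f) = mpoly_eval (\<lambda>a. g (h a)) (\<lambda>v. g (x v)) f"
  by (simp add: mpoly_eval_def ring_morph_simps[OF g])

lemma mpoly_eval_cong:
  assumes "\<And>v. v \<in> mpoly_vars f \<Longrightarrow> x v = y v"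
  shows "mpoly_eval h x f = mpoly_eval h y f"
proof -
  have "x v = y v" if "e \<in> Poly_Mapping.keys f" "v \<in> Poly_Mapping.keys e" for e v
    using assms[of v] that by (auto simp: mpoly_vars_def)
  then show ?thesis
    unfolding mpoly_eval_def by (auto intro!: sum.cong prod.cong arg_cong2[where f = "(*)"])
qed

lemma mpoly_vars_add: "mpoly_vars f \<subseteq> S \<Longrightarrow> mpoly_vars g \<subseteq> S \<Longrightarrow> mpoly_vars (f + g) \<subseteq> S"
  using keys_add[of f g] unfolding mpoly_vars_def by blast

lemma mpoly_vars_mult:
  assumes "mpoly_vars f \<subseteq> S" "mpoly_vars g \<subseteq> S"
  shows "mpoly_vars (f * g) \<subseteq> S"
proof
  fix v assume "v \<in> mpoly_vars (f * g)"
  then obtain a b where "a \<in> Poly_Mapping.keys f" "b \<in> Poly_Mapping.keys g" "v \<in> Poly_Mapping.keys (a + b)"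
    using keys_mult[of f g] unfolding mpoly_vars_def by blast
  then have "v \<in> mpoly_vars f \<union> mpoly_vars g"
    using keys_add[of a b] unfolding mpoly_vars_def by blast
  then show "v \<in> S" using assms by blast
qed

lemma mpoly_vars_const: "mpoly_vars (mpoly_const c) \<subseteq> S"
  by (simp add: mpoly_vars_def mpoly_const_def)

lemma mpoly_vars_var: "v \<in> S \<Longrightarrow> mpoly_vars (mpoly_var v) \<subseteq> S"
  by (simp add: mpoly_vars_def mpoly_var_def)

lemma mpoly_vars_0: "mpoly_vars 0 \<subseteq> S"
  by (simp add: mpoly_vars_def)

lemma mpoly_vars_1: "mpoly_vars (1 :: ('v, 'a::comm_semiring_1) mpoly) \<subseteq> S"
  using mpoly_vars_const[of "1 :: 'a" S] by (simp add: mpoly_const_def)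

lemma mpoly_vars_sum: "(\<And>i. i \<in> I \<Longrightarrow> mpoly_vars (f i) \<subseteq> S) \<Longrightarrow> mpoly_vars (\<Sum>i\<in>I. f i) \<subseteq> S"
  by (induction I rule: infinite_finite_induct) (simp_all add: mpoly_vars_0 mpoly_vars_add)

lemma mpoly_vars_power: "mpoly_vars f \<subseteq> S \<Longrightarrow> mpoly_vars (f ^ n :: ('v, 'a::comm_semiring_1) mpoly) \<subseteq> S"
  by (induction n) (simp_all add: mpoly_vars_1 mpoly_vars_mult)

lemma mpoly_vars_prod: "(\<And>i. i \<in> I \<Longrightarrow> mpoly_vars (f i) \<subseteq> S) \<Longrightarrow>
    mpoly_vars (\<Prod>i\<in>I. f i :: ('v, 'a::comm_semiring_1) mpoly) \<subseteq> S"
  by (induction I rule: infinite_finite_induct) (simp_all add: mpoly_vars_1 mpoly_vars_mult)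

lemma mpoly_vars_eval:
  assumes "\<And>v. v \<in> mpoly_vars f \<Longrightarrow> mpoly_vars (x v) \<subseteq> S"
  shows "mpoly_vars (mpoly_eval mpoly_const x f :: ('w, 'a::comm_ring_1) mpoly) \<subseteq> S"
  unfolding mpoly_eval_def using assms
  by (intro mpoly_vars_sum mpoly_vars_mult mpoly_vars_const mpoly_vars_prod mpoly_vars_power)
     (auto simp: mpoly_vars_def)

lemma lookup_mpoly_deriv:
  "Poly_Mapping.lookup (mpoly_deriv v f) e =
     of_nat (Suc (Poly_Mapping.lookup e v)) * Poly_Mapping.lookup f (e + Poly_Mapping.single v 1)"
proof -
  let ?s = "Poly_Mapping.single v (1::nat)"
  let ?g = "\<lambda>e'. of_nat (Poly_Mapping.lookup e' v) * Poly_Mapping.lookup f e'"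
  have *: "e' - ?s = e \<longleftrightarrow> e' = e + ?s" if "Poly_Mapping.lookup e' v \<noteq> 0" for e'
  proof -
    have "e' - ?s + ?s = e'"
      using that by (intro poly_mapping_eqI) (auto simp: lookup_add lookup_minus lookup_single when_def)
    then show ?thesis by auto
  qed
  have "Poly_Mapping.lookup (mpoly_deriv v f) e =
      (\<Sum>e'\<in>Poly_Mapping.keys f. if e' - ?s = e then ?g e' else 0)"
    by (simp add: mpoly_deriv_def lookup_sum lookup_single when_def)
  also have "\<dots> = (\<Sum>e'\<in>Poly_Mapping.keys f. if e' = e + ?s then ?g (e + ?s) else 0)"
  proof (rule sum.cong[OF refl])
    fix e' show "(if e' - ?s = e then ?g e' else 0) = (if e' = e + ?s then ?g (e + ?s) else 0)"
      by (cases "Poly_Mapping.lookup e' v = 0") (use *[of e'] in auto)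
  qed
  also have "\<dots> = ?g (e + ?s)" by (auto simp: in_keys_iff)
  finally show ?thesis by (simp add: lookup_add add.commute)
qed

lemma coeff_1_mult: "Polynomial.coeff (p * q) 1 =
    Polynomial.coeff p 0 * Polynomial.coeff q 1 + Polynomial.coeff p 1 * Polynomial.coeff q (0::nat)"
proof -
  have "{..1::nat} = {0, 1}" by auto
  then show ?thesis by (simp add: coeff_mult)
qed

lemma ring_morph_coeff_0: "ring_morph (\<lambda>p :: 'a::comm_ring_1 poly. Polynomial.coeff p 0)"
  by (simp add: ring_morph_def coeff_mult_0)

lemma coeff_1_power:
  "Polynomial.coeff (p ^ n) 1 =
     of_nat n * (Polynomial.coeff p 0 ^ (n - 1) * Polynomial.coeff (p :: 'a::comm_ring_1 poly) 1)"
proof (induction n)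
  case (Suc n)
  have "Polynomial.coeff (p ^ n) 0 = Polynomial.coeff p 0 ^ n"
    by (rule ring_morph_power[OF ring_morph_coeff_0])
  then show ?case using Suc by (cases n) (auto simp: coeff_1_mult algebra_simps)
qed simp

lemma coeff_1_prod:
  fixes p :: "'v \<Rightarrow> 'a::comm_ring_1 poly"
  shows "finite K \<Longrightarrow> Polynomial.coeff (\<Prod>v\<in>K. p v) 1 =
    (\<Sum>v\<in>K. Polynomial.coeff (p v) 1 * (\<Prod>u\<in>K - {v}. Polynomial.coeff (p u) 0))"
proof (induction K rule: finite_induct)
  case (insert w K)
  have "(\<Prod>u\<in>insert w K - {v}. Polynomial.coeff (p u) 0) =
      Polynomial.coeff (p w) 0 * (\<Prod>u\<in>K - {v}. Polynomial.coeff (p u) 0)" if "v \<in> K" for v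
    using that insert.hyps by (subst insert_Diff_if) auto
  moreover have "Polynomial.coeff (\<Prod>v\<in>K. p v) 0 = (\<Prod>v\<in>K. Polynomial.coeff (p v) 0)"
    by (rule ring_morph_prod[OF ring_morph_coeff_0])
  moreover have "insert w K - {w} = K" using insert.hyps by auto
  ultimately show ?case using insert
    by (simp add: coeff_1_mult sum_distrib_left ac_simps cong: sum.cong)
qed simp

text \<open>The chain rule along a curve \<open>c\<close> over K[t]. Derivatives are handled as
  linear coefficients of such evaluations, so that they inherit their calculus from evaluation being
  a ring homomorphism.\<close>

lemma coeff_1_mpoly_eval:
  fixes f :: "('v, 'a::comm_ring_1) mpoly" and c :: "'v \<Rightarrow> 'a poly"
  assumes S: "finite S" "mpoly_vars f \<subseteq> S"
  shows "Polynomial.coeff (mpoly_eval (\<lambda>a. [:a:]) c f) 1 =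
    (\<Sum>v\<in>S. mpoly_eval id (\<lambda>v. Polynomial.coeff (c v) 0) (mpoly_deriv v f) * Polynomial.coeff (c v) 1)"
proof -
  let ?x = "\<lambda>v. Polynomial.coeff (c v) 0"
  let ?s = "\<lambda>v. Poly_Mapping.single v (1::nat)"
  have m: "Polynomial.coeff (monom_eval c e) 1 =
      (\<Sum>v\<in>S. of_nat (Poly_Mapping.lookup e v) * monom_eval ?x (e - ?s v) * Polynomial.coeff (c v) 1)"
    if "Poly_Mapping.keys e \<subseteq> S" for e
  proof -
    have "Polynomial.coeff (c v ^ Poly_Mapping.lookup e v) 1 *
        (\<Prod>u\<in>S - {v}. Polynomial.coeff (c u ^ Poly_Mapping.lookup e u) 0) =
        of_nat (Poly_Mapping.lookup e v) * monom_eval ?x (e - ?s v) * Polynomial.coeff (c v) 1"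
      if "v \<in> S" for v
    proof -
      have "Poly_Mapping.keys (e - ?s v) \<subseteq> S"
        using \<open>Poly_Mapping.keys e \<subseteq> S\<close> by (auto simp: in_keys_iff lookup_minus subset_iff)
      then have "monom_eval ?x (e - ?s v) = (\<Prod>u\<in>S. ?x u ^ Poly_Mapping.lookup (e - ?s v) u)"
        using S by (intro monom_eval_superset)
      also have "\<dots> = ?x v ^ (Poly_Mapping.lookup e v - 1) * (\<Prod>u\<in>S - {v}. ?x u ^ Poly_Mapping.lookup (e - ?s v) u)"
        using S that by (subst prod.remove[of S v]) (auto simp: lookup_minus)
      also have "(\<Prod>u\<in>S - {v}. ?x u ^ Poly_Mapping.lookup (e - ?s v) u) = (\<Prod>u\<in>S - {v}. ?x u ^ Poly_Mapping.lookup e u)"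
        by (rule prod.cong) (auto simp: lookup_minus lookup_single when_def)
      finally show ?thesis
        by (simp add: coeff_1_power ring_morph_power[OF ring_morph_coeff_0] ac_simps)
    qed
    then show ?thesis using that S by (simp add: monom_eval_superset coeff_1_prod)
  qed
  have k: "Poly_Mapping.keys e \<subseteq> S" if "e \<in> Poly_Mapping.keys f" for e
    using S that by (auto simp: mpoly_vars_def)
  have "Polynomial.coeff (mpoly_eval (\<lambda>a. [:a:]) c f) 1 =
      (\<Sum>e\<in>Poly_Mapping.keys f. Poly_Mapping.lookup f e * Polynomial.coeff (monom_eval c e) 1)"
    by (simp add: mpoly_eval_monom_eval coeff_sum)
  also have "\<dots> = (\<Sum>e\<in>Poly_Mapping.keys f. \<Sum>v\<in>S. Poly_Mapping.lookup f e *
      (of_nat (Poly_Mapping.lookup e v) * monom_eval ?x (e - ?s v) * Polynomial.coeff (c v) 1))"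
    by (simp add: m k sum_distrib_left)
  also have "\<dots> = (\<Sum>v\<in>S. \<Sum>e\<in>Poly_Mapping.keys f. Poly_Mapping.lookup f e *
      (of_nat (Poly_Mapping.lookup e v) * monom_eval ?x (e - ?s v) * Polynomial.coeff (c v) 1))"
    by (rule sum.swap)
  also have "\<dots> = (\<Sum>v\<in>S. mpoly_eval id ?x (mpoly_deriv v f) * Polynomial.coeff (c v) 1)"
    by (simp add: mpoly_deriv_def mpoly_eval_sum[OF ring_morph_id] mpoly_eval_single
        sum_distrib_left sum_distrib_right ac_simps)
  finally show ?thesis .
qed

section \<open>Functions that are polynomial along lines\<close>

text \<open>Polynomial dependence along lines is all that the nonvanishing arguments below need; it
  is stable under sums and products and mentions neither degrees nor a set of variables.\<close>

definition line_poly :: "(('y \<Rightarrow> 'a) \<Rightarrow> 'a::comm_ring_1) \<Rightarrow> bool" where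
  "line_poly F \<longleftrightarrow> (\<forall>y z. \<exists>p. \<forall>t. F (\<lambda>c. y c + t * z c) = poly p t)"

lemma line_poly_const: "line_poly (\<lambda>_. a)"
  unfolding line_poly_def by (intro allI exI[of _ "[:a:]"]) simp

lemma line_poly_coord: "line_poly (\<lambda>y. y c)"
  unfolding line_poly_def
proof (intro allI)
  fix y z :: "'a \<Rightarrow> 'b"
  show "\<exists>p. \<forall>t. y c + t * z c = poly p t"
    by (intro exI[of _ "[:y c, z c:]"]) simp
qed

lemma line_poly_add: "line_poly F \<Longrightarrow> line_poly G \<Longrightarrow> line_poly (\<lambda>y. F y + G y)"
  unfolding line_poly_def by (metis poly_add)

lemma line_poly_mult: "line_poly F \<Longrightarrow> line_poly G \<Longrightarrow> line_poly (\<lambda>y. F y * G y)"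
  unfolding line_poly_def by (metis poly_mult)

lemma line_poly_sum: "(\<And>i. i \<in> I \<Longrightarrow> line_poly (F i)) \<Longrightarrow> line_poly (\<lambda>y. \<Sum>i\<in>I. F i y)"
  by (induction I rule: infinite_finite_induct) (auto intro: line_poly_const line_poly_add)

lemma line_poly_prod: "(\<And>i. i \<in> I \<Longrightarrow> line_poly (F i)) \<Longrightarrow> line_poly (\<lambda>y. \<Prod>i\<in>I. F i y)"
  by (induction I rule: infinite_finite_induct) (auto intro: line_poly_const line_poly_mult)

lemma line_poly_power: "line_poly F \<Longrightarrow> line_poly (\<lambda>y. F y ^ n)"
  by (induction n) (auto intro: line_poly_const line_poly_mult)

lemma line_poly_mpoly_eval:
  "(\<And>v. line_poly (\<lambda>y. G v y)) \<Longrightarrow> line_poly (\<lambda>y. mpoly_eval h (\<lambda>v. G v y) f)"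
  unfolding mpoly_eval_def
  by (intro line_poly_sum line_poly_mult line_poly_const line_poly_prod line_poly_power)

lemma line_poly_det: "(\<And>i j. line_poly (\<lambda>y. M y $ i $ j)) \<Longrightarrow> line_poly (\<lambda>y. det (M y))"
  unfolding det_def by (intro line_poly_sum line_poly_mult line_poly_const line_poly_prod)

text \<open>On the line through \<open>a\<close> and \<open>b\<close> both functions are nonzero
  polynomials in \<open>t\<close>, and an infinite field contains a point outside the finitely many
  roots of their product.\<close>

lemma line_poly_nonzero_mult:
  fixes F G :: "('y \<Rightarrow> 'a::field_char_0) \<Rightarrow> 'a"
  assumes "line_poly F" "line_poly G" "F a \<noteq> 0" "G b \<noteq> 0"
  shows "\<exists>y. F y \<noteq> 0 \<and> G y \<noteq> 0"
proof -
  let ?l = "\<lambda>t c. a c + t * (b c - a c)"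
  obtain p q where p: "\<And>t. F (?l t) = poly p t" and q: "\<And>t. G (?l t) = poly q t"
    using assms(1,2) unfolding line_poly_def by metis
  have "p \<noteq> 0" using p[of 0] assms(3) by auto
  moreover have "q \<noteq> 0" using q[of 1] assms(4) by auto
  ultimately have "finite {t. poly (p * q) t = 0}" by (intro poly_roots_finite) auto
  then obtain t where "poly (p * q) t \<noteq> 0"
    using infinite_UNIV_char_0[where 'a = 'a] by (metis (mono_tags, lifting) UNIV_eq_I mem_Collect_eq)
  then show ?thesis using p q by (intro exI[of _ "?l t"]) auto
qed

lemma line_poly_common_nonzero:
  fixes F :: "'i \<Rightarrow> ('y \<Rightarrow> 'a::field_char_0) \<Rightarrow> 'a"
  assumes "finite I" "\<And>i. i \<in> I \<Longrightarrow> line_poly (F i)" "\<And>i. i \<in> I \<Longrightarrow> \<exists>y. F i y \<noteq> 0"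
  shows "\<exists>y. \<forall>i\<in>I. F i y \<noteq> 0"
proof -
  have "\<exists>y. (\<Prod>i\<in>I. F i y) \<noteq> 0"
    using assms
  proof (induction I rule: finite_induct)
    case (insert i I)
    then obtain a b where "F i a \<noteq> 0" "(\<Prod>i\<in>I. F i b) \<noteq> 0" by fastforce
    with line_poly_nonzero_mult[of "F i" "\<lambda>y. \<Prod>i\<in>I. F i y" a b] show ?case
      using insert by (auto intro: line_poly_prod)
  qed simp
  then show ?thesis using assms(1) by simp
qed

text \<open>Density of rational points. The entries in \<open>Y\<close> are released from
  \<open>range h\<close> one at a time; in each of them the function is a polynomial with infinitely
  many zeros.\<close>

lemma line_poly_zero_extend:
  fixes F :: "('y \<Rightarrow> 'b::field) \<Rightarrow> 'b" and h :: "'a::field_char_0 \<Rightarrow> 'b"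
  assumes F: "line_poly F" and h: "inj h" and 0: "\<And>y. F (\<lambda>c. h (y c)) = 0"
    and "finite Y" and z: "\<And>c. c \<notin> Y \<Longrightarrow> z c \<in> range h"
  shows "F z = 0"
  using \<open>finite Y\<close> z
proof (induction Y arbitrary: z rule: finite_induct)
  case empty
  then have "\<forall>c. \<exists>a. z c = h a" by blast
  then obtain y where "\<And>c. z c = h (y c)" by metis
  then have "z = (\<lambda>c. h (y c))" by auto
  then show ?case using 0 by simp
next
  case (insert j Y)
  let ?l = "\<lambda>t c. (if c = j then 0 else z c) + t * (if c = j then 1 else 0)"
  obtain p where p: "\<And>t. F (?l t) = poly p t"
    using F unfolding line_poly_def by metis
  have "poly p (h a) = 0" for a
    unfolding p[symmetric] by (rule insert.IH) (use insert.prems in auto)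
  then have "range h \<subseteq> {t. poly p t = 0}" by auto
  moreover have "infinite (range h)"
    using h infinite_UNIV_char_0[where 'a = 'a] by (simp add: finite_image_iff)
  ultimately have "p = 0" using poly_roots_finite finite_subset by blast
  moreover have "?l (z j) = z" by auto
  ultimately show ?case using p[of "z j"] by simp
qed

section \<open>Linear systems\<close>

text \<open>Gaussian elimination: the equation \<open>j\<close> eliminates the unknown
  \<open>k\<close> from the others, which leaves one equation and one unknown less.\<close>

lemma homogeneous_system:
  fixes c :: "'j \<Rightarrow> 'i \<Rightarrow> 'a::field"
  assumes "finite J" "finite I" "card J < card I"
  shows "\<exists>x. (\<exists>i\<in>I. x i \<noteq> 0) \<and> (\<forall>j\<in>J. (\<Sum>i\<in>I. c j i * x i) = 0)"
  using assms
proof (induction J arbitrary: I c rule: finite_induct)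
  case empty
  then have "I \<noteq> {}" by auto
  then show ?case by (intro exI[of _ "\<lambda>_. 1"]) auto
next
  case (insert j J)
  show ?case
  proof (cases "\<forall>i\<in>I. c j i = 0")
    case True
    have "card J < card I" using insert by simp
    from insert.IH[OF insert.prems(1) this, of c] True show ?thesis by auto
  next
    case False
    then obtain k where k: "k \<in> I" "c j k \<noteq> 0" by blast
    define d where "d j' i = c j' i - c j' k * c j i / c j k" for j' i
    have "card J < card (I - {k})" using insert k by simp
    from insert.IH[OF _ this, of d] insert.prems(1) obtain x where
      x: "\<exists>i\<in>I - {k}. x i \<noteq> 0" "\<forall>j'\<in>J. (\<Sum>i\<in>I - {k}. d j' i * x i) = 0" by auto
    define s where "s = (\<Sum>i\<in>I - {k}. c j i * x i)"
    define y where "y = x(k := - s / c j k)"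
    have sum_y: "(\<Sum>i\<in>I. c j' i * y i) = (\<Sum>i\<in>I - {k}. c j' i * x i) - c j' k * s / c j k" for j'
    proof -
      have "(\<Sum>i\<in>I. c j' i * y i) = c j' k * y k + (\<Sum>i\<in>I - {k}. c j' i * y i)"
        using insert.prems(1) k(1) by (rule sum.remove)
      also have "(\<Sum>i\<in>I - {k}. c j' i * y i) = (\<Sum>i\<in>I - {k}. c j' i * x i)"
        by (rule sum.cong) (auto simp: y_def)
      finally show ?thesis by (simp add: y_def)
    qed
    have "(\<Sum>i\<in>I. c j' i * y i) = 0" if "j' \<in> J" for j'
    proof -
      have "(\<Sum>i\<in>I - {k}. d j' i * x i) = (\<Sum>i\<in>I - {k}. c j' i * x i) - c j' k * s / c j k"
        by (simp add: d_def s_def sum_subtractf[symmetric] sum_distrib_left sum_divide_distrib algebra_simps)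
      then show ?thesis using x that sum_y by simp
    qed
    moreover have "(\<Sum>i\<in>I. c j i * y i) = 0" using k by (simp add: sum_y s_def)
    moreover have "\<exists>i\<in>I. y i \<noteq> 0" using x(1) by (auto simp: y_def)
    ultimately show ?thesis by auto
  qed
qed

text \<open>With \<open>- b\<close> adjoined as a column there are more unknowns than equations,
  hence a nontrivial solution; injectivity forces its extra entry to be nonzero, and one divides by
  it.\<close>

lemma linear_system_solvable:
  fixes c :: "'j \<Rightarrow> 'i \<Rightarrow> 'a::field"
  assumes fin: "finite J" "finite I" and card: "card J \<le> card I"
    and inj: "\<And>x. (\<forall>j\<in>J. (\<Sum>i\<in>I. c j i * x i) = 0) \<Longrightarrow> \<forall>i\<in>I. x i = 0"
  shows "\<exists>x. \<forall>j\<in>J. (\<Sum>i\<in>I. c j i * x i) = b j"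
proof -
  define c' where "c' j i = (case i of None \<Rightarrow> - b j | Some i \<Rightarrow> c j i)" for j i
  have "card J < card (insert None (Some ` I))"
    using fin card by (simp add: card_image)
  from homogeneous_system[OF fin(1) _ this, of c'] fin obtain x where
    x: "\<exists>i\<in>insert None (Some ` I). x i \<noteq> 0"
      "\<And>j. j \<in> J \<Longrightarrow> (\<Sum>i\<in>insert None (Some ` I). c' j i * x i) = 0" by auto
  have eq: "(\<Sum>i\<in>I. c j i * x (Some i)) = b j * x None" if "j \<in> J" for j
    using x(2)[OF that] fin by (simp add: c'_def sum.reindex)
  have "x None \<noteq> 0"
  proof
    assume "x None = 0"
    then have "\<forall>i\<in>I. x (Some i) = 0" using inj[of "\<lambda>i. x (Some i)"] eq by simp
    then show False using x(1) \<open>x None = 0\<close> by auto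
  qed
  then have "(\<Sum>i\<in>I. c j i * (x (Some i) / x None)) = b j" if "j \<in> J" for j
    using eq[OF that] by (simp add: sum_divide_distrib[symmetric])
  then show ?thesis by (intro exI[of _ "\<lambda>i. x (Some i) / x None"] ballI)
qed

section \<open>Algebraic dependence\<close>

definition exps :: "'y set \<Rightarrow> nat \<Rightarrow> ('y \<Rightarrow>\<^sub>0 nat) set" where
  "exps Y d = {e. Poly_Mapping.keys e \<subseteq> Y \<and> (\<forall>v. Poly_Mapping.lookup e v \<le> d)}"

lemma bij_betw_exps:
  assumes "finite Y"
  shows "bij_betw (\<lambda>e. restrict (Poly_Mapping.lookup e) Y) (exps Y d) (PiE Y (\<lambda>_. {..d}))"
proof (rule bij_betw_byWitness[where f' = "\<lambda>f. Abs_poly_mapping (\<lambda>v. if v \<in> Y then f v else 0)"])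
  have l: "Poly_Mapping.lookup (Abs_poly_mapping (\<lambda>v. if v \<in> Y then f v else 0)) =
      (\<lambda>v. if v \<in> Y then f v else (0::nat))" for f
    using assms by (intro lookup_Abs_poly_mapping) (auto intro: finite_subset)
  show "\<forall>e\<in>exps Y d. Abs_poly_mapping (\<lambda>v. if v \<in> Y then restrict (Poly_Mapping.lookup e) Y v else 0) = e"
  proof
    fix e assume "e \<in> exps Y d"
    then have "(\<lambda>v. if v \<in> Y then restrict (Poly_Mapping.lookup e) Y v else 0) = Poly_Mapping.lookup e"
      by (auto simp: exps_def fun_eq_iff in_keys_iff)
    then show "Abs_poly_mapping (\<lambda>v. if v \<in> Y then restrict (Poly_Mapping.lookup e) Y v else 0) = e"
      by (simp add: Poly_Mapping.lookup_inverse)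
  qed
  show "\<forall>f\<in>PiE Y (\<lambda>_. {..d}). restrict (Poly_Mapping.lookup (Abs_poly_mapping (\<lambda>v. if v \<in> Y then f v else 0))) Y = f"
    by (auto simp: l fun_eq_iff PiE_def extensional_def)
  show "(\<lambda>e. restrict (Poly_Mapping.lookup e) Y) ` exps Y d \<subseteq> PiE Y (\<lambda>_. {..d})"
    by (auto simp: exps_def)
  show "(\<lambda>f. Abs_poly_mapping (\<lambda>v. if v \<in> Y then f v else 0)) ` PiE Y (\<lambda>_. {..d}) \<subseteq> exps Y d"
    by (auto simp: exps_def l in_keys_iff split: if_splits)
qed

lemma finite_exps: "finite Y \<Longrightarrow> finite (exps Y d)"
  using bij_betw_finite[OF bij_betw_exps, of Y d] by (simp add: finite_PiE)

lemma card_exps: "finite Y \<Longrightarrow> card (exps Y d) = Suc d ^ card Y"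
  using bij_betw_same_card[OF bij_betw_exps, of Y d] by (simp add: card_PiE)

lemma exps_mono: "d \<le> d' \<Longrightarrow> exps Y d \<subseteq> exps Y d'"
  unfolding exps_def using order_trans by blast

lemma exps_add:
  assumes "e \<in> exps Y d" "e' \<in> exps Y d'" shows "e + e' \<in> exps Y (d + d')"
  using assms keys_add[of e e'] by (auto simp: exps_def lookup_add intro!: add_mono)

lemma keys_mult_exps:
  assumes "Poly_Mapping.keys f \<subseteq> exps Y d" "Poly_Mapping.keys g \<subseteq> exps Y d'"
  shows "Poly_Mapping.keys (f * g) \<subseteq> exps Y (d + d')"
  using keys_mult[of f g] assms exps_add by blast

lemma keys_1_exps: "Poly_Mapping.keys (1 :: ('y, 'a::comm_semiring_1) mpoly) \<subseteq> exps Y d"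
proof -
  have "Poly_Mapping.keys (1 :: ('y, 'a) mpoly) \<subseteq> {0}" by simp
  also have "\<dots> \<subseteq> exps Y d" by (simp add: exps_def)
  finally show ?thesis .
qed

lemma keys_power_exps:
  assumes "Poly_Mapping.keys f \<subseteq> exps Y d"
  shows "Poly_Mapping.keys (f ^ n :: ('y, 'a::comm_semiring_1) mpoly) \<subseteq> exps Y (n * d)"
  by (induction n) (use assms in \<open>auto simp del: keys_one simp: keys_1_exps intro: keys_mult_exps[THEN subsetD]\<close>)

lemma keys_prod_exps:
  fixes f :: "'b \<Rightarrow> ('y, 'a::comm_semiring_1) mpoly"
  assumes "finite B" "\<And>b. b \<in> B \<Longrightarrow> Poly_Mapping.keys (f b) \<subseteq> exps Y d"
  shows "Poly_Mapping.keys (\<Prod>b\<in>B. f b) \<subseteq> exps Y (card B * d)"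
  using assms
proof (induction B rule: finite_induct)
  case empty
  show ?case by (simp del: keys_one add: keys_1_exps)
next
  case (insert b B)
  then show ?case using keys_mult_exps[of "f b" Y d "\<Prod>b\<in>B. f b" "card B * d"] by simp
qed

lemma exps_bound:
  assumes "finite Y" "mpoly_vars f \<subseteq> Y"
  shows "\<exists>d. Poly_Mapping.keys f \<subseteq> exps Y d"
proof -
  define d where "d = (\<Sum>e\<in>Poly_Mapping.keys f. \<Sum>v\<in>Poly_Mapping.keys e. Poly_Mapping.lookup e v)"
  have "e \<in> exps Y d" if e: "e \<in> Poly_Mapping.keys f" for e
  proof -
    have "Poly_Mapping.lookup e v \<le> d" for v
    proof (cases "v \<in> Poly_Mapping.keys e")
      case True
      have "Poly_Mapping.lookup e v \<le> (\<Sum>v\<in>Poly_Mapping.keys e. Poly_Mapping.lookup e v)"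
        by (rule member_le_sum) (use True in auto)
      also have "\<dots> \<le> d" unfolding d_def
        using e by (intro member_le_sum[where f = "\<lambda>e. \<Sum>v\<in>Poly_Mapping.keys e. Poly_Mapping.lookup e v"]) auto
      finally show ?thesis .
    qed (simp add: in_keys_iff)
    then show ?thesis using e assms by (auto simp: exps_def mpoly_vars_def)
  qed
  then show ?thesis by blast
qed

lemma lookup_const_mult:
  "Poly_Mapping.lookup (mpoly_const c * f) e = c * Poly_Mapping.lookup (f :: ('v, 'a::comm_semiring_1) mpoly) e"
  by (simp add: mpoly_const_def mult_map_scale_conv_mult[symmetric] map.rep_eq when_def)

text \<open>Counting: the number of monomials in \<open>B\<close> with exponents up to
  \<open>d\<close> grows like the power \<open>card B\<close> of \<open>d\<close>, while their
  images lie in a space whose dimension grows only like the power \<open>card Y\<close>. So the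
  images become linearly dependent.\<close>

lemma algebraically_dependent:
  fixes p :: "'b \<Rightarrow> ('y, 'a::field) mpoly"
  assumes Y: "finite Y" and B: "finite B" and card: "card Y < card B"
    and p: "\<And>b. b \<in> B \<Longrightarrow> mpoly_vars (p b) \<subseteq> Y"
  shows "\<exists>P. P \<noteq> 0 \<and> mpoly_vars P \<subseteq> B \<and> mpoly_eval mpoly_const p P = 0"
proof -
  obtain \<delta> where \<delta>: "\<And>b. b \<in> B \<Longrightarrow> Poly_Mapping.keys (p b) \<subseteq> exps Y (\<delta> b)"
    using exps_bound[OF Y p] by metis
  define \<Delta> where "\<Delta> = sum \<delta> B"
  have \<Delta>: "Poly_Mapping.keys (p b) \<subseteq> exps Y \<Delta>" if "b \<in> B" for b
    using \<delta>[OF that] exps_mono[of "\<delta> b" \<Delta> Y] member_le_sum[OF that, of \<delta>] B by (auto simp: \<Delta>_def)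
  \<comment> \<open>The images have exponents up to \<open>N\<close>, and
    \<open>Suc N \<le> C * Suc d\<close>. Raised to \<open>card Y\<close> this contributes the
    constant factor \<open>C ^ card Y\<close>; taking it as \<open>d\<close> lets a single
    additional factor \<open>Suc d\<close> beat it.\<close>
  define C where "C = Suc (card B * \<Delta>)"
  define d where "d = C ^ card Y"
  define N where "N = card B * (d * \<Delta>)"
  have keys_mon: "Poly_Mapping.keys (monom_eval p e) \<subseteq> exps Y N" if e: "e \<in> exps B d" for e
  proof -
    have "Poly_Mapping.keys (\<Prod>b\<in>B. p b ^ Poly_Mapping.lookup e b) \<subseteq> exps Y (card B * (d * \<Delta>))"
    proof (rule keys_prod_exps[OF B])
      fix b assume "b \<in> B"
      have "Poly_Mapping.lookup e b * \<Delta> \<le> d * \<Delta>" using e by (simp add: exps_def)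
      from exps_mono[OF this] keys_power_exps[OF \<Delta>[OF \<open>b \<in> B\<close>]]
      show "Poly_Mapping.keys (p b ^ Poly_Mapping.lookup e b) \<subseteq> exps Y (d * \<Delta>)" by blast
    qed
    then show ?thesis using e B by (simp add: monom_eval_superset[of B] exps_def N_def)
  qed
  have "Suc N ^ card Y \<le> (C * Suc d) ^ card Y"
    by (rule power_mono) (auto simp: N_def C_def algebra_simps)
  also have "\<dots> = d * Suc d ^ card Y" by (simp only: power_mult_distrib d_def)
  also have "\<dots> < Suc d ^ Suc (card Y)" by simp
  also have "\<dots> \<le> Suc d ^ card B" using card by (intro power_increasing) auto
  finally have "card (exps Y N) < card (exps B d)" using Y B by (simp add: card_exps)
  from homogeneous_system[OF finite_exps[OF Y] finite_exps[OF B] this, of "\<lambda>e' e. Poly_Mapping.lookup (monom_eval p e) e'"]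
  obtain x where x: "\<exists>e\<in>exps B d. x e \<noteq> 0"
    "\<And>e'. e' \<in> exps Y N \<Longrightarrow> (\<Sum>e\<in>exps B d. Poly_Mapping.lookup (monom_eval p e) e' * x e) = 0" by blast
  define P where "P = (\<Sum>e\<in>exps B d. Poly_Mapping.single e (x e))"
  have lP: "Poly_Mapping.lookup P e = (if e \<in> exps B d then x e else 0)" for e
    using finite_exps[OF B] by (simp add: P_def lookup_sum lookup_single when_def)
  have "P \<noteq> 0" using x(1) lP by (metis lookup_zero)
  moreover have "Poly_Mapping.keys P \<subseteq> exps B d" using lP by (auto simp: in_keys_iff split: if_splits)
  then have "mpoly_vars P \<subseteq> B" by (auto simp: mpoly_vars_def exps_def)
  moreover have "mpoly_eval mpoly_const p P = 0"
  proof (rule poly_mapping_eqI)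
    fix e'
    have "Poly_Mapping.lookup (mpoly_eval mpoly_const p P) e' =
        (\<Sum>e\<in>exps B d. Poly_Mapping.lookup (monom_eval p e) e' * x e)"
      by (subst mpoly_eval_superset[of mpoly_const, OF ring_morph_0[OF ring_morph_mpoly_const] finite_exps[OF B] \<open>Poly_Mapping.keys P \<subseteq> exps B d\<close>])
         (simp add: lookup_sum lookup_const_mult lP, simp add: mult.commute)
    also have "\<dots> = 0"
    proof (cases "e' \<in> exps Y N")
      case False
      then have "Poly_Mapping.lookup (monom_eval p e) e' = 0" if "e \<in> exps B d" for e
        using keys_mon[OF that] by (auto simp: in_keys_iff)
      then show ?thesis by simp
    qed (use x in simp)
    finally show "Poly_Mapping.lookup (mpoly_eval mpoly_const p P) e' = Poly_Mapping.lookup 0 e'" by simp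
  qed
  ultimately show ?thesis by blast
qed

section \<open>The tangent space of the image of a polynomial map\<close>

text \<open>The differential of \<open>f\<close> at \<open>g\<close> in the direction
  \<open>D\<close>, read off from the line \<open>g + t D\<close>.\<close>

definition mpoly_diff :: "('y \<Rightarrow> 'a) \<Rightarrow> ('y \<Rightarrow> 'a) \<Rightarrow> ('y, 'a::comm_ring_1) mpoly \<Rightarrow> 'a" where
  "mpoly_diff g D f = Polynomial.coeff (mpoly_eval (\<lambda>a. [:a:]) (\<lambda>j. [:g j, D j:]) f) 1"

lemma coeff_pCons_1: "Polynomial.coeff [:a, b:] 1 = b"
  by (simp add: One_nat_def)

lemma mpoly_diff_sum:
  "finite Y \<Longrightarrow> mpoly_vars f \<subseteq> Y \<Longrightarrow>
    mpoly_diff g D f = (\<Sum>j\<in>Y. mpoly_eval id g (mpoly_deriv j f) * D j)"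
  unfolding mpoly_diff_def by (simp add: coeff_1_mpoly_eval coeff_pCons_1)

lemma mpoly_diff_var: "mpoly_diff g D (mpoly_var j) = D j"
  by (simp add: mpoly_diff_def mpoly_eval_var[OF ring_morph_pCons] coeff_pCons_1)

lemma coeff_0_line_eval:
  "Polynomial.coeff (mpoly_eval (\<lambda>a. [:a:]) (\<lambda>j. [:g j, D j:]) f) 0 = mpoly_eval id g (f :: ('y, 'a::comm_ring_1) mpoly)"
  by (simp add: mpoly_eval_comp[OF ring_morph_coeff_0] id_def)

lemma poly_line_eval:
  "poly (mpoly_eval (\<lambda>a. [:a:]) (\<lambda>j. [:g j, D j:]) f) t = mpoly_eval id (\<lambda>j. g j + t * D j) (f :: ('y, 'a::comm_ring_1) mpoly)"
  by (simp add: mpoly_eval_comp[OF ring_morph_poly] id_def)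

lemma poly_eq_0_if_all_0:
  fixes p :: "'a::field_char_0 poly"
  shows "(\<And>t. poly p t = 0) \<Longrightarrow> p = 0"
  by (metis poly_all_0_iff_0)

context
  fixes F :: "'w \<Rightarrow> ('y, 'a::field_char_0) mpoly"
begin

text \<open>Being a relation is tested at rational parameters only; over an infinite field this
  agrees with an identity of polynomials.\<close>

definition alg_rel :: "('w, 'a) mpoly \<Rightarrow> bool" where
  "alg_rel P \<longleftrightarrow> (\<forall>y. mpoly_eval id (\<lambda>w. mpoly_eval id y (F w)) P = 0)"

definition alg_indep :: "'w set \<Rightarrow> bool" where
  "alg_indep B \<longleftrightarrow> (\<forall>P. mpoly_vars P \<subseteq> B \<longrightarrow> alg_rel P \<longrightarrow> P = 0)"

lemma alg_indep_empty: "alg_indep {}"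
  unfolding alg_indep_def
proof (intro allI impI)
  fix P assume P: "mpoly_vars P \<subseteq> {}" "alg_rel P"
  have "Poly_Mapping.keys P \<subseteq> {0}"
  proof
    fix e assume "e \<in> Poly_Mapping.keys P"
    then have "Poly_Mapping.keys e = {}" using P(1) by (auto simp: mpoly_vars_def)
    then show "e \<in> {0}" by (simp add: poly_mapping_eqI in_keys_iff[symmetric] lookup_eq_zero_in_keys_contradict)
  qed
  from mpoly_eval_superset[OF _ _ this, of id] have "mpoly_eval id x P = Poly_Mapping.lookup P 0" for x :: "'w \<Rightarrow> 'a"
    by simp
  then have "Poly_Mapping.lookup P 0 = 0" using P(2) by (simp add: alg_rel_def)
  then show "P = 0" using \<open>Poly_Mapping.keys P \<subseteq> {0}\<close> by (metis in_keys_iff keys_eq_empty subset_singletonD insertI1)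
qed

lemma alg_indep_subset: "alg_indep B \<Longrightarrow> B' \<subseteq> B \<Longrightarrow> alg_indep B'"
  unfolding alg_indep_def by (meson order_trans)

lemma alg_indep_card:
  assumes "finite Y" "finite B" "\<And>b. b \<in> B \<Longrightarrow> mpoly_vars (F b) \<subseteq> Y" "alg_indep B"
  shows "card B \<le> card Y"
proof (rule ccontr)
  assume "\<not> card B \<le> card Y"
  then obtain P where P: "P \<noteq> 0" "mpoly_vars P \<subseteq> B" "mpoly_eval mpoly_const F P = 0"
    using algebraically_dependent[of Y B F] assms by auto
  have "mpoly_eval id (\<lambda>w. mpoly_eval id y (F w)) P = mpoly_eval id y (mpoly_eval mpoly_const F P)" for y
    unfolding mpoly_eval_comp[of "mpoly_eval id y", OF ring_morph_mpoly_eval[OF ring_morph_id]]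
      mpoly_eval_const[OF ring_morph_id] by (simp add: id_def)
  then have "alg_rel P" by (simp add: alg_rel_def P(3) mpoly_eval_0[OF ring_morph_id])
  then show False using P assms(4) by (auto simp: alg_indep_def)
qed

text \<open>A relation of minimal degree in \<open>w\<close> has a derivative in direction \<open>w\<close> that is not a relation.\<close>

lemma alg_dependent_deriv:
  assumes B: "alg_indep B" and w: "\<not> alg_indep (insert w B)"
  shows "\<exists>Q. mpoly_vars Q \<subseteq> insert w B \<and> alg_rel Q \<and> \<not> alg_rel (mpoly_deriv w Q)"
proof -
  define good where "good n Q \<longleftrightarrow> Q \<noteq> 0 \<and> mpoly_vars Q \<subseteq> insert w B \<and> alg_rel Q \<and>
    (\<forall>e\<in>Poly_Mapping.keys Q. Poly_Mapping.lookup e w \<le> n)" for n Q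
  obtain Q0 where Q0: "Q0 \<noteq> 0" "mpoly_vars Q0 \<subseteq> insert w B" "alg_rel Q0"
    using w by (auto simp: alg_indep_def)
  have "good (\<Sum>e\<in>Poly_Mapping.keys Q0. Poly_Mapping.lookup e w) Q0"
    using Q0 by (auto simp: good_def intro: member_le_sum)
  then have ex: "\<exists>n. \<exists>Q. good n Q" by blast
  define n where "n = (LEAST n. \<exists>Q. good n Q)"
  obtain Q where Q: "good n Q" using LeastI_ex[OF ex] by (auto simp: n_def)
  have min: "\<not> good m Q'" if "m < n" for m Q'
    using not_less_Least[of m "\<lambda>n. \<exists>Q. good n Q"] that by (auto simp: n_def)
  let ?s = "Poly_Mapping.single w (1::nat)"
  have "n \<noteq> 0"
  proof
    assume "n = 0"
    then have "w \<notin> mpoly_vars Q" using Q by (auto simp: good_def mpoly_vars_def in_keys_iff)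
    then have "mpoly_vars Q \<subseteq> B" using Q by (auto simp: good_def)
    then show False using Q B by (auto simp: good_def alg_indep_def)
  qed
  then obtain e where e: "e \<in> Poly_Mapping.keys Q" "Poly_Mapping.lookup e w = n"
    using min[of "n - 1" Q] Q by (fastforce simp: good_def)
  have "e - ?s + ?s = e"
    using e(2) \<open>n \<noteq> 0\<close> by (intro poly_mapping_eqI) (auto simp: lookup_add lookup_minus lookup_single when_def)
  \<comment> \<open>The monomial \<open>e\<close> of maximal degree \<open>n\<close> in
    \<open>w\<close> acquires the factor \<open>n\<close>, a nonzero scalar in characteristic
    0.\<close>
  then have "Poly_Mapping.lookup (mpoly_deriv w Q) (e - ?s) \<noteq> 0"
    using e(1) by (simp add: lookup_mpoly_deriv in_keys_iff del: of_nat_Suc)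
  then have nz: "mpoly_deriv w Q \<noteq> 0" by auto
  have key: "e' + ?s \<in> Poly_Mapping.keys Q" if "e' \<in> Poly_Mapping.keys (mpoly_deriv w Q)" for e'
    using that by (auto simp: in_keys_iff lookup_mpoly_deriv)
  have sub: "Poly_Mapping.keys e' \<subseteq> Poly_Mapping.keys (e' + ?s)" for e' :: "'w \<Rightarrow>\<^sub>0 nat"
    by (auto simp: in_keys_iff lookup_add)
  have "mpoly_vars (mpoly_deriv w Q) \<subseteq> mpoly_vars Q"
    using key sub unfolding mpoly_vars_def by blast
  moreover have "Poly_Mapping.lookup e' w \<le> n - 1" if "e' \<in> Poly_Mapping.keys (mpoly_deriv w Q)" for e'
    using key[OF that] Q by (fastforce simp: good_def lookup_add)
  ultimately have "alg_rel (mpoly_deriv w Q) \<Longrightarrow> good (n - 1) (mpoly_deriv w Q)"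
    using nz Q by (auto simp: good_def)
  then have "\<not> alg_rel (mpoly_deriv w Q)" using min[of "n - 1"] \<open>n \<noteq> 0\<close> by auto
  then show ?thesis using Q by (auto simp: good_def)
qed

text \<open>Along \<open>g + t D\<close> the relation is a polynomial in \<open>t\<close> that
  vanishes identically; this is its linear coefficient.\<close>

lemma alg_rel_diff:
  assumes "alg_rel Q" "finite S" "mpoly_vars Q \<subseteq> S"
  shows "(\<Sum>s\<in>S. mpoly_eval id (\<lambda>w. mpoly_eval id g (F w)) (mpoly_deriv s Q) * mpoly_diff g D (F s)) = 0"
proof -
  let ?c = "\<lambda>w. mpoly_eval (\<lambda>a. [:a:]) (\<lambda>j. [:g j, D j:]) (F w)"
  have "poly (mpoly_eval (\<lambda>a. [:a:]) ?c Q) t = 0" for t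
    using assms(1) by (simp add: mpoly_eval_comp[OF ring_morph_poly] poly_line_eval alg_rel_def id_def[symmetric])
  then have "mpoly_eval (\<lambda>a. [:a:]) ?c Q = 0" by (rule poly_eq_0_if_all_0)
  then show ?thesis
    using coeff_1_mpoly_eval[OF assms(2,3), of ?c] by (simp add: coeff_0_line_eval mpoly_diff_def)
qed

end

text \<open>At a generic \<open>g\<close> a direction \<open>D\<close> may be prescribed by its
  derivatives on the independent family \<open>B\<close>: the differentiated relations make this
  linear system injective, and \<open>card B \<le> card Y\<close> then makes it solvable. The
  function \<open>q\<close> carries an additional open condition on \<open>g\<close>, later that
  \<open>g\<close> is a group element.\<close>

lemma tangent_image:
  fixes \<Phi> :: "'v \<Rightarrow> ('y, 'a::field_char_0) mpoly" and q :: "('y \<Rightarrow> 'a) \<Rightarrow> 'a"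
  assumes S: "finite S" and Y: "finite Y" and \<Phi>: "\<And>v. v \<in> S \<Longrightarrow> mpoly_vars (\<Phi> v) \<subseteq> Y"
    and q: "line_poly q" "q y0 \<noteq> 0"
  shows "\<exists>g. q g \<noteq> 0 \<and> (\<forall>w.
    (\<forall>P. mpoly_vars P \<subseteq> S \<longrightarrow> alg_rel \<Phi> P \<longrightarrow>
      mpoly_diff (\<lambda>v. mpoly_eval id g (\<Phi> v)) w P = 0) \<longrightarrow>
    (\<exists>D. \<forall>v\<in>S. w v = mpoly_diff g D (\<Phi> v)))"
proof -
  define F where "F w = (case w of Inl v \<Rightarrow> \<Phi> v | Inr j \<Rightarrow> mpoly_var j)" for w
  have F_vars: "mpoly_vars (F w) \<subseteq> Y" if "w \<in> Inl ` S \<union> Inr ` Y" for w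
  proof (cases w)
    case (Inl v)
    then have "v \<in> S" using that by auto
    then show ?thesis using \<Phi> Inl by (simp add: F_def)
  next
    case (Inr j)
    then have "j \<in> Y" using that by auto
    then show ?thesis using Inr by (simp add: F_def mpoly_vars_var)
  qed
  have fin: "finite (Inl ` S \<union> Inr ` Y :: ('v + 'y) set)" using S Y by simp
  obtain B1 where B1: "B1 \<subseteq> Inl ` S" "alg_indep F B1"
    and B1_max: "\<And>B. B \<subseteq> Inl ` S \<Longrightarrow> alg_indep F B \<Longrightarrow> B1 \<subseteq> B \<Longrightarrow> B1 = B"
    using finite_has_maximal2[of "{B. B \<subseteq> Inl ` S \<and> alg_indep F B}" "{}"] S alg_indep_empty[of F]
    by auto
  have "B1 \<subseteq> Inl ` S \<union> Inr ` Y" using B1(1) by blast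
  then obtain B where B: "B \<subseteq> Inl ` S \<union> Inr ` Y" "alg_indep F B" "B1 \<subseteq> B"
    and B_max: "\<And>B'. B' \<subseteq> Inl ` S \<union> Inr ` Y \<Longrightarrow> alg_indep F B' \<Longrightarrow> B \<subseteq> B' \<Longrightarrow> B = B'"
    using finite_has_maximal2[of "{B. B \<subseteq> Inl ` S \<union> Inr ` Y \<and> alg_indep F B}" B1] fin B1 by auto
  have B_int: "B \<inter> Inl ` S = B1"
    using B1_max[of "B \<inter> Inl ` S"] B B1 alg_indep_subset[OF B(2)] by auto
  have finB: "finite B" "finite B1" using B fin by (meson finite_subset)+
  have card: "card B \<le> card Y"
    using alg_indep_card[OF Y finB(1) _ B(2)] B(1) F_vars by blast
  \<comment> \<open>The relation of a coordinate may involve only coordinates, because a tangent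
    vector of the image has no components in parameter directions; the relation of a parameter may
    involve all of \<open>B\<close>.\<close>
  define base where "base w = (case w of Inl _ \<Rightarrow> B1 | Inr _ \<Rightarrow> B)" for w :: "'v + 'y"
  define W where "W = (Inl ` S \<union> Inr ` Y) - B"
  have "\<exists>Q. mpoly_vars Q \<subseteq> insert w (base w) \<and> alg_rel F Q \<and> \<not> alg_rel F (mpoly_deriv w Q)" if w: "w \<in> W" for w
  proof (rule alg_dependent_deriv)
    show "alg_indep F (base w)" using B B1 by (auto simp: base_def split: sum.splits)
    show "\<not> alg_indep F (insert w (base w))"
    proof
      assume *: "alg_indep F (insert w (base w))"
      show False
      proof (cases w)
        case (Inl v)
        then have "B1 = insert w B1" using w * B1(1) by (intro B1_max) (auto simp: base_def W_def)
        then show False using w B(3) by (auto simp: W_def)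
      next
        case (Inr j)
        then have "B = insert w B" using w * B(1) by (intro B_max) (auto simp: base_def W_def)
        then show False using w by (auto simp: W_def)
      qed
    qed
  qed
  then obtain Q where Q: "\<And>w. w \<in> W \<Longrightarrow> mpoly_vars (Q w) \<subseteq> insert w (base w)"
    "\<And>w. w \<in> W \<Longrightarrow> alg_rel F (Q w)" "\<And>w. w \<in> W \<Longrightarrow> \<not> alg_rel F (mpoly_deriv w (Q w))"
    by metis
  define ev where "ev y w = mpoly_eval id y (F w)" for y w
  define R where "R i y = (case i of None \<Rightarrow> q y | Some w \<Rightarrow> mpoly_eval id (ev y) (mpoly_deriv w (Q w)))" for i y
  have lp: "line_poly (R i)" for i
  proof (cases i)
    case None then show ?thesis using q by (simp add: R_def[abs_def])
  next
    case (Some w)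
    have "line_poly (\<lambda>y. mpoly_eval id (\<lambda>w. mpoly_eval id y (F w)) (mpoly_deriv w (Q w)))"
      by (intro line_poly_mpoly_eval line_poly_coord)
    then show ?thesis by (simp add: Some R_def[abs_def] ev_def[abs_def])
  qed
  have "\<exists>y. \<forall>i\<in>insert None (Some ` W). R i y \<noteq> 0"
  proof (rule line_poly_common_nonzero[OF _ lp])
    show "finite (insert None (Some ` W))" using fin by (simp add: W_def)
    show "\<exists>y. R i y \<noteq> 0" if "i \<in> insert None (Some ` W)" for i
      using that q Q(3) by (auto simp: R_def alg_rel_def ev_def[abs_def])
  qed
  then obtain g where "\<forall>i\<in>insert None (Some ` W). R i g \<noteq> 0" ..
  then have g: "q g \<noteq> 0" and gW: "\<And>w. w \<in> W \<Longrightarrow> mpoly_eval id (ev g) (mpoly_deriv w (Q w)) \<noteq> 0"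
    by (auto simp: R_def)
  have base_fin: "finite (base w)" for w
    using finB by (auto simp: base_def split: sum.splits)
  have base_sub: "base w \<subseteq> B" for w
    using B by (auto simp: base_def split: sum.splits)
  have determ: "c w = 0" if w: "w \<in> W" and c: "\<And>b. b \<in> base w \<Longrightarrow> c b = 0"
    and rel: "(\<Sum>b\<in>insert w (base w). mpoly_eval id (ev g) (mpoly_deriv b (Q w)) * c b) = 0" for w c
  proof -
    have "w \<notin> base w" using w base_sub[of w] by (auto simp: W_def)
    then have "mpoly_eval id (ev g) (mpoly_deriv w (Q w)) * c w = 0"
      using rel c base_fin[of w] by simp
    then show ?thesis using gW[OF w] by simp
  qed
  have "\<exists>D. \<forall>v\<in>S. w v = mpoly_diff g D (\<Phi> v)"
    if w: "\<And>P. mpoly_vars P \<subseteq> S \<Longrightarrow> alg_rel \<Phi> P \<Longrightarrow> mpoly_diff (\<lambda>v. mpoly_eval id g (\<Phi> v)) w P = 0" for w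
  proof -
    \<comment> \<open>The components at parameters in \<open>B\<close> are free; 0 is an arbitrary
      choice.\<close>
    define r where "r b = (case b of Inl v \<Rightarrow> w v | Inr j \<Rightarrow> 0)" for b :: "'v + 'y"
    \<comment> \<open>For injectivity: if all derivatives on \<open>B\<close> vanish, the relation
      of each remaining parameter makes its derivative, which is \<open>D j\<close> itself, vanish
      too.\<close>
    have "\<exists>D. \<forall>b\<in>B. (\<Sum>j\<in>Y. mpoly_eval id g (mpoly_deriv j (F b)) * D j) = r b"
    proof (rule linear_system_solvable[OF finB(1) Y card], intro ballI)
      fix D j assume D: "\<forall>b\<in>B. (\<Sum>j\<in>Y. mpoly_eval id g (mpoly_deriv j (F b)) * D j) = 0" and j: "j \<in> Y"
      have DB: "mpoly_diff g D (F b) = 0" if "b \<in> B" for b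
        using D that B(1) mpoly_diff_sum[OF Y F_vars] by auto
      have "mpoly_diff g D (F (Inr j)) = 0"
      proof (cases "Inr j \<in> B")
        case False
        then have "Inr j \<in> W" using j by (simp add: W_def)
        then show ?thesis
        proof (rule determ)
          show "mpoly_diff g D (F b) = 0" if "b \<in> base (Inr j)" for b
            using that DB base_sub by blast
          show "(\<Sum>b\<in>insert (Inr j) (base (Inr j)). mpoly_eval id (ev g) (mpoly_deriv b (Q (Inr j))) * mpoly_diff g D (F b)) = 0"
            using alg_rel_diff[OF Q(2)[OF \<open>Inr j \<in> W\<close>] _ Q(1)[OF \<open>Inr j \<in> W\<close>]] base_fin
            by (simp add: ev_def[abs_def])
        qed
      qed (rule DB)
      then show "D j = 0" by (simp add: F_def mpoly_diff_var)
    qed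
    then obtain D where D: "\<And>b. b \<in> B \<Longrightarrow> mpoly_diff g D (F b) = r b"
      using mpoly_diff_sum[OF Y F_vars] B(1) by (metis subsetD)
    have "w v = mpoly_diff g D (\<Phi> v)" if v: "v \<in> S" for v
    proof (cases "Inl v \<in> B")
      case True
      then show ?thesis using D[OF True] by (simp add: F_def r_def)
    next
      case False
      then have vW: "Inl v \<in> W" using v by (simp add: W_def)
      let ?Q = "Q (Inl v)"
      \<comment> \<open>The relation of \<open>Inl v\<close> contains only coordinates, so renaming
        its variables gives a relation of \<open>\<Phi>\<close>, to which the assumption on
        \<open>w\<close> applies.\<close>
      define P where "P = mpoly_eval mpoly_const (\<lambda>s. mpoly_var (projl s)) ?Q"
      have Qv: "mpoly_vars ?Q \<subseteq> Inl ` S" using Q(1)[OF vW] B1 v by (auto simp: base_def)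
      have P_eval: "mpoly_eval h x P = mpoly_eval h (\<lambda>s. x (projl s)) ?Q" if "ring_morph h" for h :: "'a \<Rightarrow> 'c::comm_ring_1" and x
        by (simp add: P_def mpoly_eval_comp[OF ring_morph_mpoly_eval[OF that]] mpoly_eval_const[OF that] mpoly_eval_var[OF that])
      have "mpoly_vars P \<subseteq> S"
        unfolding P_def by (rule mpoly_vars_eval, rule mpoly_vars_var) (use Qv in auto)
      moreover have "alg_rel \<Phi> P"
        unfolding alg_rel_def
      proof
        fix y
        have "mpoly_eval id (\<lambda>w. mpoly_eval id y (\<Phi> w)) P = mpoly_eval id (\<lambda>w. mpoly_eval id y (F w)) ?Q"
          unfolding P_eval[OF ring_morph_id] by (rule mpoly_eval_cong) (use Qv in \<open>auto simp: F_def\<close>)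
        then show "mpoly_eval id (\<lambda>w. mpoly_eval id y (\<Phi> w)) P = 0"
          using Q(2)[OF vW] by (simp add: alg_rel_def)
      qed
      ultimately have "mpoly_diff (\<lambda>v. mpoly_eval id g (\<Phi> v)) w P = 0" by (rule w)
      also have "mpoly_diff (\<lambda>v. mpoly_eval id g (\<Phi> v)) w P = mpoly_diff (ev g) r ?Q"
        unfolding mpoly_diff_def P_eval[OF ring_morph_pCons]
        by (intro arg_cong2[where f = Polynomial.coeff] mpoly_eval_cong refl) (use Qv in \<open>auto simp: F_def ev_def r_def\<close>)
      also have "\<dots> = (\<Sum>b\<in>insert (Inl v) (base (Inl v)). mpoly_eval id (ev g) (mpoly_deriv b ?Q) * r b)"
        by (rule mpoly_diff_sum) (use base_fin Q(1)[OF vW] in auto)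
      finally have 1: "(\<Sum>b\<in>insert (Inl v) (base (Inl v)). mpoly_eval id (ev g) (mpoly_deriv b ?Q) * r b) = 0" .
      have "(\<Sum>b\<in>insert (Inl v) (base (Inl v)). mpoly_eval id (ev g) (mpoly_deriv b ?Q) * mpoly_diff g D (F b)) = 0"
        using alg_rel_diff[OF Q(2)[OF vW] _ Q(1)[OF vW]] base_fin by (simp add: ev_def[abs_def])
      \<comment> \<open>Both \<open>r\<close> and the derivatives along \<open>D\<close> satisfy the
        differentiated relation, and they agree on the base; hence they agree at
        \<open>Inl v\<close>.\<close>
      with 1 have "(\<Sum>b\<in>insert (Inl v) (base (Inl v)). mpoly_eval id (ev g) (mpoly_deriv b ?Q) * (r b - mpoly_diff g D (F b))) = 0"
        by (simp add: right_diff_distrib sum_subtractf)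
      moreover have "r b - mpoly_diff g D (F b) = 0" if "b \<in> base (Inl v)" for b
        using D[OF subsetD[OF base_sub that]] by simp
      ultimately have "r (Inl v) - mpoly_diff g D (F (Inl v)) = 0"
        using determ[OF vW, of "\<lambda>b. r b - mpoly_diff g D (F b)"] by blast
      then show ?thesis by (simp add: r_def F_def)
    qed
    then show ?thesis by blast
  qed
  then show ?thesis using g by blast
qed

section \<open>The tangent image\<close>

definition tang :: "('s::finite, 'a::comm_ring_1, 'm::finite, 'm) mps_mat \<Rightarrow> ('s, 'a, 'n::finite, 'n) mps_mat \<Rightarrow>
    ('s \<Rightarrow> ('s, 'a) mps) \<Rightarrow> ('s, 'a, 'm, 'n) mps_mat \<Rightarrow> ('s, 'a, 'm, 'n) mps_mat" where
  "tang u v \<xi> A = u ** A + A ** v + map_matrix (\<lambda>f. \<Sum>i\<in>UNIV. \<xi> i * pd i f) A"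

text \<open>
  A filtration of the Lie algebra of the group; \<open>lie_elems G 0\<close> is the whole Lie algebra, as
  automorphisms preserve the maximal ideal.
\<close>

definition lie_elems :: "grp \<Rightarrow> nat \<Rightarrow> (('s::finite, 'a::comm_ring_1, 'm::finite, 'm) mps_mat \<times>
    ('s, 'a, 'n::finite, 'n) mps_mat \<times> ('s \<Rightarrow> ('s, 'a) mps)) set" where
  "lie_elems G k = {(u, v, \<xi>). (G \<notin> {Grp_l, Grp_lr} \<longrightarrow> u = 0) \<and> (G \<notin> {Grp_r, Grp_lr} \<longrightarrow> v = 0) \<and>
     mat_ord_ge k u \<and> mat_ord_ge k v \<and> (\<forall>i. ord_ge (Suc k) (\<xi> i))}"

definition par_of :: "('s::finite, 'a, 'm::finite, 'm) mps_mat \<Rightarrow> ('s, 'a, 'n::finite, 'n) mps_mat \<Rightarrow>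
    ('s \<Rightarrow> ('s, 'a) mps) \<Rightarrow> ('s, 'm, 'n) par_ix \<Rightarrow> 'a" where
  "par_of u v \<xi> c = (case c of Inl (i, j, \<alpha>) \<Rightarrow> mps_nth (u $ i $ j) \<alpha>
     | Inr (Inl (i, j, \<alpha>)) \<Rightarrow> mps_nth (v $ i $ j) \<alpha> | Inr (Inr (i, \<alpha>)) \<Rightarrow> mps_nth (\<xi> i) \<alpha>)"

lemma par_U_of [simp]: "par_U (par_of u v \<xi>) = u"
  and par_V_of [simp]: "par_V (par_of u v \<xi>) = v"
  and par_X_of [simp]: "par_X (par_of u v \<xi>) = \<xi>"
  by (auto simp: par_U_def par_V_def par_X_def par_of_def vec_eq_iff mps_nth_inverse)

lemma par_supp_of:
  "(u, v, \<xi>) \<in> lie_elems G k \<Longrightarrow> par_supp G (par_of u v \<xi>)"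
  by (auto simp: lie_elems_def par_supp_def par_dom_def par_of_def zero_mps.rep_eq ord_ge_def mdeg_less_Suc_0
      split: sum.splits prod.splits)

lemma par_of_deg:
  "(u, v, \<xi>) \<in> lie_elems G k \<Longrightarrow> par_deg c < k \<Longrightarrow> par_of u v \<xi> c = 0"
  by (cases c rule: par_deg.cases)
     (auto simp: lie_elems_def par_of_def mat_ord_ge_def ord_ge_def)

lemma par_deriv_of:
  "par_deriv y (par_of u v \<xi>) A =
     u ** map_matrix (mps_subst (\<lambda>i. mps_X i + par_X y i)) A ** (mat 1 + par_V y) +
     (mat 1 + par_U y) ** map_matrix (mps_subst (\<lambda>i. mps_X i + par_X y i)) A ** v +
     (mat 1 + par_U y) ** dir_deriv (\<lambda>i. mps_X i + par_X y i) \<xi> A ** (mat 1 + par_V y)"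
  by (simp add: par_deriv_def Let_def)

lemma par_deriv_cong:
  "par_U z = par_U z' \<Longrightarrow> par_V z = par_V z' \<Longrightarrow> par_X z = par_X z' \<Longrightarrow> par_deriv y z A = par_deriv y z' A"
  by (simp add: par_deriv_def Let_def)

text \<open>Transport of a direction from the neutral element to \<open>y\<close>: applying the
  substitution to a derivation of \<open>A\<close> gives the derivative of the substitution in the
  transformed direction.\<close>

lemma par_act_tang:
  fixes y :: "('s::finite, 'm::finite, 'n::finite) par_ix \<Rightarrow> 'a::comm_ring_1"
  assumes y: "par_supp G y"
  defines "\<phi> \<equiv> mps_subst (\<lambda>i. mps_X i + par_X y i)"
  shows "par_act y (tang u v \<xi> A) =
    par_deriv y (par_of ((mat 1 + par_U y) ** map_matrix \<phi> u) (map_matrix \<phi> v ** (mat 1 + par_V y)) (\<lambda>i. \<phi> (\<xi> i))) A"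
proof -
  have o: "ord_ge (Suc 0) (mps_X i + par_X y i)" for i
    using par_supp_X[OF y] by (simp add: ord_ge_add)
  have \<phi>: "ring_morph \<phi>" unfolding \<phi>_def using o by (rule ring_morph_subst)
  have "map_matrix \<phi> (map_matrix (\<lambda>f. \<Sum>i\<in>UNIV. \<xi> i * pd i f) A) =
      dir_deriv (\<lambda>i. mps_X i + par_X y i) (\<lambda>i. \<phi> (\<xi> i)) A"
    by (simp add: dir_deriv_def map_matrix_comp ring_morph_sum[OF \<phi>] ring_morph_mult[OF \<phi>])
       (simp add: \<phi>_def)
  then show ?thesis
    unfolding par_deriv_of
    by (simp add: par_act_def subst_act_def tang_def \<phi>_def[symmetric] map_matrix_add[OF \<phi>]
        map_matrix_mult[OF \<phi>] matrix_add_ldistrib matrix_add_rdistrib matrix_mul_assoc)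
qed

lemma par_act_add: 
  fixes y :: "('s::finite, 'm::finite, 'n::finite) par_ix \<Rightarrow> 'a::comm_ring_1"
  assumes y: "par_supp G y"
  shows "par_act y (A + B) = par_act y A + par_act y B"
  using par_supp_X[OF y]
  by (simp add: par_act_def subst_act_def map_matrix_add[OF ring_morph_subst] ord_ge_add
      matrix_add_ldistrib matrix_add_rdistrib)

lemma par_act_diff: 
  fixes y :: "('s::finite, 'm::finite, 'n::finite) par_ix \<Rightarrow> 'a::comm_ring_1"
  assumes y: "par_supp G y"
  shows "par_act y (A - B) = par_act y A - par_act y B"
  using par_act_add[OF y, of "A - B" B] by simp

lemma mat_ord_ge_par_act: 
  fixes y :: "('s::finite, 'm::finite, 'n::finite) par_ix \<Rightarrow> 'a::comm_ring_1"
  assumes y: "par_supp G y" and A: "mat_ord_ge k A"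
  shows "mat_ord_ge k (par_act y A)"
proof -
  have "mat_ord_ge k (map_matrix (mps_subst (\<lambda>i. mps_X i + par_X y i)) A)"
    using A par_supp_X[OF y] by (simp add: mat_ord_ge_def ord_ge_subst ord_ge_add)
  then show ?thesis
    by (simp add: par_act_def subst_act_def mat_ord_ge_mult_left mat_ord_ge_mult_right)
qed

lemma map_matrix_ident: "map_matrix (\<lambda>x. x) A = A"
  by (simp add: vec_eq_iff)

lemma mat_ord_ge_ideal_mats: "A \<in> ideal_mats {f. ord_ge k f} \<longleftrightarrow> mat_ord_ge k A"
  by (simp add: ideal_mats_def mat_ord_ge_def)

text \<open>Taylor expansion modulo order \<open>k\<close>, where the linear part is negligible as
  well. It makes \<open>k\<close>-jets depend on finitely many parameters and lets the Newton
  iteration pass to the limit.\<close>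

lemma par_act_cong:
  fixes y y' :: "('s::finite, 'm::finite, 'n::finite) par_ix \<Rightarrow> 'a::comm_ring_1"
  assumes y: "par_supp G y" and y': "par_supp G y'" and eq: "\<And>c. par_deg c < k \<Longrightarrow> y c = y' c"
  shows "mat_ord_ge k (par_act y' A - par_act y A)"
proof -
  define z where "z c = y' c - y c" for c
  have z: "par_supp G z" using y y' by (simp add: par_supp_def z_def)
  have z0: "z c = 0" if "par_deg c < k" for c using eq[OF that] by (simp add: z_def)
  have zU: "ord_ge k (par_U z $ i $ j)" and zV: "ord_ge k (par_V z $ i' $ j')" and zX: "ord_ge k (par_X z l)"
    for i j i' j' l
    by (auto simp: par_U_def par_V_def par_X_def ord_ge_def z0)
  have "mat_ord_ge k (par_act (\<lambda>c. y c + z c) A - (par_act y A + par_deriv y z A))"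
    unfolding mat_ord_ge_ideal_mats[symmetric]
    by (rule par_act_taylor[OF closed_ideal_ord_ge y z]) (auto intro: ord_ge_mult_left zU zV zX)
  moreover have "mat_ord_ge k (par_deriv y z A)"
  proof -
    have "mat_ord_ge k (par_U z)" "mat_ord_ge k (par_V z)" "mat_ord_ge k (dir_deriv \<phi> (par_X z) A)" for \<phi>
      by (simp_all add: mat_ord_ge_def zU zV dir_deriv_def ord_ge_sum ord_ge_mult_right zX)
    then show ?thesis
      by (simp add: par_deriv_def Let_def mat_ord_ge_add mat_ord_ge_mult_left mat_ord_ge_mult_right)
  qed
  ultimately have "mat_ord_ge k (par_act (\<lambda>c. y c + z c) A - (par_act y A + par_deriv y z A) + par_deriv y z A)"
    by (rule mat_ord_ge_add)
  then show ?thesis by (simp add: z_def)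
qed

lemma par_act_inverse:
  fixes y :: "('s::finite, 'm::finite, 'n::finite) par_ix \<Rightarrow> 'a::field"
  assumes y: "par_supp G y" "par_det y \<noteq> 0"
  obtains U' V' \<psi> where "alg_aut \<psi>" "U' ** (mat 1 + par_U y) = mat 1" "(mat 1 + par_U y) ** U' = mat 1"
    "V' ** (mat 1 + par_V y) = mat 1" "(mat 1 + par_V y) ** V' = mat 1"
    "\<And>f. \<psi> (mps_subst (\<lambda>i. mps_X i + par_X y i) f) = f" "\<And>f. mps_subst (\<lambda>i. mps_X i + par_X y i) (\<psi> f) = f"
proof -
  from par_elem_in_grp[OF y] have g: "par_elem y \<in> grp_elems G" .
  have one: "\<exists>M'. M' ** M = mat 1 \<and> M ** M' = mat 1" if "M = mat 1 \<or> invertible M" for M :: "('s, 'a, 'q::finite, 'q) mps_mat"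
    using that by (auto simp: invertible_def)
  have aut: "alg_aut (mps_subst (\<lambda>i. mps_X i + par_X y i))"
    using g by (auto simp: par_elem_def grp_elems_def)
  have "mat 1 + par_U y = mat 1 \<or> invertible (mat 1 + par_U y)" "mat 1 + par_V y = mat 1 \<or> invertible (mat 1 + par_V y)"
    using g by (auto simp: par_elem_def grp_elems_def split: if_splits)
  from one[OF this(1)] one[OF this(2)] obtain U' V' where UV: "U' ** (mat 1 + par_U y) = mat 1" "(mat 1 + par_U y) ** U' = mat 1"
    "V' ** (mat 1 + par_V y) = mat 1" "(mat 1 + par_V y) ** V' = mat 1"
    by blast
  obtain \<psi> where \<psi>: "alg_aut \<psi>" "\<And>f. \<psi> (mps_subst (\<lambda>i. mps_X i + par_X y i) f) = f"
    "\<And>f. mps_subst (\<lambda>i. mps_X i + par_X y i) (\<psi> f) = f"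
    using alg_aut_inverse[OF aut] by metis
  show ?thesis by (rule that[OF \<psi>(1) UV \<psi>(2,3)])
qed

lemma mat_ord_ge_par_act_iff: 
  fixes y :: "('s::finite, 'm::finite, 'n::finite) par_ix \<Rightarrow> 'a::field"
  assumes y: "par_supp G y" "par_det y \<noteq> 0"
  shows "mat_ord_ge k (par_act y A) \<longleftrightarrow> mat_ord_ge k A"
proof
  assume *: "mat_ord_ge k (par_act y A)"
  obtain U' V' \<psi> where inv: "alg_aut \<psi>" "U' ** (mat 1 + par_U y) = mat 1" "(mat 1 + par_U y) ** U' = mat 1"
    "V' ** (mat 1 + par_V y) = mat 1" "(mat 1 + par_V y) ** V' = mat 1"
    "\<And>f. \<psi> (mps_subst (\<lambda>i. mps_X i + par_X y i) f) = f"
    by (rule par_act_inverse[OF y]) blast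
  let ?\<phi> = "mps_subst (\<lambda>i. mps_X i + par_X y i)"
  have "U' ** par_act y A ** V' = (U' ** (mat 1 + par_U y)) ** map_matrix ?\<phi> A ** ((mat 1 + par_V y) ** V')"
    by (simp only: par_act_def subst_act_def matrix_mul_assoc)
  also have "\<dots> = map_matrix ?\<phi> A" by (simp add: inv)
  finally have eq: "map_matrix ?\<phi> A = U' ** par_act y A ** V'" by simp
  have "mat_ord_ge k (map_matrix ?\<phi> A)"
    unfolding eq by (intro mat_ord_ge_mult_right mat_ord_ge_mult_left *)
  then have "mat_ord_ge k (map_matrix \<psi> (map_matrix ?\<phi> A))"
    by (simp add: mat_ord_ge_def alg_aut_ord_ge[OF inv(1)])
  then show "mat_ord_ge k A" by (simp add: map_matrix_comp inv map_matrix_ident)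
qed (rule mat_ord_ge_par_act[OF y(1)])

lemma par_act_surj: 
  fixes y :: "('s::finite, 'm::finite, 'n::finite) par_ix \<Rightarrow> 'a::field"
  assumes y: "par_supp G y" "par_det y \<noteq> 0"
  shows "\<exists>B. par_act y B = A"
proof -
  obtain U' V' \<psi> where inv: "alg_aut \<psi>" "U' ** (mat 1 + par_U y) = mat 1" "(mat 1 + par_U y) ** U' = mat 1"
    "V' ** (mat 1 + par_V y) = mat 1" "(mat 1 + par_V y) ** V' = mat 1"
    "\<And>f. mps_subst (\<lambda>i. mps_X i + par_X y i) (\<psi> f) = f"
    by (rule par_act_inverse[OF y]) blast
  have "par_act y (map_matrix \<psi> (U' ** A ** V')) = ((mat 1 + par_U y) ** U') ** A ** (V' ** (mat 1 + par_V y))"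
    unfolding par_act_def subst_act_def map_matrix_comp inv(6)
    by (simp add: matrix_mul_assoc map_matrix_ident)
  then show ?thesis by (auto simp: inv)
qed

text \<open>The converse transport, from \<open>y\<close> back to the neutral element, by the
  inverse group element. Automorphisms preserve the order, so \<open>\<xi>\<close> keeps zero
  constant terms.\<close>

lemma par_deriv_in_tangent:
  fixes y z :: "('s::finite, 'm::finite, 'n::finite) par_ix \<Rightarrow> 'a::field"
  assumes y: "par_supp G y" "par_det y \<noteq> 0" and z: "par_supp G z"
  shows "\<exists>u v \<xi>. (u, v, \<xi>) \<in> lie_elems G 0 \<and> par_deriv y z A = par_act y (tang u v \<xi> A)"
proof -
  obtain U' V' \<psi> where inv: "alg_aut \<psi>" "U' ** (mat 1 + par_U y) = mat 1" "(mat 1 + par_U y) ** U' = mat 1"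
    "V' ** (mat 1 + par_V y) = mat 1" "(mat 1 + par_V y) ** V' = mat 1"
    "\<And>f. mps_subst (\<lambda>i. mps_X i + par_X y i) (\<psi> f) = f"
    by (rule par_act_inverse[OF y]) blast
  have \<psi>: "ring_morph \<psi>" by (rule alg_aut_ring_morph[OF inv(1)])
  define u where "u = map_matrix \<psi> (U' ** par_U z)"
  define v where "v = map_matrix \<psi> (par_V z ** V')"
  define \<xi> where "\<xi> i = \<psi> (par_X z i)" for i
  have "par_deriv y z A = par_act y (tang u v \<xi> A)"
    unfolding par_act_tang[OF y(1)]
    by (rule par_deriv_cong)
       (simp_all add: u_def v_def \<xi>_def map_matrix_comp inv map_matrix_ident matrix_mul_assoc,
        simp_all add: matrix_mul_assoc[symmetric] inv)
  moreover have "(u, v, \<xi>) \<in> lie_elems G 0"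
  proof -
    have "u = 0" if "G \<notin> {Grp_l, Grp_lr}"
      using par_supp_U[OF z that] by (simp add: u_def matrix_matrix_mult_def vec_eq_iff ring_morph_0[OF \<psi>])
    moreover have "v = 0" if "G \<notin> {Grp_r, Grp_lr}"
      using par_supp_V[OF z that] by (simp add: v_def matrix_matrix_mult_def vec_eq_iff ring_morph_0[OF \<psi>])
    moreover have "ord_ge (Suc 0) (\<xi> i)" for i
      unfolding \<xi>_def by (rule alg_aut_ord_ge[OF inv(1) par_supp_X[OF z]])
    ultimately show ?thesis by (auto simp: lie_elems_def mat_ord_ge_def)
  qed
  ultimately show ?thesis by blast
qed

section \<open>First-order jets in a parameter\<close>

lemma jet_map: "h 0 = 0 \<Longrightarrow> jet k (map_matrix (mps_map h) A) v = h (jet k A v)"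
  by (simp add: jet_def mps_map.rep_eq split: prod.splits)

lemma jet_eq_iff_ord: "jet k A = jet k B \<longleftrightarrow> mat_ord_ge (Suc k) (A - B :: ('s::finite, 'a::comm_ring_1, 'm::finite, 'n::finite) mps_mat)"
  by (auto simp: jet_def mat_ord_ge_def ord_ge_def mps_nth_simps fun_eq_iff less_Suc_eq_le)

lemma closed_ideal_order2:
  "closed_ideal {f :: ('s::finite, 'a::comm_ring_1 poly) mps.
     \<forall>\<alpha>. Polynomial.coeff (mps_nth f \<alpha>) 0 = 0 \<and> Polynomial.coeff (mps_nth f \<alpha>) 1 = 0}"
  unfolding closed_ideal_def
proof (intro conjI ballI allI impI)
  fix f :: "('s, 'a poly) mps"
  assume *: "\<forall>k. \<exists>g\<in>{f. \<forall>\<alpha>. Polynomial.coeff (mps_nth f \<alpha>) 0 = 0 \<and> Polynomial.coeff (mps_nth f \<alpha>) 1 = 0}. ord_ge k (f - g)"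
  have "Polynomial.coeff (mps_nth f \<alpha>) 0 = 0 \<and> Polynomial.coeff (mps_nth f \<alpha>) 1 = 0" for \<alpha>
  proof -
    obtain g where g: "\<forall>\<alpha>. Polynomial.coeff (mps_nth g \<alpha>) 0 = 0 \<and> Polynomial.coeff (mps_nth g \<alpha>) 1 = 0"
      "ord_ge (Suc (mdeg \<alpha>)) (f - g)" using * by blast
    then have "mps_nth f \<alpha> = mps_nth g \<alpha>" by (simp add: ord_ge_def mps_nth_simps)
    then show ?thesis using g by simp
  qed
  then show "f \<in> {f. \<forall>\<alpha>. Polynomial.coeff (mps_nth f \<alpha>) 0 = 0 \<and> Polynomial.coeff (mps_nth f \<alpha>) 1 = 0}" by simp
qed (auto simp: mps_nth_simps times_mps.rep_eq coeff_sum coeff_mult_0 coeff_1_mult intro!: sum.neutral)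

lemma mps_nth_mult_coeff_0:
  fixes f g :: "('s::finite, 'a::comm_ring_1 poly) mps"
  assumes "\<And>\<alpha>. Polynomial.coeff (mps_nth f \<alpha>) 0 = 0" "\<And>\<alpha>. Polynomial.coeff (mps_nth g \<alpha>) 0 = 0"
  shows "Polynomial.coeff (mps_nth (f * g) \<alpha>) 0 = 0 \<and> Polynomial.coeff (mps_nth (f * g) \<alpha>) 1 = 0"
  using assms
  by (auto simp: times_mps.rep_eq coeff_sum coeff_mult_0 coeff_1_mult intro!: sum.neutral)

lemma map_matrix_const_mult:
  fixes c :: "'r::comm_ring_1"
  shows "map_matrix ((*) c) (A ** B) = map_matrix ((*) c) A ** B"
    and "map_matrix ((*) c) (A ** B) = A ** map_matrix ((*) c) B"
  by (simp_all add: vec_eq_iff matrix_matrix_mult_def sum_distrib_left ac_simps)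

lemma map_matrix_const_add:
  fixes c :: "'r::comm_ring_1"
  shows "map_matrix ((*) c) (A + B) = map_matrix ((*) c) A + map_matrix ((*) c) B"
  by (simp add: vec_eq_iff distrib_left)

lemma par_scale:
  fixes z :: "('s::finite, 'm::finite, 'n::finite) par_ix \<Rightarrow> 'a::comm_ring_1"
  shows "par_U (\<lambda>c. t * z c) = map_matrix ((*) (mps_const t)) (par_U z)"
    "par_V (\<lambda>c. t * z c) = map_matrix ((*) (mps_const t)) (par_V z)"
    "par_X (\<lambda>c. t * z c) i = mps_const t * par_X z i"
  by (auto simp: par_U_def par_V_def par_X_def vec_eq_iff intro!: mps_eqI)

lemma par_deriv_scale:
  "par_deriv y (\<lambda>c. t * z c) A = map_matrix ((*) (mps_const t)) (par_deriv y z A)"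
proof -
  have "dir_deriv \<phi> (\<lambda>i. mps_const t * \<xi> i) A = map_matrix ((*) (mps_const t)) (dir_deriv \<phi> \<xi> A)" for \<phi> \<xi>
    by (simp add: dir_deriv_def vec_eq_iff sum_distrib_left mult.assoc)
  then show ?thesis
    by (simp add: par_deriv_def Let_def par_scale map_matrix_const_add[symmetric] map_matrix_const_mult(1)[symmetric]
       map_matrix_const_mult(2)[symmetric] par_scale(3)[abs_def])
qed

lemma par_deriv_map:
  assumes h: "ring_morph h"
  shows "map_matrix (mps_map h) (par_deriv y z A) =
    par_deriv (\<lambda>c. h (y c)) (\<lambda>c. h (z c)) (map_matrix (mps_map h) A)"
proof -
  note H = ring_morph_mps_map[OF h]
  have "map_matrix (mps_map h) (dir_deriv \<phi> \<xi> A) =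
      dir_deriv (\<lambda>i. mps_map h (\<phi> i)) (\<lambda>i. mps_map h (\<xi> i)) (map_matrix (mps_map h) A)" for \<phi> \<xi>
    by (simp add: dir_deriv_def map_matrix_comp ring_morph_sum[OF H] ring_morph_mult[OF H] mps_map_subst[OF h] mps_map_pd[OF h])
  then show ?thesis
    by (simp add: par_deriv_def Let_def map_matrix_add[OF H] map_matrix_mult[OF H] map_matrix_comp
       par_U_map par_V_map par_X_map map_matrix_1[OF H] mps_map_subst[OF h] ring_morph_add[OF H] mps_map_X[OF h] par_X_map[abs_def])
qed

text \<open>Taylor expansion over K[t] with increment \<open>t z\<close>: products of two increments
  are divisible by t^2 and do not contribute to the coefficient of t.\<close>

lemma jet_par_act_line:
  fixes A :: "('s::finite, 'a::comm_ring_1, 'm::finite, 'n::finite) mps_mat"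
  assumes y: "par_supp G y" and z: "par_supp G z"
  shows "Polynomial.coeff (jet k (par_act (\<lambda>c. [:y c, z c:]) (map_matrix (mps_map (\<lambda>a. [:a:])) A)) v) 1 =
    jet k (par_deriv y z A) v"
proof -
  let ?C = "\<lambda>a :: 'a. [:a:]"
  let ?t = "[:0, 1:] :: 'a poly"
  let ?A = "map_matrix (mps_map ?C) A"
  define J where "J = {f :: ('s, 'a poly) mps.
     \<forall>\<alpha>. Polynomial.coeff (mps_nth f \<alpha>) 0 = 0 \<and> Polynomial.coeff (mps_nth f \<alpha>) 1 = 0}"
  note C = ring_morph_pCons[where 'a = 'a]
  have y': "par_supp G (\<lambda>c. ?C (y c))" and z': "par_supp G (\<lambda>c. ?t * ?C (z c))"
    using y z by (auto simp: par_supp_def)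
  have sc: "Polynomial.coeff (mps_nth (mps_const ?t * f) \<alpha>) 0 = 0" for f :: "('s, 'a poly) mps" and \<alpha>
    by (simp add: coeff_mult_0)
  have "par_act (\<lambda>c. ?C (y c) + ?t * ?C (z c)) ?A - (par_act (\<lambda>c. ?C (y c)) ?A + par_deriv (\<lambda>c. ?C (y c)) (\<lambda>c. ?t * ?C (z c)) ?A) \<in> ideal_mats J"
    unfolding J_def
    by (rule par_act_taylor[OF closed_ideal_order2 y' z'])
       (unfold par_scale nth_map_matrix mem_Collect_eq, (intro allI mps_nth_mult_coeff_0 sc)+)
  moreover have "(\<lambda>c. ?C (y c) + ?t * ?C (z c)) = (\<lambda>c. [:y c, z c:])" by auto
  ultimately have "Polynomial.coeff (mps_nth ((par_act (\<lambda>c. [:y c, z c:]) ?A - (par_act (\<lambda>c. ?C (y c)) ?A + par_deriv (\<lambda>c. ?C (y c)) (\<lambda>c. ?t * ?C (z c)) ?A)) $ i $ j) \<alpha>) 1 = 0" for i j \<alpha>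
    by (auto simp: J_def ideal_mats_def)
  then have main: "Polynomial.coeff (mps_nth (par_act (\<lambda>c. [:y c, z c:]) ?A $ i $ j) \<alpha>) 1 =
      Polynomial.coeff (mps_nth (par_act (\<lambda>c. ?C (y c)) ?A $ i $ j) \<alpha>) 1 +
      Polynomial.coeff (mps_nth (par_deriv (\<lambda>c. ?C (y c)) (\<lambda>c. ?t * ?C (z c)) ?A $ i $ j) \<alpha>) 1" for i j \<alpha>
    by (simp add: mps_nth_simps)
  have e1: "par_act (\<lambda>c. ?C (y c)) ?A = map_matrix (mps_map ?C) (par_act y A)"
    by (simp add: par_act_map[OF C])
  have e2: "par_deriv (\<lambda>c. ?C (y c)) (\<lambda>c. ?t * ?C (z c)) ?A = map_matrix ((*) (mps_const ?t)) (map_matrix (mps_map ?C) (par_deriv y z A))"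
    by (simp only: par_deriv_map[OF C] par_deriv_scale)
  show ?thesis
    using main unfolding e1 e2
    by (simp add: jet_def mps_map.rep_eq coeff_pCons_1 split: prod.splits) (simp add: One_nat_def)
qed

section \<open>The tangent space to the orbit of a jet\<close>

lemma ring_morph_to_ac: "ring_morph (to_ac :: 'a::field \<Rightarrow> _)"
  by (simp add: ring_morph_def)

lemma mps_map_mps_map: "mps_map g (mps_map h f) = mps_map (\<lambda>a. g (h a)) f"
  by (rule mps_eqI) (simp add: mps_map.rep_eq)

lemma map_matrix_mps_map_id: "map_matrix (mps_map id) A = A"
  by (auto simp: vec_eq_iff mps_map.rep_eq intro!: mps_eqI)

definition unjet :: "('m \<times> 'n \<times> (nat ^ 's) \<Rightarrow> 'a) \<Rightarrow> ('s::finite, 'a, 'm::finite, 'n::finite) mps_mat" where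
  "unjet x = (\<chi> i j. Abs_mps (\<lambda>\<alpha>. x (i, j, \<alpha>)))"

lemma jet_unjet: "(\<And>v. v \<notin> jet_coords k \<Longrightarrow> x v = 0) \<Longrightarrow> jet k (unjet x) = x"
  by (auto simp: jet_def unjet_def jet_coords_def fun_eq_iff)

lemma jet_outside: "v \<notin> jet_coords k \<Longrightarrow> jet k A v = 0"
  by (cases v) (simp add: jet_def jet_coords_def)

lemma unjet_map: "map_matrix (mps_map h) (unjet x) = unjet (\<lambda>v. h (x v))"
  by (auto simp: unjet_def vec_eq_iff mps_map.rep_eq intro!: mps_eqI)

lemma gen_eval:
  assumes h: "ring_morph h"
  shows "h (jet k (par_act p M) v) = jet k (par_act (\<lambda>c. h (p c)) (map_matrix (mps_map h) M)) v"
  using jet_map[of h k "par_act p M" v] by (simp add: ring_morph_0[OF h] par_act_map[OF h])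

lemma finite_par_deg: "finite {c :: ('s::finite, 'm::finite, 'n::finite) par_ix. par_deg c \<le> k}"
proof (rule finite_subset)
  let ?M = "{\<alpha> :: nat ^ 's. mdeg \<alpha> \<le> k}"
  show "{c :: ('s, 'm, 'n) par_ix. par_deg c \<le> k} \<subseteq>
      Inl ` (UNIV \<times> UNIV \<times> ?M) \<union> Inr ` (Inl ` (UNIV \<times> UNIV \<times> ?M) \<union> Inr ` (UNIV \<times> ?M))"
  proof
    fix c :: "('s, 'm, 'n) par_ix" assume "c \<in> {c. par_deg c \<le> k}"
    then show "c \<in> Inl ` (UNIV \<times> UNIV \<times> ?M) \<union> Inr ` (Inl ` (UNIV \<times> UNIV \<times> ?M) \<union> Inr ` (UNIV \<times> ?M))"
      by (cases c rule: par_deg.cases) auto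
  qed
  show "finite (Inl ` (UNIV \<times> UNIV \<times> ?M) \<union> Inr ` (Inl ` (UNIV \<times> UNIV \<times> ?M) \<union> Inr ` (UNIV \<times> ?M))
      :: ('s, 'm, 'n) par_ix set)"
    using finite_mdeg_le by (intro finite_UnI finite_imageI finite_cartesian_product) auto
qed

lemma grp_elem_par:
  fixes U :: "('s::finite, 'a::field, 'm::finite, 'm) mps_mat" and V :: "('s, 'a, 'n::finite, 'n) mps_mat"
  assumes "(U, V, \<phi>) \<in> grp_elems G"
  shows "\<exists>y. par_supp G y \<and> (\<forall>B. grp_act (U, V, \<phi>) B = par_act y B)"
proof -
  have \<phi>: "alg_aut \<phi>" using assms by (simp add: grp_elems_def)
  define y where "y = par_of (U - mat 1) (V - mat 1) (\<lambda>i. \<phi> (mps_X i) - mps_X i)"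
  have "(U - mat 1, V - mat 1, \<lambda>i. \<phi> (mps_X i) - mps_X i) \<in> lie_elems G 0"
    using assms alg_aut_ord_ge[OF \<phi> ord_ge_X]
    by (auto simp: grp_elems_def lie_elems_def mat_ord_ge_def ord_ge_diff split: if_splits)
  then have "par_supp G y" unfolding y_def by (rule par_supp_of)
  moreover have "grp_act (U, V, \<phi>) B = par_act y B" for B
    unfolding y_def par_act_def subst_act_def grp_act_def
    using alg_aut_eq_subst[OF \<phi>] by simp
  ultimately show ?thesis by blast
qed

lemma grp_act_comp:
  assumes "g \<in> grp_elems G" "h \<in> grp_elems G"
  shows "\<exists>k\<in>grp_elems G. \<forall>A. grp_act g (grp_act h A) = grp_act k A"
proof -
  obtain U V \<phi> where g: "g = (U, V, \<phi>)" by (cases g)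
  obtain U' V' \<phi>' where h: "h = (U', V', \<phi>')" by (cases h)
  have \<phi>: "alg_aut \<phi>" "alg_aut \<phi>'" using assms by (auto simp: g h grp_elems_def)
  note r = alg_aut_ring_morph[OF \<phi>(1)]
  have "grp_act g (grp_act h A) = grp_act (U ** map_matrix \<phi> U', map_matrix \<phi> V' ** V, \<lambda>f. \<phi> (\<phi>' f)) A" for A
    by (simp add: g h grp_act_def map_matrix_mult[OF r] map_matrix_comp matrix_mul_assoc)
  moreover have "(U ** map_matrix \<phi> U', map_matrix \<phi> V' ** V, \<lambda>f. \<phi> (\<phi>' f)) \<in> grp_elems G"
    using assms
    by (auto simp: g h grp_elems_def alg_aut_comp invertible_mult invertible_map_matrix[OF r] map_matrix_1[OF r]
        split: if_splits)
  ultimately show ?thesis by blast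
qed

lemma ring_morph_of_int: "ring_morph h \<Longrightarrow> h (of_int n) = of_int n"
  by (cases n) (auto simp: ring_morph_of_nat ring_morph_minus ring_morph_diff ring_morph_1)

lemma det_map_matrix: "ring_morph h \<Longrightarrow> det (map_matrix h M) = h (det M)"
  by (simp add: det_def ring_morph_simps ring_morph_of_int)

lemma par_det_map:
  assumes h: "ring_morph h" shows "par_det (\<lambda>c. h (y c)) = h (par_det y)"
proof -
  have 1: "mat 1 + map_matrix (\<lambda>f. mps_nth f 0) (map_matrix (mps_map h) M) =
      map_matrix h (mat 1 + map_matrix (\<lambda>f. mps_nth f 0) M)" for M
    by (simp add: vec_eq_iff mat_def mps_map.rep_eq ring_morph_simps[OF h])
  have 2: "mat 1 + (\<chi> i j. mps_nth (par_X (\<lambda>c. h (y c)) i) (axis j 1)) =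
      map_matrix h (mat 1 + (\<chi> i j. mps_nth (par_X y i) (axis j 1)))"
    by (simp add: vec_eq_iff mat_def mps_map.rep_eq ring_morph_simps[OF h] par_X_map)
  show ?thesis
    unfolding par_det_def par_U_map par_V_map 1 2 det_map_matrix[OF h] ring_morph_mult[OF h] ..
qed

lemma par_det_0: "par_det (\<lambda>_ :: ('s::finite, 'm::finite, 'n::finite) par_ix. 0 :: 'a::comm_ring_1) = 1"
proof -
  let ?z = "\<lambda>_ :: ('s, 'm, 'n) par_ix. 0 :: 'a"
  have "map_matrix (\<lambda>f. mps_nth f 0) (par_U ?z) = 0" "map_matrix (\<lambda>f. mps_nth f 0) (par_V ?z) = 0"
    "(\<chi> i j. mps_nth (par_X ?z i) (axis j 1)) = 0"
    by (simp_all add: vec_eq_iff par_U_def par_V_def par_X_def)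
  then show ?thesis by (simp add: par_det_def)
qed

lemma line_poly_par_det:
  assumes "\<And>c. line_poly (\<lambda>y. T y c)"
  shows "line_poly (\<lambda>y. par_det (T y))"
  unfolding par_det_def
  by (intro line_poly_mult line_poly_det)
     (auto simp: par_U_def par_V_def par_X_def mat_def intro!: line_poly_add line_poly_const assms)

lemma par_act_scale:
  fixes y :: "('s::finite, 'm::finite, 'n::finite) par_ix \<Rightarrow> 'a::comm_ring_1"
  assumes y: "par_supp G y"
  shows "par_act y (map_matrix ((*) (mps_const t)) A) = map_matrix ((*) (mps_const t)) (par_act y A)"
proof -
  have "map_matrix (mps_subst (\<lambda>i. mps_X i + par_X y i)) (map_matrix ((*) (mps_const t)) A) =
      map_matrix ((*) (mps_const t)) (map_matrix (mps_subst (\<lambda>i. mps_X i + par_X y i)) A)"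
    using par_supp_X[OF y] by (simp add: vec_eq_iff mps_subst_const_mult ord_ge_add)
  then show ?thesis
    by (simp add: par_act_def subst_act_def map_matrix_const_mult(1)) (simp flip: map_matrix_const_mult)
qed

lemma jet_par_act_cong:
  fixes y :: "('s::finite, 'm::finite, 'n::finite) par_ix \<Rightarrow> 'a::comm_ring_1"
  assumes y: "par_supp G y" and "jet k A = jet k B"
  shows "jet k (par_act y A) = jet k (par_act y B)"
  using assms mat_ord_ge_par_act[OF y, of "Suc k" "A - B"] by (simp add: jet_eq_iff_ord par_act_diff[OF y])

context
  fixes G :: grp and k :: nat and A :: "('s::finite, 'a::field_char_0, 'm::finite, 'n::finite) mps_mat"
begin

definition coords :: "('s, 'm, 'n) par_ix set" where
  "coords = {c \<in> par_dom G. par_deg c \<le> k}"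

text \<open>Parameters of degree above \<open>k\<close> do not influence a \<open>k\<close>-jet
  (\<open>jet_par_act_trunc\<close>). Setting them to 0 leaves the finitely many variables in
  \<open>coords\<close>.\<close>

definition trunc :: "(('s, 'm, 'n) par_ix \<Rightarrow> 'b::zero) \<Rightarrow> ('s, 'm, 'n) par_ix \<Rightarrow> 'b" where
  "trunc y c = (if c \<in> coords then y c else 0)"

lemma trunc_trunc: "trunc (trunc y) = trunc y"
  by (auto simp: trunc_def)

lemma finite_coords: "finite coords"
  by (rule finite_subset[OF _ finite_par_deg[of k]]) (auto simp: coords_def)

lemma par_supp_trunc: "par_supp G (trunc y)"
  by (simp add: par_supp_def trunc_def coords_def)

lemma jet_par_act_trunc:
  fixes y :: "('s, 'm, 'n) par_ix \<Rightarrow> 'b::comm_ring_1"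
  assumes "par_supp G y"
  shows "jet k (par_act (trunc y) B) = jet k (par_act y B)"
  unfolding jet_eq_iff_ord
  by (rule par_act_cong[OF assms par_supp_trunc])
     (use assms in \<open>auto simp: trunc_def coords_def par_supp_def\<close>)

text \<open>The coordinates of the \<open>k\<close>-jet of \<open>g A\<close> as polynomials in the parameters of \<open>g\<close>.\<close>

definition gen_orbit :: "'m \<times> 'n \<times> (nat ^ 's) \<Rightarrow> (('s, 'm, 'n) par_ix, 'a) mpoly" where
  "gen_orbit = jet k (par_act (trunc mpoly_var) (map_matrix (mps_map mpoly_const) A))"

lemma gen_orbit_eval:
  assumes h: "ring_morph h"
  shows "mpoly_eval h y (gen_orbit v) = jet k (par_act (trunc y) (map_matrix (mps_map h) A)) v"
proof -
  have "(\<lambda>c. mpoly_eval h y (trunc mpoly_var c)) = trunc y"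
    by (auto simp: trunc_def mpoly_eval_var[OF h] mpoly_eval_0[OF h])
  then show ?thesis
    unfolding gen_orbit_def gen_eval[OF ring_morph_mpoly_eval[OF h]]
    by (simp add: map_matrix_comp mps_map_mps_map mpoly_eval_const[OF h])
qed

text \<open>\<open>gen_orbit\<close> is unchanged by the evaluation that sends every variable
  outside \<open>coords\<close> to 0, so none of them occurs in it.\<close>

lemma vars_gen_orbit: "mpoly_vars (gen_orbit v) \<subseteq> coords"
proof -
  have "gen_orbit v = mpoly_eval mpoly_const (trunc mpoly_var) (gen_orbit v)"
    unfolding gen_orbit_eval[OF ring_morph_mpoly_const] trunc_trunc by (simp add: gen_orbit_def)
  moreover have "mpoly_vars (mpoly_eval mpoly_const (trunc mpoly_var) (gen_orbit v) :: (_, 'a) mpoly) \<subseteq> coords"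
    by (rule mpoly_vars_eval) (simp add: trunc_def mpoly_vars_var mpoly_vars_0)
  ultimately show ?thesis by simp
qed

text \<open>A relation holds at all rational parameters, invertible or not. By density of these it
  holds at all parameters over the closure, in particular at those of group elements.\<close>

lemma alg_rel_imp_vanishing:
  assumes P: "mpoly_vars P \<subseteq> jet_coords k" "alg_rel gen_orbit P"
  shows "P \<in> vanishing_ideal (jet_coords k) (jet_orbit G k A)"
  unfolding vanishing_ideal_def
proof (intro CollectI conjI P(1) ballI)
  fix z assume "z \<in> jet_orbit G k A"
  then obtain U V \<phi> where g: "(U, V, \<phi>) \<in> grp_elems G" and
    z: "z = jet k (grp_act (U, V, \<phi>) (map_matrix (mps_map to_ac) A))"
    unfolding jet_orbit_def by auto
  obtain y where y: "par_supp G y" "\<forall>B. grp_act (U, V, \<phi>) B = par_act y B"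
    using grp_elem_par[OF g] by blast
  have z': "z = (\<lambda>v. mpoly_eval to_ac (trunc y) (gen_orbit v))"
  proof
    show "z v = mpoly_eval to_ac (trunc y) (gen_orbit v)" for v
      by (simp add: z y trunc_trunc gen_orbit_eval[OF ring_morph_to_ac] jet_par_act_trunc[OF y(1)])
  qed
  have "mpoly_eval to_ac (\<lambda>v. mpoly_eval to_ac (trunc y) (gen_orbit v)) P = 0"
  proof (rule line_poly_zero_extend[where z = "trunc y" and
      F = "\<lambda>y. mpoly_eval to_ac (\<lambda>v. mpoly_eval to_ac y (gen_orbit v)) P", OF _ inj_to_ac _ finite_coords])
    show "line_poly (\<lambda>y. mpoly_eval to_ac (\<lambda>v. mpoly_eval to_ac y (gen_orbit v)) P)"
      by (intro line_poly_mpoly_eval line_poly_coord)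
    fix y :: "('s, 'm, 'n) par_ix \<Rightarrow> 'a"
    have "mpoly_eval to_ac (\<lambda>c. to_ac (y c)) (gen_orbit v) = to_ac (mpoly_eval id y (gen_orbit v))" for v
      by (simp add: mpoly_eval_comp[OF ring_morph_to_ac])
    then have "mpoly_eval to_ac (\<lambda>v. mpoly_eval to_ac (\<lambda>c. to_ac (y c)) (gen_orbit v)) P =
        to_ac (mpoly_eval id (\<lambda>v. mpoly_eval id y (gen_orbit v)) P)"
      by (simp add: mpoly_eval_comp[OF ring_morph_to_ac])
    then show "mpoly_eval to_ac (\<lambda>v. mpoly_eval to_ac (\<lambda>c. to_ac (y c)) (gen_orbit v)) P = 0"
      using P(2) by (simp add: alg_rel_def)
  next
    show "trunc y c \<in> range to_ac" if "c \<notin> coords" for c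
      using that by (auto simp: trunc_def intro!: image_eqI[of _ _ 0])
  qed
  then show "mpoly_eval to_ac z P = 0" by (simp add: z')
qed

lemma line_poly_trunc: "line_poly (\<lambda>y. par_det (trunc y))"
proof (rule line_poly_par_det)
  show "line_poly (\<lambda>y. trunc y c)" for c
    by (cases "c \<in> coords") (simp_all add: trunc_def line_poly_coord line_poly_const)
qed

text \<open>Composing a polynomial with the action of \<open>g\<close> preserves the vanishing ideal of the orbit,
  so the action of \<open>g\<close> maps the tangent space at \<open>A\<close> to the one at \<open>g A\<close>.\<close>

lemma tangent_translate:
  fixes g :: "('s, 'm, 'n) par_ix \<Rightarrow> 'a"
  assumes g: "par_supp G g" "par_det g \<noteq> 0"
    and P: "P \<in> vanishing_ideal (jet_coords k) (jet_orbit G k A)"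
    and W: "jet k W \<in> jet_tangent G k A"
  shows "mpoly_diff (jet k (par_act g A)) (jet k (par_act g W)) P = 0"
proof -
  let ?S = "jet_coords k :: ('m \<times> 'n \<times> (nat ^ 's)) set"
  let ?X = "\<lambda>v. if v \<in> ?S then mpoly_var v else 0"
  \<comment> \<open>The action of \<open>g\<close> on a generic \<open>k\<close>-jet, whose
    coordinates are the variables; hence \<open>P'\<close> below is \<open>P\<close> composed with
    the action of \<open>g\<close>.\<close>
  define M :: "'m \<times> 'n \<times> (nat ^ 's) \<Rightarrow> ('m \<times> 'n \<times> (nat ^ 's), 'a) mpoly"
    where "M = jet k (par_act (\<lambda>c. mpoly_const (g c)) (unjet ?X))"
  define P' where "P' = mpoly_eval mpoly_const M P"
  have M_eval: "mpoly_eval h x (M v) = jet k (par_act (\<lambda>c. h (g c)) (unjet (\<lambda>v. if v \<in> ?S then x v else 0))) v"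
    if h: "ring_morph h" for h :: "'a \<Rightarrow> 'b::comm_ring_1" and x v
  proof -
    have "(\<lambda>v. mpoly_eval h x (?X v)) = (\<lambda>v. if v \<in> ?S then x v else 0)"
      by (auto simp: mpoly_eval_var[OF h] mpoly_eval_0[OF h])
    then show ?thesis
      by (simp add: M_def gen_eval[OF ring_morph_mpoly_eval[OF h]] mpoly_eval_const[OF h] unjet_map)
  qed
  have P'_eval: "mpoly_eval h x P' =
      mpoly_eval h (jet k (par_act (\<lambda>c. h (g c)) (unjet (\<lambda>v. if v \<in> ?S then x v else 0)))) P"
    if h: "ring_morph h" for h :: "'a \<Rightarrow> 'b::comm_ring_1" and x
    by (simp add: P'_def mpoly_eval_comp[OF ring_morph_mpoly_eval[OF h]] mpoly_eval_const[OF h] M_eval[OF h])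
  have "mpoly_vars (M v) \<subseteq> ?S" for v
  proof -
    have "M v = mpoly_eval mpoly_const ?X (M v)"
      unfolding M_eval[OF ring_morph_mpoly_const] by (simp add: M_def cong: if_cong)
    moreover have "mpoly_vars (mpoly_eval mpoly_const ?X (M v) :: (_, 'a) mpoly) \<subseteq> ?S"
      by (rule mpoly_vars_eval) (simp add: mpoly_vars_var mpoly_vars_0)
    ultimately show ?thesis by simp
  qed
  then have P'_vars: "mpoly_vars P' \<subseteq> ?S" unfolding P'_def by (intro mpoly_vars_eval)
  have "P' \<in> vanishing_ideal ?S (jet_orbit G k A)"
    unfolding vanishing_ideal_def
  proof (intro CollectI conjI P'_vars ballI)
    fix z assume "z \<in> jet_orbit G k A"
    then obtain \<gamma> where \<gamma>: "\<gamma> \<in> grp_elems G" and z: "z = jet k (grp_act \<gamma> (map_matrix (mps_map to_ac) A))"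
      unfolding jet_orbit_def by blast
    let ?g = "\<lambda>c. to_ac (g c)"
    have g': "par_supp G ?g" using g by (simp add: par_supp_def)
    have "par_elem ?g \<in> grp_elems G"
      using par_elem_in_grp[OF g'] g by (simp add: par_det_map[OF ring_morph_to_ac])
    then obtain \<kappa> where \<kappa>: "\<kappa> \<in> grp_elems G" "\<And>B. par_act ?g (grp_act \<gamma> B) = grp_act \<kappa> B"
      using grp_act_comp[OF _ \<gamma>] par_act_elem by metis
    have e1: "(\<lambda>v. if v \<in> ?S then z v else 0) = z" by (auto simp: z jet_outside)
    have "jet k (unjet z) = jet k (grp_act \<gamma> (map_matrix (mps_map to_ac) A))"
      unfolding z by (rule jet_unjet) (rule jet_outside)
    note e2 = jet_par_act_cong[OF g' this]
    have "mpoly_eval to_ac z P' = mpoly_eval to_ac (jet k (par_act ?g (unjet z))) P"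
      by (simp only: P'_eval[OF ring_morph_to_ac] e1)
    also have "\<dots> = mpoly_eval to_ac (jet k (grp_act \<kappa> (map_matrix (mps_map to_ac) A))) P"
      by (simp only: e2 \<kappa>(2))
    also have "jet k (grp_act \<kappa> (map_matrix (mps_map to_ac) A)) \<in> jet_orbit G k A"
      unfolding jet_orbit_def using \<kappa>(1) by blast
    then have "mpoly_eval to_ac (jet k (grp_act \<kappa> (map_matrix (mps_map to_ac) A))) P = 0"
      using P by (simp add: vanishing_ideal_def)
    finally show "mpoly_eval to_ac z P' = 0" .
  qed
  then have d0: "mpoly_diff (jet k A) (jet k W) P' = 0"
    using W by (auto simp: jet_tangent_def zariski_tangent_def mpoly_diff_sum[OF finite_jet_coords P'_vars])
  \<comment> \<open>By linearity, \<open>g\<close> maps the line \<open>A + t W\<close> to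
    \<open>g A + t g W\<close>. So the differential of \<open>P'\<close> at \<open>A\<close> along
    \<open>W\<close> is that of \<open>P\<close> at \<open>g A\<close> along
    \<open>g W\<close>.\<close>
  have "jet k (par_act (\<lambda>c. [:g c:]) (unjet (\<lambda>v. if v \<in> ?S then [:jet k A v, jet k W v:] else 0))) =
      (\<lambda>v. [:jet k (par_act g A) v, jet k (par_act g W) v:])"
  proof
    fix v
    let ?C = "\<lambda>a :: 'a. [:a:]"
    let ?t = "[:0, 1:] :: 'a poly"
    note C = ring_morph_pCons[where 'a = 'a]
    have g': "par_supp G (\<lambda>c. ?C (g c))" using g by (simp add: par_supp_def)
    have "unjet (\<lambda>v. if v \<in> ?S then [:jet k A v, jet k W v:] else 0) =
        map_matrix (mps_map ?C) (unjet (jet k A)) + map_matrix ((*) (mps_const ?t)) (map_matrix (mps_map ?C) (unjet (jet k W)))"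
      by (auto simp: unjet_def vec_eq_iff mps_nth_simps mps_map.rep_eq jet_outside intro!: mps_eqI)
    also have "par_act (\<lambda>c. ?C (g c)) \<dots> = map_matrix (mps_map ?C) (par_act g (unjet (jet k A))) +
        map_matrix ((*) (mps_const ?t)) (map_matrix (mps_map ?C) (par_act g (unjet (jet k W))))"
      by (simp only: par_act_add[OF g'] par_act_scale[OF g'] par_act_map[OF C])
    finally have "jet k (par_act (\<lambda>c. ?C (g c)) (unjet (\<lambda>v. if v \<in> ?S then [:jet k A v, jet k W v:] else 0))) v =
        jet k (map_matrix (mps_map ?C) (par_act g (unjet (jet k A))) +
        map_matrix ((*) (mps_const ?t)) (map_matrix (mps_map ?C) (par_act g (unjet (jet k W))))) v"
      by simp
    also have "\<dots> = [:jet k (par_act g (unjet (jet k A))) v, jet k (par_act g (unjet (jet k W))) v:]"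
      by (auto simp: jet_def mps_nth_simps mps_map.rep_eq split: prod.splits)
    finally have "jet k (par_act (\<lambda>c. ?C (g c)) (unjet (\<lambda>v. if v \<in> ?S then [:jet k A v, jet k W v:] else 0))) v =
        [:jet k (par_act g (unjet (jet k A))) v, jet k (par_act g (unjet (jet k W))) v:]" .
    moreover have "jet k (par_act g (unjet (jet k B))) = jet k (par_act g B)" for B
      by (rule jet_par_act_cong[OF g(1)]) (rule jet_unjet, rule jet_outside)
    ultimately show "jet k (par_act (\<lambda>c. ?C (g c)) (unjet (\<lambda>v. if v \<in> ?S then [:jet k A v, jet k W v:] else 0))) v =
        [:jet k (par_act g A) v, jet k (par_act g W) v:]" by simp
  qed
  then show ?thesis
    using d0 by (simp add: mpoly_diff_def P'_eval[OF ring_morph_pCons])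
qed

lemma jet_tangent_subset:
  assumes W: "jet k W \<in> jet_tangent G k A"
  shows "\<exists>u v \<xi>. (u, v, \<xi>) \<in> lie_elems G 0 \<and> mat_ord_ge (Suc k) (W - tang u v \<xi> A)"
proof -
  let ?S = "jet_coords k :: ('m \<times> 'n \<times> (nat ^ 's)) set"
  \<comment> \<open>The neutral element witnesses that invertibility is a satisfiable open
    condition, so a generic \<open>g\<close> can be taken invertible.\<close>
  have "par_det (trunc (\<lambda>_. 0 :: 'a)) \<noteq> 0"
    by (simp add: trunc_def[abs_def] par_det_0)
  from tangent_image[where \<Phi> = gen_orbit and S = ?S, OF finite_jet_coords finite_coords vars_gen_orbit line_poly_trunc this]
  obtain g where g: "par_det (trunc g) \<noteq> 0" and
    tan: "\<forall>w. (\<forall>P. mpoly_vars P \<subseteq> ?S \<longrightarrow> alg_rel gen_orbit P \<longrightarrow>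
        mpoly_diff (\<lambda>v. mpoly_eval id g (gen_orbit v)) w P = 0) \<longrightarrow>
      (\<exists>D. \<forall>v\<in>?S. w v = mpoly_diff g D (gen_orbit v))"
    by (elim exE conjE)
  have gA: "(\<lambda>v. mpoly_eval id g (gen_orbit v)) = jet k (par_act (trunc g) A)"
    by (simp add: gen_orbit_eval[OF ring_morph_id] map_matrix_mps_map_id)
  have "\<exists>D. \<forall>v\<in>?S. jet k (par_act (trunc g) W) v = mpoly_diff g D (gen_orbit v)"
    by (rule tan[rule_format]) (simp only: gA tangent_translate[OF par_supp_trunc g alg_rel_imp_vanishing W])
  then obtain D where D: "\<And>v. v \<in> ?S \<Longrightarrow> jet k (par_act (trunc g) W) v = mpoly_diff g D (gen_orbit v)"
    by blast
  have "jet k (par_act (trunc g) W) = jet k (par_deriv (trunc g) (trunc D) A)"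
  proof
    fix v
    have "trunc (\<lambda>j. [:g j, D j:]) = (\<lambda>c. [:trunc g c, trunc D c:])"
      by (auto simp: trunc_def)
    then have "mpoly_diff g D (gen_orbit v) = jet k (par_deriv (trunc g) (trunc D) A) v"
      by (simp add: mpoly_diff_def gen_orbit_eval[OF ring_morph_pCons] jet_par_act_line[OF par_supp_trunc par_supp_trunc])
    then show "jet k (par_act (trunc g) W) v = jet k (par_deriv (trunc g) (trunc D) A) v"
      using D[of v] by (cases "v \<in> ?S") (auto simp: jet_outside)
  qed
  moreover obtain u v \<xi> where uv: "(u, v, \<xi>) \<in> lie_elems G 0"
    "par_deriv (trunc g) (trunc D) A = par_act (trunc g) (tang u v \<xi> A)"
    using par_deriv_in_tangent[OF par_supp_trunc g par_supp_trunc] by blast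
  \<comment> \<open>The action of an invertible \<open>g\<close> preserves the order in both
    directions, so it can be cancelled.\<close>
  ultimately have "mat_ord_ge (Suc k) (par_act (trunc g) (W - tang u v \<xi> A))"
    by (simp add: jet_eq_iff_ord par_act_diff[OF par_supp_trunc])
  then have "mat_ord_ge (Suc k) (W - tang u v \<xi> A)"
    by (simp add: mat_ord_ge_par_act_iff[OF par_supp_trunc g])
  then show ?thesis using uv by blast
qed

end

section \<open>Tangent vectors of high order\<close>

lemma tang_0: "tang 0 0 (\<lambda>_. 0) A = 0"
  by (simp add: tang_def vec_eq_iff matrix_matrix_mult_def)

lemma tang_add: "tang (u + u') (v + v') (\<lambda>i. \<xi> i + \<xi>' i) A = tang u v \<xi> A + tang u' v' \<xi>' A"
proof -
  have "map_matrix (\<lambda>f. \<Sum>i\<in>UNIV. (\<xi> i + \<xi>' i) * pd i f) A =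
      map_matrix (\<lambda>f. \<Sum>i\<in>UNIV. \<xi> i * pd i f) A + map_matrix (\<lambda>f. \<Sum>i\<in>UNIV. \<xi>' i * pd i f) A"
    by (simp add: vec_eq_iff distrib_right sum.distrib)
  then show ?thesis by (simp add: tang_def matrix_add_ldistrib matrix_add_rdistrib)
qed

text \<open>Linearity over the whole power series ring: the factor multiplies the direction, while
  the derivatives fall on \<open>A\<close> alone.\<close>

lemma tang_scale:
  "tang (map_matrix ((*) c) u) (map_matrix ((*) c) v) (\<lambda>i. c * \<xi> i) A = map_matrix ((*) c) (tang u v \<xi> A)"
proof -
  have "map_matrix (\<lambda>f. \<Sum>i\<in>UNIV. c * \<xi> i * pd i f) A = map_matrix ((*) c) (map_matrix (\<lambda>f. \<Sum>i\<in>UNIV. \<xi> i * pd i f) A)"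
    by (simp add: vec_eq_iff sum_distrib_left mult.assoc)
  then show ?thesis
    by (simp add: tang_def map_matrix_const_add map_matrix_const_mult(1)[of c u] map_matrix_const_mult(2)[of c A])
qed

lemma tang_sum:
  "tang (\<Sum>l\<in>L. map_matrix ((*) (c l)) (u l)) (\<Sum>l\<in>L. map_matrix ((*) (c l)) (v l)) (\<lambda>i. \<Sum>l\<in>L. c l * \<xi> l i) A =
    (\<Sum>l\<in>L. map_matrix ((*) (c l)) (tang (u l) (v l) (\<xi> l) A))"
  by (induction L rule: infinite_finite_induct) (simp_all add: tang_0 tang_add tang_scale)

lemma mat_ord_ge_sum: "(\<And>l. l \<in> L \<Longrightarrow> mat_ord_ge k (M l)) \<Longrightarrow>
    mat_ord_ge k (\<Sum>l\<in>L. M l :: (('s::finite, 'a::comm_ring_1) mps ^ _) ^ _)"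
  by (simp add: mat_ord_ge_def ord_ge_sum)

lemma mat_ord_ge_X_mult:
  "mat_ord_ge k M \<Longrightarrow> mat_ord_ge (Suc k) (map_matrix ((*) (mps_X l)) M)"
  for M :: "(('s::finite, 'a::comm_ring_1) mps ^ _) ^ _"
  by (auto simp: mat_ord_ge_def intro!: ord_ge_mult[OF ord_ge_X, of k, simplified])

text \<open>Writing \<open>W\<close> as a sum of variables times matrices of order one less, and
  multiplying the directions found for these by the same variables, raises the order of the
  direction and of the error by one each.\<close>

lemma tangent_high_order:
  fixes A :: "('s::finite, 'a::comm_ring_1, 'm::finite, 'n::finite) mps_mat"
  assumes base: "\<And>W. mat_ord_ge c W \<Longrightarrow>
    \<exists>u v \<xi>. (u, v, \<xi>) \<in> lie_elems G 0 \<and> mat_ord_ge (Suc c) (W - tang u v \<xi> A)"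
    and W: "mat_ord_ge (c + j) W"
  shows "\<exists>u v \<xi>. (u, v, \<xi>) \<in> lie_elems G j \<and> mat_ord_ge (Suc (c + j)) (W - tang u v \<xi> A)"
  using W
proof (induction j arbitrary: W)
  case 0
  then show ?case using base by simp
next
  case (Suc j)
  have "\<forall>i k. \<exists>g. W $ i $ k = (\<Sum>l\<in>UNIV. mps_X l * g l) \<and> (\<forall>l. ord_ge (c + j) (g l))"
    using Suc.prems by (auto simp: mat_ord_ge_def intro!: ord_ge_Suc_decomp)
  then obtain g where g: "\<And>i k. W $ i $ k = (\<Sum>l\<in>UNIV. mps_X l * g i k l)" "\<And>i k l. ord_ge (c + j) (g i k l)"
    by metis
  define W' where "W' l = (\<chi> i k. g i k l)" for l
  have W: "W = (\<Sum>l\<in>UNIV. map_matrix ((*) (mps_X l)) (W' l))"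
    by (simp add: vec_eq_iff g(1) W'_def)
  have "mat_ord_ge (c + j) (W' l)" for l by (simp add: mat_ord_ge_def W'_def g)
  from Suc.IH[OF this] have "\<forall>l. \<exists>u v \<xi>. (u, v, \<xi>) \<in> lie_elems G j \<and> mat_ord_ge (Suc (c + j)) (W' l - tang u v \<xi> A)"
    by blast
  then obtain u v \<xi> where uv: "\<And>l. (u l, v l, \<xi> l) \<in> lie_elems G j"
    "\<And>l. mat_ord_ge (Suc (c + j)) (W' l - tang (u l) (v l) (\<xi> l) A)" by metis
  let ?u = "\<Sum>l\<in>UNIV. map_matrix ((*) (mps_X l)) (u l)" and ?v = "\<Sum>l\<in>UNIV. map_matrix ((*) (mps_X l)) (v l)"
  let ?\<xi> = "\<lambda>i. \<Sum>l\<in>UNIV. mps_X l * \<xi> l i"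
  have "W - tang ?u ?v ?\<xi> A = (\<Sum>l\<in>UNIV. map_matrix ((*) (mps_X l)) (W' l - tang (u l) (v l) (\<xi> l) A))"
    unfolding tang_sum by (subst W) (simp add: vec_eq_iff sum_subtractf[symmetric] right_diff_distrib)
  also have "mat_ord_ge (Suc (c + Suc j)) \<dots>"
    using uv(2) by (intro mat_ord_ge_sum) (auto dest: mat_ord_ge_X_mult)
  finally have "mat_ord_ge (Suc (c + Suc j)) (W - tang ?u ?v ?\<xi> A)" .
  moreover have "(?u, ?v, ?\<xi>) \<in> lie_elems G (Suc j)"
  proof -
    have "mat_ord_ge (Suc j) ?u" "mat_ord_ge (Suc j) ?v"
      using uv(1) by (auto simp: lie_elems_def intro!: mat_ord_ge_sum mat_ord_ge_X_mult)
    moreover have "ord_ge (Suc (Suc j)) (?\<xi> i)" for i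
    proof (rule ord_ge_sum)
      fix l
      have "ord_ge (Suc j) (\<xi> l i)" using uv(1)[of l] by (simp add: lie_elems_def)
      from ord_ge_mult[OF ord_ge_X this] show "ord_ge (Suc (Suc j)) (mps_X l * \<xi> l i)" by simp
    qed
    moreover have "?u = 0" if "G \<notin> {Grp_l, Grp_lr}"
      using uv(1) that by (simp add: lie_elems_def vec_eq_iff)
    moreover have "?v = 0" if "G \<notin> {Grp_r, Grp_lr}"
      using uv(1) that by (simp add: lie_elems_def vec_eq_iff)
    ultimately show ?thesis unfolding lie_elems_def by blast
  qed
  ultimately show ?case by blast
qed

section \<open>Newton iteration\<close>

lemma newton_step:
  fixes A :: "('s::finite, 'a::field, 'm::finite, 'n::finite) mps_mat"
  assumes base: "\<And>W. mat_ord_ge c W \<Longrightarrow>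
      \<exists>u v \<xi>. (u, v, \<xi>) \<in> lie_elems G 0 \<and> mat_ord_ge (Suc c) (W - tang u v \<xi> A)"
    and y: "par_supp G y" "par_det y \<noteq> 0" and j: "j > c"
    and B: "mat_ord_ge (c + j) (B - par_act y A)"
  shows "\<exists>u v \<xi>. (u, v, \<xi>) \<in> lie_elems G j \<and>
    mat_ord_ge (Suc (c + j)) (B - par_act (\<lambda>i. y i + par_of u v \<xi> i) A)"
proof -
  \<comment> \<open>The error is pulled back to \<open>A\<close>, where tangent directions are
    available; the direction found there is then transported to \<open>y\<close>.\<close>
  obtain W where W: "par_act y W = B - par_act y A" using par_act_surj[OF y] by blast
  then have "mat_ord_ge (c + j) W" using B mat_ord_ge_par_act_iff[OF y] by metis
  from tangent_high_order[OF base this] obtain u v \<xi> where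
    uv: "(u, v, \<xi>) \<in> lie_elems G j" and W': "mat_ord_ge (Suc (c + j)) (W - tang u v \<xi> A)" by blast
  define \<phi> where "\<phi> = mps_subst (\<lambda>i. mps_X i + par_X y i)"
  have o: "ord_ge (Suc 0) (mps_X i + par_X y i)" for i
    using par_supp_X[OF y(1)] by (simp add: ord_ge_add)
  have \<phi>0: "\<phi> 0 = 0" unfolding \<phi>_def by (rule ring_morph_0[OF ring_morph_subst[OF o]])
  have \<phi>o: "ord_ge k f \<Longrightarrow> ord_ge k (\<phi> f)" for k f
    unfolding \<phi>_def by (rule ord_ge_subst[OF o])
  define u' where "u' = (mat 1 + par_U y) ** map_matrix \<phi> u"
  define v' where "v' = map_matrix \<phi> v ** (mat 1 + par_V y)"
  define \<xi>' where "\<xi>' i = \<phi> (\<xi> i)" for i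
  let ?z = "par_of u' v' \<xi>'"
  have "mat_ord_ge j (map_matrix \<phi> u)" "mat_ord_ge j (map_matrix \<phi> v)"
    using uv by (simp_all add: lie_elems_def mat_ord_ge_def \<phi>o)
  then have "mat_ord_ge j u'" "mat_ord_ge j v'"
    by (simp_all add: u'_def v'_def mat_ord_ge_mult_left mat_ord_ge_mult_right)
  moreover have "u = 0 \<Longrightarrow> u' = 0" "v = 0 \<Longrightarrow> v' = 0"
    by (simp_all add: u'_def v'_def matrix_matrix_mult_def vec_eq_iff \<phi>0)
  moreover have "ord_ge (Suc j) (\<xi>' i)" for i
    using uv by (simp add: lie_elems_def \<xi>'_def \<phi>o)
  ultimately have lie: "(u', v', \<xi>') \<in> lie_elems G j"
    using uv by (simp add: lie_elems_def)
  have tang: "par_act y (tang u v \<xi> A) = par_deriv y ?z A"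
    unfolding u'_def v'_def \<xi>'_def \<phi>_def by (rule par_act_tang[OF y(1)])
  have 2: "ord_ge (2 * j) (f * g)" if "ord_ge j f" "ord_ge j g" for f g :: "('s, 'a) mps"
    using ord_ge_mult[OF that] by (simp add: mult_2)
  have "ord_ge j (\<xi>' i)" "ord_ge j (u' $ k $ l)" "ord_ge j (v' $ k' $ l')" for i k l k' l'
    using lie ord_ge_mono[of "Suc j" "\<xi>' i" j] by (auto simp: lie_elems_def mat_ord_ge_def)
  then have "mat_ord_ge (2 * j) (par_act (\<lambda>i. y i + ?z i) A - (par_act y A + par_deriv y ?z A))"
    unfolding mat_ord_ge_ideal_mats[symmetric]
    by (intro par_act_taylor[OF closed_ideal_ord_ge y(1) par_supp_of[OF lie]]) (simp_all add: 2)
  \<comment> \<open>The quadratic error has order \<open>2 * j\<close>, and \<open>j > c\<close> is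
    exactly what brings it to \<open>Suc (c + j)\<close>.\<close>
  then have t: "mat_ord_ge (Suc (c + j)) (par_act (\<lambda>i. y i + ?z i) A - (par_act y A + par_deriv y ?z A))"
    by (rule mat_ord_ge_mono) (use j in simp)
  have eq: "B - par_act (\<lambda>i. y i + ?z i) A = par_act y (W - tang u v \<xi> A) -
      (par_act (\<lambda>i. y i + ?z i) A - (par_act y A + par_deriv y ?z A))"
    by (simp add: par_act_diff[OF y(1)] W tang)
  have "mat_ord_ge (Suc (c + j)) (B - par_act (\<lambda>i. y i + ?z i) A)"
    unfolding eq by (rule mat_ord_ge_diff[OF mat_ord_ge_par_act[OF y(1) W'] t])
  then show ?thesis using lie by blast
qed

text \<open>Both matrices are the identity modulo the maximal ideal, and the substitution is tangent
  to the identity. These are equations on single coordinates, so they pass to coordinatewise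
  limits.\<close>

definition par_unipotent :: "(('s::finite, 'm::finite, 'n::finite) par_ix \<Rightarrow> 'a::zero) \<Rightarrow> bool" where
  "par_unipotent y \<longleftrightarrow> (\<forall>c. par_deg c = 0 \<longrightarrow> y c = 0) \<and> (\<forall>i l. y (Inr (Inr (i, axis l 1))) = 0)"

lemma par_det_unipotent:
  fixes y :: "('s::finite, 'm::finite, 'n::finite) par_ix \<Rightarrow> 'a::comm_ring_1"
  assumes "par_unipotent y"
  shows "par_det y = 1"
proof -
  have "map_matrix (\<lambda>f. mps_nth f 0) (par_U y) = 0" "map_matrix (\<lambda>f. mps_nth f 0) (par_V y) = 0"
    "(\<chi> i j. mps_nth (par_X y i) (axis j 1)) = 0"
    using assms by (simp_all add: vec_eq_iff par_U_def par_V_def par_X_def par_unipotent_def)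
  then show ?thesis by (simp add: par_det_def)
qed

lemma par_act_0:
  fixes A :: "('s::finite, 'a::comm_ring_1, 'm::finite, 'n::finite) mps_mat"
  shows "par_act (\<lambda>_. 0) A = A"
proof -
  let ?z = "\<lambda>_ :: ('s, 'm, 'n) par_ix. 0 :: 'a"
  have "par_U ?z = 0" "par_V ?z = 0" "par_X ?z i = 0" for i
    by (auto simp: par_U_def par_V_def par_X_def vec_eq_iff zero_mps.rep_eq intro!: mps_eqI)
  then show ?thesis by (simp add: par_act_def subst_act_def mps_subst_id id_def map_matrix_ident)
qed

lemma determined_of_tangent:
  fixes A :: "('s::finite, 'a::field, 'm::finite, 'n::finite) mps_mat"
  assumes base: "\<And>W. mat_ord_ge c W \<Longrightarrow>
      \<exists>u v \<xi>. (u, v, \<xi>) \<in> lie_elems G 0 \<and> mat_ord_ge (Suc c) (W - tang u v \<xi> A)"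
    and B: "mat_ord_ge (c + Suc c) (B - A)"
  shows "B \<in> grp_orbit G A"
proof -
  \<comment> \<open>The offset \<open>Suc c\<close> keeps the order of the correction above
    \<open>c\<close> from the start, as the Newton step requires.\<close>
  define P where "P n y \<longleftrightarrow> par_supp G y \<and> par_unipotent y \<and> mat_ord_ge (c + (Suc c + n)) (B - par_act y A)" for n y
  define Q where "Q n y y' \<longleftrightarrow> (\<forall>i. par_deg i \<le> n \<longrightarrow> y i = y' i)" for n and y y' :: "('s, 'm, 'n) par_ix \<Rightarrow> 'a"
  have "\<exists>f. \<forall>n. P n (f n) \<and> Q n (f n) (f (Suc n))"
  proof (rule dependent_nat_choice)
    show "\<exists>y. P 0 y"
      using B by (intro exI[of _ "\<lambda>_. 0"]) (simp add: P_def par_supp_def par_unipotent_def par_act_0)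
    fix y n assume "P n y"
    then have y: "par_supp G y" "par_unipotent y" "mat_ord_ge (c + (Suc c + n)) (B - par_act y A)"
      by (auto simp: P_def)
    have "par_det y \<noteq> 0" using par_det_unipotent[OF y(2)] by simp
    from newton_step[OF base y(1) this _ y(3)] obtain u v \<xi> where
      lie: "(u, v, \<xi>) \<in> lie_elems G (Suc c + n)" and
      B': "mat_ord_ge (Suc (c + (Suc c + n))) (B - par_act (\<lambda>i. y i + par_of u v \<xi> i) A)" by auto
    let ?z = "par_of u v \<xi>"
    have z: "?z i = 0" if "par_deg i \<le> c + n" for i
      using par_of_deg[OF lie, of i] that by simp
    \<comment> \<open>The \<open>\<xi>\<close>-part of the correction has order at least 2, so the
      linear part of the substitution stays the identity.\<close>
    have "?z (Inr (Inr (i, axis l 1))) = 0" for i l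
      using lie by (simp add: lie_elems_def par_of_def ord_ge_def)
    then have "par_unipotent (\<lambda>i. y i + ?z i)"
      using y(2) z by (simp add: par_unipotent_def)
    moreover have "par_supp G (\<lambda>i. y i + ?z i)"
      using y(1) par_supp_of[OF lie] by (simp add: par_supp_def)
    moreover have "mat_ord_ge (c + (Suc c + Suc n)) (B - par_act (\<lambda>i. y i + ?z i) A)"
      using B' by simp
    ultimately show "\<exists>y'. P (Suc n) y' \<and> Q n y y'"
      using z by (intro exI[of _ "\<lambda>i. y i + ?z i"]) (simp add: P_def Q_def)
  qed
  then obtain f where P: "\<And>n. P n (f n)" and Q: "\<And>n. Q n (f n) (f (Suc n))" by blast
  have stable: "f n i = f m i" if "n \<le> m" "par_deg i \<le> n" for n m i
    using that(1)
  proof (induction m rule: dec_induct)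
    case (step m)
    then show ?case using Q[of m] that(2) by (auto simp: Q_def)
  qed simp
  \<comment> \<open>The limit of the iteration: from stage \<open>par_deg i\<close> on, the
    coordinate \<open>i\<close> is constant.\<close>
  define y where "y i = f (par_deg i) i" for i
  have y_eq: "y i = f n i" if "par_deg i \<le> n" for i n
    unfolding y_def using stable[OF that] by simp
  have supp: "par_supp G y" using P by (simp add: par_supp_def y_def P_def)
  have "par_unipotent y" using P by (simp add: par_unipotent_def y_def P_def)
  then have det: "par_det y \<noteq> 0" using par_det_unipotent by fastforce
  have "B = par_act y A"
  proof (rule mat_ord_ge_all_imp_eq)
    fix n
    have "mat_ord_ge n (B - par_act (f n) A)"
      using P[of n] by (auto simp: P_def intro: mat_ord_ge_mono)
    moreover have "mat_ord_ge n (par_act (f n) A - par_act y A)"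
      by (rule par_act_cong[OF supp]) (use P[of n] y_eq in \<open>auto simp: P_def\<close>)
    ultimately have "mat_ord_ge n ((B - par_act (f n) A) + (par_act (f n) A - par_act y A))"
      by (rule mat_ord_ge_add)
    then show "mat_ord_ge n (B - par_act y A)" by simp
  qed
  then show ?thesis
    using par_elem_in_grp[OF supp det] unfolding grp_orbit_def par_act_elem by blast
qed

section \<open>Finite codimension\<close>

lemma ideal_mats_max_pow: "A \<in> ideal_mats (ideal_pow max_ideal k) \<longleftrightarrow> mat_ord_ge k A"
  by (simp add: ideal_mats_def mat_ord_ge_def ideal_pow_ord_ge)

lemma coset_eq_iff:
  assumes "mps_mat.subspace T"
  shows "coset T A = coset T B \<longleftrightarrow> A - B \<in> T"
proof
  assume "coset T A = coset T B"
  moreover have "A \<in> coset T A" using mps_mat.subspace_0[OF assms] by (simp add: coset_def)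
  ultimately show "A - B \<in> T" by (simp add: coset_def)
next
  assume "A - B \<in> T"
  then have "C - A \<in> T \<longleftrightarrow> C - B \<in> T" for C
    using mps_mat.subspace_add[OF assms, of "C - A" "A - B"] mps_mat.subspace_diff[OF assms, of "C - B" "A - B"]
    by auto
  then show "coset T A = coset T B" by (auto simp: coset_def)
qed

lemma jet_sum: "jet k (\<Sum>x\<in>I. f x :: (_, 'a::comm_ring_1, _, _) mps_mat) v = (\<Sum>x\<in>I. jet k (f x) v)"
  by (induction I rule: infinite_finite_induct) (simp_all add: jet_0 jet_add)

text \<open>The classes of the finitely many monomial matrices up to degree \<open>N\<close> span
  the quotient, since \<open>T\<close> absorbs everything of higher order.\<close>

lemma finite_codimI:
  fixes T :: "('s::finite, 'a::field, 'm::finite, 'n::finite) mps_mat set"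
  assumes T: "mps_mat.subspace T" and N: "\<And>W. mat_ord_ge N W \<Longrightarrow> W \<in> T"
  shows "finite_codim T"
proof -
  define E :: "'m \<times> 'n \<times> (nat ^ 's) \<Rightarrow> ('s, 'a, 'm, 'n) mps_mat"
    where "E v = unjet (\<lambda>w. if w = v then 1 else 0)" for v
  let ?F = "E ` jet_coords N"
  have "\<exists>C\<in>mps_mat.span ?F. coset T B = coset T C" for B
  proof -
    define C where "C = (\<Sum>v\<in>jet_coords N. mat_scale (jet N B v) (E v))"
    have "jet N C = jet N B"
    proof
      fix w
      have "jet N C w = (\<Sum>v\<in>jet_coords N. jet N B v * jet N (E v) w)"
        by (simp add: C_def jet_sum jet_scale)
      also have "\<dots> = (\<Sum>v\<in>jet_coords N. if w = v then jet N B v else 0)"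
        by (rule sum.cong) (auto simp: E_def unjet_def jet_def jet_coords_def split: prod.splits)
      also have "\<dots> = jet N B w" by (auto simp: finite_jet_coords jet_outside)
      finally show "jet N C w = jet N B w" .
    qed
    then have "mat_ord_ge N (B - C)"
      using mat_ord_ge_mono[of "Suc N" "B - C" N] by (simp add: jet_eq_iff_ord[symmetric])
    then have "coset T B = coset T C" using N coset_eq_iff[OF T] by blast
    moreover have "C \<in> mps_mat.span ?F"
      unfolding C_def by (intro mps_mat.span_sum mps_mat.span_scale mps_mat.span_base) auto
    ultimately show ?thesis by blast
  qed
  then have "coset T B \<in> coset T ` mps_mat.span ?F" for B by (metis imageI)
  then have "range (coset T) = coset T ` mps_mat.span ?F" by auto
  then show ?thesis
    unfolding finite_codim_def by (intro exI[of _ ?F] conjI finite_imageI finite_jet_coords)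
qed

lemma tangent_space_closed:
  assumes "\<And>k. \<exists>C\<in>tangent_space G A. mat_ord_ge k (B - C)"
  shows "B \<in> tangent_space G A"
  unfolding tangent_space_def
proof (intro CollectI allI)
  fix k
  obtain C where C: "C \<in> tangent_space G A" "mat_ord_ge (Suc k) (B - C)" using assms by blast
  then have "jet k B = jet k C" by (simp add: jet_eq_iff_ord)
  then show "jet k B \<in> jet_tangent G k A" using C by (simp add: tangent_space_def)
qed

text \<open>The intersections \<open>L k\<close> of \<open>span F\<close> with the sum of
  \<open>T\<close> and the matrices of order \<open>k\<close> form a decreasing chain in a
  finite-dimensional space, so it is stationary from some \<open>N\<close> on. A representative in
  \<open>span F\<close> of a matrix of order \<open>N\<close> then lies in every \<open>L k\<close>,
  hence in the closure of \<open>T\<close>, which is \<open>T\<close>.\<close>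

lemma finite_codimD:
  fixes T :: "('s::finite, 'a::field, 'm::finite, 'n::finite) mps_mat set"
  assumes T: "mps_mat.subspace T"
    and closed: "\<And>B. (\<And>k. \<exists>C\<in>T. mat_ord_ge k (B - C)) \<Longrightarrow> B \<in> T"
    and "finite_codim T"
  shows "\<exists>N. \<forall>W. mat_ord_ge N W \<longrightarrow> W \<in> T"
proof -
  obtain F where F: "finite F" "range (coset T) = coset T ` mps_mat.span F"
    using assms(3) unfolding finite_codim_def by blast
  define L where "L k = mps_mat.span F \<inter> {B. \<exists>C\<in>T. mat_ord_ge k (B - C)}" for k
  have anti: "L l \<subseteq> L k" if "k \<le> l" for k l
    unfolding L_def using that mat_ord_ge_mono by blast
  have sub: "mps_mat.subspace (L k)" for k
    unfolding L_def
  proof (intro mps_mat.subspace_inter mps_mat.subspace_span mps_mat.subspaceI)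
    show "0 \<in> {B. \<exists>C\<in>T. mat_ord_ge k (B - C)}"
      using mps_mat.subspace_0[OF T] by (auto simp: mat_ord_ge_def intro!: bexI[of _ 0])
    fix x y assume "x \<in> {B. \<exists>C\<in>T. mat_ord_ge k (B - C)}" "y \<in> {B. \<exists>C\<in>T. mat_ord_ge k (B - C)}"
    then obtain C D where CD: "C \<in> T" "D \<in> T" "mat_ord_ge k (x - C)" "mat_ord_ge k (y - D)" by blast
    then have "C + D \<in> T" "mat_ord_ge k (x + y - (C + D))"
      using mps_mat.subspace_add[OF T] mat_ord_ge_add[OF CD(3,4)] by (auto simp: algebra_simps)
    then show "x + y \<in> {B. \<exists>C\<in>T. mat_ord_ge k (B - C)}" by blast
  next
    fix a x assume "x \<in> {B. \<exists>C\<in>T. mat_ord_ge k (B - C)}"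
    then obtain C where C: "C \<in> T" "mat_ord_ge k (x - C)" by blast
    have "mat_scale a x - mat_scale a C = mat_scale a (x - C)" by (simp add: mps_mat.scale_right_diff_distrib)
    moreover have "mat_ord_ge k (mat_scale a (x - C))"
      using C(2) by (simp add: mat_ord_ge_def mat_scale_def ord_ge_mult_left)
    ultimately show "mat_scale a x \<in> {B. \<exists>C\<in>T. mat_ord_ge k (B - C)}"
      using mps_mat.subspace_scale[OF T C(1), of a] by (auto intro!: bexI[of _ "mat_scale a C"])
  qed
  define d where "d k = mps_mat.dim (L k)" for k
  \<comment> \<open>A space of minimal dimension in the decreasing chain is contained in all
    others.\<close>
  obtain N where N: "\<And>k. d N \<le> d k"
    using ex_has_least_nat[of "\<lambda>_. True" 0 d] by auto
  have "L N \<subseteq> L k" for k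
  proof (cases "N \<le> k")
    case True
    obtain B where B: "B \<subseteq> L k" "mps_mat.independent B" "L k \<subseteq> mps_mat.span B" "card B = d k"
      using mps_mat.basis_exists[of "L k"] unfolding d_def by metis
    obtain B0 where B0: "B0 \<subseteq> L N" "mps_mat.independent B0" "L N \<subseteq> mps_mat.span B0" "card B0 = d N"
      using mps_mat.basis_exists[of "L N"] unfolding d_def by metis
    have fin: "finite B0" "finite B"
      using mps_mat.independent_span_bound[OF F(1) B0(2)] mps_mat.independent_span_bound[OF F(1) B(2)] B0(1) B(1)
      by (auto simp: L_def)
    show ?thesis
    proof
      fix x assume x: "x \<in> L N"
      have "x \<in> mps_mat.span B"
      proof (rule ccontr)
        assume "x \<notin> mps_mat.span B"
        then have "mps_mat.independent (insert x B)" "x \<notin> B"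
          using B(2) by (auto simp: mps_mat.independent_insert mps_mat.span_base)
        moreover have "insert x B \<subseteq> mps_mat.span B0" using x B(1) anti[OF True] B0(3) by blast
        ultimately have "card (insert x B) \<le> card B0"
          using mps_mat.independent_span_bound[OF fin(1)] by blast
        then show False using N[of k] B(4) B0(4) fin(2) \<open>x \<notin> B\<close> by simp
      qed
      then show "x \<in> L k" using mps_mat.span_minimal[OF B(1) sub] by blast
    qed
  next
    case False
    then show ?thesis by (intro anti) simp
  qed
  moreover have "W \<in> T" if W: "mat_ord_ge N W" and LN: "\<And>k. L N \<subseteq> L k" for W
  proof -
    obtain C where C: "C \<in> mps_mat.span F" "coset T W = coset T C" using F(2) by blast
    then have "W - C \<in> T" using coset_eq_iff[OF T] by blast
    then have "C - W \<in> T" using mps_mat.subspace_neg[OF T, of "W - C"] by simp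
    then have "C \<in> L N"
      using C(1) W unfolding L_def by (auto intro!: bexI[of _ "C - W"])
    then have "\<exists>D\<in>T. mat_ord_ge k (C - D)" for k using LN[of k] by (auto simp: L_def)
    then have "C \<in> T" by (rule closed)
    then show "W \<in> T" using mps_mat.subspace_add[OF T _ \<open>W - C \<in> T\<close>, of C] by simp
  qed
  ultimately show ?thesis by blast
qed

section \<open>Determinacy implies finite codimension\<close>

text \<open>An automorphism over the ground field does not act on series over the closure. It is
  replaced by the substitution of the same images of the variables, and \<open>mps_map_subst\<close>
  gives the compatibility.\<close>

lemma grp_orbit_extend:
  fixes A :: "('s::finite, 'a::field, 'm::finite, 'n::finite) mps_mat"
  assumes "B \<in> grp_orbit G A"
  shows "(\<lambda>v. to_ac (jet k B v)) \<in> jet_orbit G k A"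
proof -
  obtain U V \<phi> where g: "(U, V, \<phi>) \<in> grp_elems G" and B: "B = U ** map_matrix \<phi> A ** V"
    using assms by (auto simp: grp_orbit_def grp_act_def)
  have \<phi>: "alg_aut \<phi>" using g by (simp add: grp_elems_def)
  note R = ring_morph_to_ac[where 'a = 'a]
  note M = ring_morph_mps_map[OF R]
  let ?h = "map_matrix (mps_map to_ac)"
  define \<psi> where "\<psi> = mps_subst (\<lambda>i. mps_map to_ac (\<phi> (mps_X i)))"
  have \<psi>: "alg_aut \<psi>" unfolding \<psi>_def by (rule alg_aut_extend[OF \<phi> R])
  have "mps_map to_ac (\<phi> f) = \<psi> (mps_map to_ac f)" for f
    using fun_cong[OF alg_aut_eq_subst[OF \<phi>], of f] by (metis \<psi>_def mps_map_subst[OF R])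
  then have "?h B = grp_act (?h U, ?h V, \<psi>) (?h A)"
    by (simp add: B grp_act_def map_matrix_mult[OF M] map_matrix_comp)
  moreover have "(?h U, ?h V, \<psi>) \<in> grp_elems G"
    using g \<psi> by (auto simp: grp_elems_def invertible_map_matrix[OF M] map_matrix_1[OF M] split: if_splits)
  ultimately have "jet k (?h B) \<in> jet_orbit G k A" unfolding jet_orbit_def by force
  moreover have "jet k (?h B) = (\<lambda>v. to_ac (jet k B v))" by (rule ext) (simp add: jet_map)
  ultimately show ?thesis by simp
qed

lemma determined_imp_tangent:
  fixes A :: "('s::finite, 'a::field_char_0, 'm::finite, 'n::finite) mps_mat"
  assumes det: "determined G k A" and W: "mat_ord_ge (Suc k) W"
  shows "W \<in> tangent_space G A"
  unfolding tangent_space_def jet_tangent_def zariski_tangent_def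
proof (intro CollectI allI conjI impI ballI jet_outside)
  fix l and f assume f: "f \<in> vanishing_ideal (jet_coords l) (jet_orbit G l A)"
  let ?p = "mpoly_eval (\<lambda>a. [:a:]) (\<lambda>v. [:jet l A v, jet l W v:]) f"
  have "poly ?p t = 0" for t
  proof -
    have "A + mat_scale t W - A \<in> ideal_mats (ideal_pow max_ideal (k + 1))"
      unfolding ideal_mats_max_pow Suc_eq_plus1[symmetric] using W by (simp add: mat_ord_ge_def mat_scale_def ord_ge_mult_left)
    then have "A + mat_scale t W \<in> grp_orbit G A"
      using det unfolding determined_def by blast
    from grp_orbit_extend[OF this, of l]
    have "mpoly_eval to_ac (\<lambda>v. to_ac (jet l A v + t * jet l W v)) f = 0"
      using f by (simp add: vanishing_ideal_def jet_add jet_scale)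
    then have "to_ac (mpoly_eval id (\<lambda>v. jet l A v + t * jet l W v) f) = 0"
      by (simp add: mpoly_eval_comp[OF ring_morph_to_ac])
    then show ?thesis by (simp add: poly_line_eval)
  qed
  then have "?p = 0" by (rule poly_eq_0_if_all_0)
  then have "mpoly_diff (jet l A) (jet l W) f = 0" by (simp add: mpoly_diff_def)
  then show "(\<Sum>v\<in>jet_coords l. mpoly_eval id (jet l A) (mpoly_deriv v f) * jet l W v) = 0"
    using f mpoly_diff_sum[OF finite_jet_coords, of f l "jet l A" "jet l W"]
    by (simp add: vanishing_ideal_def)
qed

theorem corollary4p4:
  fixes G :: grp
    and A :: "(('s::finite, 'k::field_char_0) mps ^ 'n::finite) ^ 'm::finite"
  assumes "A \<in> ideal_mats max_ideal"
  shows "finitely_determined G A \<longleftrightarrow> finite_codim (tangent_space G A)"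
proof
  assume "finitely_determined G A"
  then obtain k where "determined G k A" by (auto simp: finitely_determined_def)
  then show "finite_codim (tangent_space G A)"
    by (intro finite_codimI[OF subspace_tangent_space determined_imp_tangent])
next
  assume "finite_codim (tangent_space G A)"
  from finite_codimD[OF subspace_tangent_space tangent_space_closed this]
  obtain c where c: "\<And>W. mat_ord_ge c W \<Longrightarrow> W \<in> tangent_space G A" by blast
  \<comment> \<open>Of the tangent condition on \<open>W\<close> only the jet of order
    \<open>c\<close> is used; it yields an error of order \<open>Suc c\<close>.\<close>
  have base: "\<exists>u v \<xi>. (u, v, \<xi>) \<in> lie_elems G 0 \<and> mat_ord_ge (Suc c) (W - tang u v \<xi> A)"
    if "mat_ord_ge c W" for W
    using c[OF that] by (intro jet_tangent_subset) (simp add: tangent_space_def)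
  \<comment> \<open>The iteration starts from a difference of order \<open>2 * c + 1\<close>, which
    would give the bound \<open>2 * c\<close>; one is added to make the bound positive also for
    \<open>c = 0\<close>.\<close>
  have "determined G (2 * c + 1) A"
    unfolding determined_def ideal_mats_max_pow
    by (auto intro!: determined_of_tangent[OF base] elim: mat_ord_ge_mono)
  then show "finitely_determined G A" unfolding finitely_determined_def by (intro exI[of _ "2 * c + 1"]) simp
qed

end
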